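(* The following isomorphisms hold: $\mathrm{Out}\,C_1^4\simeq\mathbb Z_2^3\rtimes GL_3(2)$, $\mathrm{Out}\,C_2^4\simeq\mathbb Z_2^3\rtimes S_4$, $\mathrm{Out}\,C_3^4\simeq\mathbb Z_2^3\rtimes S_4$, $\mathrm{Out}\,C_4^4\simeq\mathbb Z_2^3\rtimes D_8$, $\mathrm{Out}\,C_5^4\simeq S_4\times\mathbb Z_2$, $\mathrm{Out}\,C_6^4\simeq GL_3(2)$, $\mathrm{Out}\,C_7^4\simeq S_4$, $\mathrm{Out}\,C_8^4\simeq S_4$, $\mathrm{Out}\,C_9^4\simeq D_8$, $\mathrm{Out}\,C_{10}^4\simeq S_3\times\mathbb Z_2$, $\mathrm{Out}\,C_{11}^4\simeq S_3\times\mathbb Z_2$, $\mathrm{Out}\,C_{12}^4\simeq D_8$, $\mathrm{Out}\,C_{13}^4\simeq S_4$, $\mathrm{Out}\,C_{14}^4\simeq\mathbb Z_2^3\rtimes S_3$, $\mathrm{Out}\,C_{15}^4\simeq\mathbb Z_2^3\rtimes S_3$, $\mathrm{Out}\,C_{16}^4\simeq\mathbb Z_2^3$.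
   Context: For $u,v,w\in\mathbf F_2^m$ let $|v|$ be the number of coordinates equal to $1$, and $|u\cap v|$, $|u\cap v\cap w|$ the number of coordinates where all listed vectors equal $1$. A double even code is a subspace $V\subseteq\mathbf F_2^m$ with $|v|\equiv0\pmod 4$ and $|u\cap v|\equiv 0\pmod 2$ for all $u,v\in V$. There is a function $\phi:V\times V\to\{1,-1\}$ with $\phi(v,v)=(-1)^{|v|/4}$, $\phi(v,w)=(-1)^{|v\cap w|/2}\phi(w,v)$, $\phi(0,v)=\phi(v,0)=1$, $\phi(v+w,u)=\phi(v,w+u)\phi(v,w)\phi(w,u)(-1)^{|v\cap w\cap u|}$. The code loop $L(V)$ is the set $\{1,-1\}\times V$ with product $(\epsilon,v)(\delta,w)=(\epsilon\delta\,\phi(v,w),v+w)$; it is a Moufang loop, of rank $\dim_{\mathbf F_2}V$. A code loop is a loop isomorphic to some $L(V)$. Commutators: $[x,y]=x^{-1}y^{-1}xy$; associators: $(x,y,z)=((xy)z)(x(yz))^{-1}$. A nonassociative code loop $L$ of rank $4$ has generators $a,b,c,d$ (elements whose images form a basis of $L/\{\pm1\}$) with $(a,b,c)=-1$ and $(d,L,L)=1$. Its characteristic vector with respect to them is $(\lambda_1\dots\lambda_{10})\in\mathbf F_2^{10}$ given by $a^2=(-1)^{\lambda_1}$, $b^2=(-1)^{\lambda_2}$, $c^2=(-1)^{\lambda_3}$, $d^2=(-1)^{\lambda_4}$, $[a,b]=(-1)^{\lambda_5}$, $[a,c]=(-1)^{\lambda_6}$, $[a,d]=(-1)^{\lambda_7}$,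 $[b,c]=(-1)^{\lambda_8}$, $[b,d]=(-1)^{\lambda_9}$, $[c,d]=(-1)^{\lambda_{10}}$; it determines the loop up to isomorphism. $C_1^4,\dots,C_{16}^4$ are the nonassociative code loops of rank $4$ with characteristic vectors, in order: $(1110110100)$, $(0000000000)$, $(0000110100)$, $(0010100000)$, $(0000010100)$, $(1111110100)$, $(0001000000)$, $(0000001000)$, $(0100001000)$, $(0001111000)$, $(0001001000)$, $(0000001100)$, $(0110111100)$, $(0001001100)$, $(1001001100)$, $(0001111100)$. For a code loop $L$, $\mathrm{Out}\,L=\mathrm{Aut}\,L/N(\mathrm{Aut}\,L)$, where $N(\mathrm{Aut}\,L)=\{\phi\in\mathrm{Aut}\,L : \phi(x)=\pm x\ \forall x\in L\}$. $H\times K$ is the direct product; $H\rtimes K$ is a semidirect product of $H$ (normal) and $K$, the action not being specified. $D_8$ is the dihedral group of order $8$, $S_n$ the symmetric group on $n$ letters, $\mathbb Z_2$ the cyclic group of order $2$. *)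

theory Defs
  imports
    "HOL-Library.Z2"
    "HOL-Library.Function_Algebras"
    "HOL-Analysis.Finite_Cartesian_Product"
    "HOL-Analysis.Cartesian_Space"
    "HOL-Algebra.Bij"
    "HOL-Algebra.Coset"
    "HOL-Algebra.Elementary_Groups"
    "HOL-Algebra.Generated_Groups"
    "HOL-Algebra.Sym_Groups"
begin

section \<open>Doubly even binary codes\<close>

text \<open>
  Words of length \<open>m\<close> over the field with two elements are the functions
  \<open>nat \<Rightarrow> bit\<close> that vanish outside \<open>{..<m}\<close>; the length can then be quantified over.
\<close>

type_synonym word2 = "nat \<Rightarrow> bit"

interpretation F2: vector_space "\<lambda>(c::bit) (v::word2) i. c * v i"
  by unfold_locales (auto simp: fun_eq_iff algebra_simps)

definition F2_space :: "nat \<Rightarrow> word2 set" where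
  "F2_space m = {v. \<forall>i\<ge>m. v i = 0}"

definition supp :: "word2 \<Rightarrow> nat set" where
  "supp v = {i. v i = 1}"

definition double_even_code :: "nat \<Rightarrow> word2 set \<Rightarrow> bool" where
  "double_even_code m V \<longleftrightarrow>
     V \<subseteq> F2_space m \<and> F2.subspace V \<and>
     (\<forall>v\<in>V. 4 dvd card (supp v)) \<and>
     (\<forall>u\<in>V. \<forall>v\<in>V. 2 dvd card (supp u \<inter> supp v))"

definition code_factor :: "word2 set \<Rightarrow> (word2 \<Rightarrow> word2 \<Rightarrow> int) \<Rightarrow> bool" where
  "code_factor V \<phi> \<longleftrightarrow>
     (\<forall>v\<in>V. \<forall>w\<in>V. \<phi> v w \<in> {1, -1}) \<and>
     (\<forall>v\<in>V. \<phi> v v = (-1) ^ (card (supp v) div 4)) \<and>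
     (\<forall>v\<in>V. \<forall>w\<in>V. \<phi> v w = (-1) ^ (card (supp v \<inter> supp w) div 2) * \<phi> w v) \<and>
     (\<forall>v\<in>V. \<phi> 0 v = 1 \<and> \<phi> v 0 = 1) \<and>
     (\<forall>v\<in>V. \<forall>w\<in>V. \<forall>u\<in>V.
        \<phi> (v + w) u =
          \<phi> v (w + u) * \<phi> v w * \<phi> w u * (-1) ^ card (supp v \<inter> supp w \<inter> supp u))"


section \<open>Code loops\<close>

locale loop =
  fixes L :: "('a, 'b) monoid_scheme" (structure)
  assumes m_closed: "x \<in> carrier L \<Longrightarrow> y \<in> carrier L \<Longrightarrow> x \<otimes> y \<in> carrier L"
    and one_closed: "\<one> \<in> carrier L"
    and l_one: "x \<in> carrier L \<Longrightarrow> \<one> \<otimes> x = x"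
    and r_one: "x \<in> carrier L \<Longrightarrow> x \<otimes> \<one> = x"
    and left_div: "a \<in> carrier L \<Longrightarrow> b \<in> carrier L \<Longrightarrow> \<exists>!x. x \<in> carrier L \<and> a \<otimes> x = b"
    and right_div: "a \<in> carrier L \<Longrightarrow> b \<in> carrier L \<Longrightarrow> \<exists>!y. y \<in> carrier L \<and> y \<otimes> a = b"

text \<open>
  A code loop comes with a distinguished element \<open>-1\<close>. It is recorded as part of the
  structure, so that \<open>\<plusminus>x\<close> makes sense in a loop that is only isomorphic to some \<open>L(V)\<close>.
\<close>

record 'a signed_loop = "'a monoid" +
  minus_one :: 'a

definition code_loop_of ::
    "word2 set \<Rightarrow> (word2 \<Rightarrow> word2 \<Rightarrow> int) \<Rightarrow> (int \<times> word2) signed_loop" where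
  "code_loop_of V \<phi> =
     \<lparr>carrier = {1, -1} \<times> V,
      monoid.mult = (\<lambda>(\<epsilon>, v) (\<delta>, w). (\<epsilon> * \<delta> * \<phi> v w, v + w)),
      one = (1, 0),
      minus_one = (-1, 0)\<rparr>"

definition code_loop_of_rank :: "nat \<Rightarrow> 'a signed_loop \<Rightarrow> bool" where
  "code_loop_of_rank n L \<longleftrightarrow> loop L \<and>
     (\<exists>m V \<phi>. double_even_code m V \<and> F2.dim V = n \<and> code_factor V \<phi> \<and>
        (\<exists>h \<in> iso (code_loop_of V \<phi>) L. h (minus_one (code_loop_of V \<phi>)) = minus_one L))"

definition nonassociative :: "('a, 'b) monoid_scheme \<Rightarrow> bool" where
  "nonassociative L \<longleftrightarrow>
     (\<exists>x\<in>carrier L. \<exists>y\<in>carrier L. \<exists>z\<in>carrier L.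
        (x \<otimes>\<^bsub>L\<^esub> y) \<otimes>\<^bsub>L\<^esub> z \<noteq> x \<otimes>\<^bsub>L\<^esub> (y \<otimes>\<^bsub>L\<^esub> z))"

text \<open>
  Moufang loops are diassociative, so the bracketing of the commutator is immaterial.
\<close>

definition commutator :: "('a, 'b) monoid_scheme \<Rightarrow> 'a \<Rightarrow> 'a \<Rightarrow> 'a" where
  "commutator L x y = ((inv\<^bsub>L\<^esub> x \<otimes>\<^bsub>L\<^esub> inv\<^bsub>L\<^esub> y) \<otimes>\<^bsub>L\<^esub> x) \<otimes>\<^bsub>L\<^esub> y"

definition associator :: "('a, 'b) monoid_scheme \<Rightarrow> 'a \<Rightarrow> 'a \<Rightarrow> 'a \<Rightarrow> 'a" where
  "associator L x y z =
     ((x \<otimes>\<^bsub>L\<^esub> y) \<otimes>\<^bsub>L\<^esub> z) \<otimes>\<^bsub>L\<^esub> inv\<^bsub>L\<^esub> (x \<otimes>\<^bsub>L\<^esub> (y \<otimes>\<^bsub>L\<^esub> z))"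

definition signs :: "'a signed_loop \<Rightarrow> 'a set" where
  "signs L = {\<one>\<^bsub>L\<^esub>, minus_one L}"

text \<open>
  In the elementary abelian 2-group \<open>L/{\<plusminus>1}\<close>, regarded as a vector space over the field
  with two elements, the linear span of a set is the subgroup it generates.
\<close>

definition basis_mod_signs :: "'a signed_loop \<Rightarrow> 'a list \<Rightarrow> bool" where
  "basis_mod_signs L xs \<longleftrightarrow>
     set xs \<subseteq> carrier L \<and>
     (let Q = L Mod signs L; ys = map (\<lambda>x. signs L #>\<^bsub>L\<^esub> x) xs
      in distinct ys \<and>
         generate Q (set ys) = carrier Q \<and>
         (\<forall>y\<in>set ys. y \<notin> generate Q (set ys - {y})))"

definition sign_power :: "'a signed_loop \<Rightarrow> bit \<Rightarrow> 'a" where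
  "sign_power L e = (if e = 1 then minus_one L else \<one>\<^bsub>L\<^esub>)"

definition has_characteristic_vector :: "'a signed_loop \<Rightarrow> bit list \<Rightarrow> bool" where
  "has_characteristic_vector L ls \<longleftrightarrow>
     (\<exists>a b c d.
        basis_mod_signs L [a, b, c, d] \<and>
        associator L a b c = minus_one L \<and>
        (\<forall>x\<in>carrier L. \<forall>y\<in>carrier L. associator L d x y = \<one>\<^bsub>L\<^esub>) \<and>
        [a \<otimes>\<^bsub>L\<^esub> a, b \<otimes>\<^bsub>L\<^esub> b, c \<otimes>\<^bsub>L\<^esub> c, d \<otimes>\<^bsub>L\<^esub> d,
         commutator L a b, commutator L a c, commutator L a d,
         commutator L b c, commutator L b d, commutator L c d] = map (sign_power L) ls)"

definition C4_vectors :: "bit list list" where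
  "C4_vectors =
    [[1,1,1,0,1,1,0,1,0,0],
     [0,0,0,0,0,0,0,0,0,0],
     [0,0,0,0,1,1,0,1,0,0],
     [0,0,1,0,1,0,0,0,0,0],
     [0,0,0,0,0,1,0,1,0,0],
     [1,1,1,1,1,1,0,1,0,0],
     [0,0,0,1,0,0,0,0,0,0],
     [0,0,0,0,0,0,1,0,0,0],
     [0,1,0,0,0,0,1,0,0,0],
     [0,0,0,1,1,1,1,0,0,0],
     [0,0,0,1,0,0,1,0,0,0],
     [0,0,0,0,0,0,1,1,0,0],
     [0,1,1,0,1,1,1,1,0,0],
     [0,0,0,1,0,0,1,1,0,0],
     [1,0,0,1,0,0,1,1,0,0],
     [0,0,0,1,1,1,1,1,0,0]]"

text \<open>The index \<open>i\<close> runs from 1 to 16.\<close>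

definition is_C4 :: "nat \<Rightarrow> 'a signed_loop \<Rightarrow> bool" where
  "is_C4 i L \<longleftrightarrow>
     code_loop_of_rank 4 L \<and> nonassociative L \<and>
     has_characteristic_vector L (C4_vectors ! (i - 1))"


section \<open>Outer automorphism groups\<close>

definition sign_auto :: "'a signed_loop \<Rightarrow> ('a \<Rightarrow> 'a) set" where
  "sign_auto L = {f \<in> auto L. \<forall>x\<in>carrier L. f x = x \<or> f x = minus_one L \<otimes>\<^bsub>L\<^esub> x}"

definition Out :: "'a signed_loop \<Rightarrow> ('a \<Rightarrow> 'a) set monoid" where
  "Out L = AutoGroup L Mod sign_auto L"


section \<open>The groups in the classification\<close>

definition semidirect ::
    "('a, 'c) monoid_scheme \<Rightarrow> ('b, 'd) monoid_scheme \<Rightarrow> ('b \<Rightarrow> 'a \<Rightarrow> 'a) \<Rightarrow> ('a \<times> 'b) monoid" where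
  "semidirect H K \<theta> =
     \<lparr>carrier = carrier H \<times> carrier K,
      monoid.mult = (\<lambda>(h, k) (h', k'). (h \<otimes>\<^bsub>H\<^esub> \<theta> k h', k \<otimes>\<^bsub>K\<^esub> k')),
      one = (\<one>\<^bsub>H\<^esub>, \<one>\<^bsub>K\<^esub>)\<rparr>"

definition is_semidirect ::
    "('g, 'e) monoid_scheme \<Rightarrow> ('a, 'c) monoid_scheme \<Rightarrow> ('b, 'd) monoid_scheme \<Rightarrow> bool" where
  "is_semidirect G H K \<longleftrightarrow> (\<exists>\<theta> \<in> hom K (AutoGroup H). G \<cong> semidirect H K \<theta>)"

abbreviation Z2 :: "int monoid" where
  "Z2 \<equiv> integer_mod_group 2"

abbreviation Z2_cubed :: "(int \<times> int \<times> int) monoid" where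
  "Z2_cubed \<equiv> Z2 \<times>\<times> Z2 \<times>\<times> Z2"

text \<open>The dihedral group of order \<open>2 * n\<close>.\<close>

definition dihedral_group :: "nat \<Rightarrow> (int \<times> int) monoid" where
  "dihedral_group n =
     semidirect (integer_mod_group n) Z2
       (\<lambda>k h. if k = 0 then h else inv\<^bsub>integer_mod_group n\<^esub> h)"

abbreviation D8 :: "(int \<times> int) monoid" where
  "D8 \<equiv> dihedral_group 4"

definition general_linear_group :: "('k::field ^ 'n ^ 'n) monoid" where
  "general_linear_group = \<lparr>carrier = {A. invertible A}, monoid.mult = (**), one = mat 1\<rparr>"

abbreviation GL3_2 :: "(bit ^ 3 ^ 3) monoid" where
  "GL3_2 \<equiv> general_linear_group"

end

theory Submission
  imports
    Defs
    "HOL-Library.Product_Plus"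
    "HOL-Algebra.Multiplicative_Group"
    "HOL-Analysis.Determinants"
begin

text \<open>
  Squaring induces a cubic form \<open>q\<close> on the space \<open>L/{\<plusminus>1}\<close>, whose first and second polarizations
  are the commutator and the associator. An automorphism of \<open>L\<close> induces a linear map that
  preserves \<open>q\<close>. Conversely, for a linear map \<open>g\<close> preserving \<open>q\<close> the quotient of the factor sets
  \<open>\<phi> \<circ> g\<close> and \<open>\<phi>\<close> is a symmetric cocycle with trivial diagonal, hence describes an elementary
  abelian extension and is a coboundary; so \<open>g\<close> lifts to \<open>L\<close>. Therefore \<open>Out L\<close> is the stabilizer
  of \<open>q\<close> in the general linear group, and the characteristic vector lists the coefficients
  of \<open>q\<close> other than that of \<open>xyz\<close>, which is 1.

  All stabilizers fix the radical vector \<open>d\<close> of the associator. If \<open>q\<close> does not involve the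
  coordinate of \<open>d\<close> (the first five loops), the maps that are trivial modulo \<open>d\<close> form an
  elementary abelian normal subgroup of order 8, complemented by the maps that stabilize a
  hyperplane. For the fourteenth and fifteenth form such a normal subgroup is the kernel of the
  action on three vectors. The symmetric groups are recognized by their action on short orbits
  of sets of vectors, the dihedral ones by generators and relations.
\<close>

section \<open>Recognizing groups\<close>

text \<open>The type of \<open>L\<close> and the code behind it are arbitrary, so nothing can be
  computed in \<open>L\<close> itself; coordinates with respect to the given generators move
  everything to one fixed space of 16 vectors. There a map that fixes \<open>d\<close> is a triple
  of vectors, the images of \<open>a\<close>, \<open>b\<close>, \<open>c\<close>, and most
  stabilizers, or complements in them, are short lists of such triples, which can be checked by
  evaluation. The exceptions are the first and the sixth form: up to a summand t both are 1 +
  (1+x)(1+y)(1+z), the indicator of the nonzero vectors, whose symmetry under GL_3(2) is plain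
  without enumeration. The short orbits have a common origin. In all sixteen vectors the last two
  entries are 0, so the polarization of q with \<open>d\<close> is lambda_7 x. For the last nine
  forms lambda_7 = 1, and since \<open>d\<close> is fixed, the functional x is invariant. On each of
  the levels x = 0 and x = 1 the form has degree at most 2, and its zeros there, or the vectors of
  value 1, supply the orbits.\<close>

lemma iso_inv_into:
  assumes h: "h \<in> iso G H"
    and closed: "\<And>x y. x \<in> carrier G \<Longrightarrow> y \<in> carrier G \<Longrightarrow> x \<otimes>\<^bsub>G\<^esub> y \<in> carrier G"
  shows "inv_into (carrier G) h \<in> iso H G"
proof (rule isoI)
  have b: "bij_betw h (carrier G) (carrier H)" and hom: "h \<in> hom G H"
    using h by (auto simp: iso_def)
  show b': "bij_betw (inv_into (carrier G) h) (carrier H) (carrier G)"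
    using b by (rule bij_betw_inv_into)
  show "inv_into (carrier G) h \<in> hom H G"
  proof (rule homI)
    fix x y assume xy: "x \<in> carrier H" "y \<in> carrier H"
    let ?i = "inv_into (carrier G) h"
    have i: "?i x \<in> carrier G" "?i y \<in> carrier G" "h (?i x) = x" "h (?i y) = y"
      using b b' xy by (auto simp: bij_betw_inv_into_right dest: bij_betwE)
    then have "h (?i x \<otimes>\<^bsub>G\<^esub> ?i y) = x \<otimes>\<^bsub>H\<^esub> y"
      using hom by (simp add: hom_mult)
    then show "?i (x \<otimes>\<^bsub>H\<^esub> y) = ?i x \<otimes>\<^bsub>G\<^esub> ?i y"
      using b i closed by (metis bij_betw_inv_into_left)
  qed (use b' in \<open>auto dest: bij_betwE\<close>)
qed

text \<open>This is the internal semidirect product: \<open>K\<close> acts on \<open>H\<close> by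
  conjugation, transported along the two isomorphisms. The hypothesis \<open>split\<close> is the
  factorization G = NC in the form in which it arises for stabilizers: a correction by an element of
  \<open>N\<close> lands in the complement.\<close>

lemma (in group) is_semidirectI:
  assumes N: "N \<lhd> G" and C: "subgroup C G" and triv: "N \<inter> C \<subseteq> {\<one>}"
    and split: "\<And>g. g \<in> carrier G \<Longrightarrow> \<exists>n\<in>N. n \<otimes> g \<in> C"
    and H: "G\<lparr>carrier := N\<rparr> \<cong> H" "group H" and K: "G\<lparr>carrier := C\<rparr> \<cong> K" "group K"
  shows "is_semidirect G H K"
proof -
  interpret N: normal N G by (rule N)
  interpret C: subgroup C G by (rule C)
  obtain \<alpha>' \<sigma>' where \<alpha>': "\<alpha>' \<in> iso (G\<lparr>carrier := N\<rparr>) H" and \<sigma>': "\<sigma>' \<in> iso (G\<lparr>carrier := C\<rparr>) K"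
    using H(1) K(1) by (auto simp: is_iso_def)
  define \<alpha> \<sigma> where "\<alpha> = inv_into N \<alpha>'" and "\<sigma> = inv_into C \<sigma>'"
  have \<alpha>: "\<alpha> \<in> iso H (G\<lparr>carrier := N\<rparr>)" and \<sigma>: "\<sigma> \<in> iso K (G\<lparr>carrier := C\<rparr>)"
    using iso_inv_into[OF \<alpha>'] iso_inv_into[OF \<sigma>'] by (simp_all add: \<alpha>_def \<sigma>_def)
  have \<alpha>b: "bij_betw \<alpha> (carrier H) N" and \<sigma>b: "bij_betw \<sigma> (carrier K) C"
    using \<alpha> \<sigma> by (auto simp: iso_def)
  have \<alpha>N: "\<alpha> h \<in> N" "\<alpha> h \<in> carrier G" if "h \<in> carrier H" for h
    using that \<alpha>b by (auto dest: bij_betwE)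
  have \<sigma>C: "\<sigma> k \<in> C" "\<sigma> k \<in> carrier G" if "k \<in> carrier K" for k
    using that \<sigma>b by (auto dest: bij_betwE)
  have \<alpha>m: "\<alpha> (h \<otimes>\<^bsub>H\<^esub> h') = \<alpha> h \<otimes> \<alpha> h'" if "h \<in> carrier H" "h' \<in> carrier H" for h h'
    using \<alpha> that by (auto simp: iso_def hom_def)
  have \<sigma>m: "\<sigma> (k \<otimes>\<^bsub>K\<^esub> k') = \<sigma> k \<otimes> \<sigma> k'" if "k \<in> carrier K" "k' \<in> carrier K" for k k'
    using \<sigma> that by (auto simp: iso_def hom_def)
  interpret H: group H by (rule H(2))
  interpret K: group K by (rule K(2))
  define \<beta> where "\<beta> = inv_into (carrier H) \<alpha>"
  have \<beta>: "\<beta> n \<in> carrier H" "\<alpha> (\<beta> n) = n" if "n \<in> N" for n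
    using that \<alpha>b unfolding \<beta>_def
    by (auto simp: bij_betw_inv_into_right dest: bij_betwE[OF bij_betw_inv_into])
  have \<alpha>inj: "h = h'" if "h \<in> carrier H" "h' \<in> carrier H" "\<alpha> h = \<alpha> h'" for h h'
    using \<alpha>b that by (auto simp: bij_betw_def inj_on_def)
  have inv_cancel: "inv x \<otimes> (x \<otimes> y) = y" if "x \<in> carrier G" "y \<in> carrier G" for x y
    using that by (simp flip: m_assoc)
  have conj: "x \<otimes> n \<otimes> inv x \<in> N" if "n \<in> N" "x \<in> carrier G" for n x
    using N.inv_op_closed2 that by simp
  \<comment> \<open>Members of \<open>AutoGroup H\<close> are undefined outside the carrier, hence
    the restriction.\<close>
  define \<theta> where "\<theta> k = restrict (\<lambda>h. \<beta> (\<sigma> k \<otimes> \<alpha> h \<otimes> inv \<sigma> k)) (carrier H)" for k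
  have \<theta>c: "\<theta> k h \<in> carrier H" and \<theta>\<alpha>: "\<alpha> (\<theta> k h) = \<sigma> k \<otimes> \<alpha> h \<otimes> inv \<sigma> k"
    if "k \<in> carrier K" "h \<in> carrier H" for k h
    using that by (auto simp: \<theta>_def intro!: \<beta> conj \<alpha>N \<sigma>C)
  have \<theta>mult: "\<theta> (k \<otimes>\<^bsub>K\<^esub> k') h = \<theta> k (\<theta> k' h)"
    if "k \<in> carrier K" "k' \<in> carrier K" "h \<in> carrier H" for k k' h
    using that
    by (intro \<alpha>inj) (auto simp: \<theta>\<alpha> \<theta>c \<sigma>m \<sigma>C \<alpha>N inv_mult_group m_assoc)
  have \<sigma>1: "\<sigma> \<one>\<^bsub>K\<^esub> = \<one>"
  proof -
    have "\<sigma> \<one>\<^bsub>K\<^esub> \<otimes> \<sigma> \<one>\<^bsub>K\<^esub> = \<sigma> \<one>\<^bsub>K\<^esub>" using \<sigma>m[of "\<one>\<^bsub>K\<^esub>" "\<one>\<^bsub>K\<^esub>"] by simp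
    then show ?thesis using \<sigma>C(2)[of "\<one>\<^bsub>K\<^esub>"] by (metis K.one_closed l_cancel_one')
  qed
  have \<theta>1: "\<theta> \<one>\<^bsub>K\<^esub> h = h" if "h \<in> carrier H" for h
    using that by (intro \<alpha>inj) (auto simp: \<theta>\<alpha> \<theta>c \<sigma>1 \<alpha>N)
  have \<theta>auto: "\<theta> k \<in> auto H" if k: "k \<in> carrier K" for k
  proof -
    have "bij_betw (\<theta> k) (carrier H) (carrier H)"
      by (rule bij_betw_byWitness[where f' = "\<theta> (inv\<^bsub>K\<^esub> k)"])
        (use k in \<open>auto simp: \<theta>c simp flip: \<theta>mult simp: \<theta>1\<close>)
    moreover have "\<theta> k \<in> hom H H"
      by (rule homI) (use k in \<open>auto intro!: \<alpha>inj simp: \<theta>c \<theta>\<alpha> \<alpha>m \<sigma>C \<alpha>N m_assoc inv_solve_left\<close>)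
    ultimately show ?thesis
      by (auto simp: auto_def Bij_def \<theta>_def)
  qed
  have "\<theta> \<in> hom K (AutoGroup H)"
  proof (rule homI)
    fix k k' assume "k \<in> carrier K" "k' \<in> carrier K"
    then show "\<theta> (k \<otimes>\<^bsub>K\<^esub> k') = \<theta> k \<otimes>\<^bsub>AutoGroup H\<^esub> \<theta> k'"
      using \<theta>auto[of k] \<theta>auto[of k'] \<theta>mult
      by (auto simp: AutoGroup_def BijGroup_def auto_def compose_def fun_eq_iff \<theta>_def)
  qed (simp add: AutoGroup_def \<theta>auto)
  moreover define \<Psi> where "\<Psi> = (\<lambda>(h, k). \<alpha> h \<otimes> \<sigma> k)"
  have "\<Psi> \<in> iso (semidirect H K \<theta>) G"
  proof (rule isoI)
    show "\<Psi> \<in> hom (semidirect H K \<theta>) G"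
      by (rule homI)
        (auto simp: semidirect_def \<Psi>_def \<alpha>m \<sigma>m \<theta>\<alpha> \<theta>c \<alpha>N \<sigma>C m_assoc inv_cancel)
    have inj: "h = h' \<and> k = k'"
      if *: "h \<in> carrier H" "k \<in> carrier K" "h' \<in> carrier H" "k' \<in> carrier K"
        and eq: "\<alpha> h \<otimes> \<sigma> k = \<alpha> h' \<otimes> \<sigma> k'" for h k h' k'
    proof -
      have "inv (\<alpha> h') \<otimes> \<alpha> h = \<sigma> k' \<otimes> inv (\<sigma> k)"
        using eq * by (metis (no_types, lifting) \<alpha>N(2) \<sigma>C(2) inv_closed inv_solve_left inv_solve_right m_assoc m_closed)
      moreover have "inv (\<alpha> h') \<otimes> \<alpha> h \<in> N" "\<sigma> k' \<otimes> inv (\<sigma> k) \<in> C"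
        using * \<alpha>N \<sigma>C by auto
      ultimately have "inv (\<alpha> h') \<otimes> \<alpha> h = \<one>" "\<sigma> k' \<otimes> inv (\<sigma> k) = \<one>"
        using triv by auto
      then have "\<alpha> h = \<alpha> h'" "\<sigma> k' = \<sigma> k"
        using * \<alpha>N \<sigma>C by (metis inv_equality inv_inv inv_closed)+
      then show ?thesis
        using * \<alpha>inj \<sigma>b by (auto simp: bij_betw_def inj_on_def)
    qed
    have surj: "\<exists>h\<in>carrier H. \<exists>k\<in>carrier K. g = \<alpha> h \<otimes> \<sigma> k" if g: "g \<in> carrier G" for g
    proof -
      obtain n where n: "n \<in> N" "n \<otimes> g \<in> C" using split[OF g] by blast
      then obtain k where k: "k \<in> carrier K" "n \<otimes> g = \<sigma> k"
        using \<sigma>b by (auto simp: bij_betw_def image_iff)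
      have "g = inv n \<otimes> \<sigma> k"
        using n k g by (metis N.mem_carrier \<sigma>C(2) inv_solve_left)
      then have "g = \<alpha> (\<beta> (inv n)) \<otimes> \<sigma> k" using \<beta> n by simp
      then show ?thesis using k \<beta>(1)[of "inv n"] n by blast
    qed
    show "bij_betw \<Psi> (carrier (semidirect H K \<theta>)) (carrier G)"
      unfolding bij_betw_def
    proof
      show "inj_on \<Psi> (carrier (semidirect H K \<theta>))"
        by (auto simp: inj_on_def semidirect_def \<Psi>_def dest: inj)
      show "\<Psi> ` carrier (semidirect H K \<theta>) = carrier G"
        using surj \<alpha>N \<sigma>C by (fastforce simp: semidirect_def \<Psi>_def image_iff)
    qed
  qed
  \<comment> \<open>The semidirect product is a bare structure here, not yet known to be a group;
    inverting the isomorphism takes only closure under multiplication.\<close>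
  then have "inv_into (carrier (semidirect H K \<theta>)) \<Psi> \<in> iso G (semidirect H K \<theta>)"
    by (rule iso_inv_into) (auto simp: semidirect_def \<theta>c)
  ultimately show ?thesis
    by (auto simp: is_semidirect_def is_iso_def)
qed

lemma is_semidirect_iso_left:
  assumes "G \<cong> G'" "is_semidirect G' H K"
  shows "is_semidirect G H K"
  using assms iso_trans by (auto simp: is_semidirect_def)


lemma group_Z2_cubed: "group Z2_cubed"
  by (intro DirProd_group group_integer_mod_group)

text \<open>Each of a, b, c is picked outside the subgroup generated by its predecessors, which has
  at most 1, 2, 4 elements. The products a^i b^j c^k are then distinct and fill the group by
  counting.\<close>

lemma (in group) elementary_abelian_8:
  assumes ord: "order G = 8" and sq: "\<And>x. x \<in> carrier G \<Longrightarrow> x \<otimes> x = \<one>"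
  shows "G \<cong> Z2_cubed"
proof -
  have inv: "inv x = x" if "x \<in> carrier G" for x
    using that sq by (simp add: inv_equality)
  have comm: "x \<otimes> y = y \<otimes> x" if "x \<in> carrier G" "y \<in> carrier G" for x y
    using that inv inv_mult_group[of x y] by auto
  have lcomm: "x \<otimes> (y \<otimes> z) = y \<otimes> (x \<otimes> z)" if "x \<in> carrier G" "y \<in> carrier G" "z \<in> carrier G" for x y z
    using that comm by (metis m_assoc)
  have sql: "x \<otimes> (x \<otimes> y) = y" if "x \<in> carrier G" "y \<in> carrier G" for x y
    using that sq by (metis m_assoc l_one)
  have card: "card (carrier G) = 8" using ord by (simp add: order_def)
  then have fin: "finite (carrier G)" by (metis card.infinite zero_neq_numeral)
  have ex: "\<exists>x\<in>carrier G. x \<notin> S" if "finite S" "card S < 8" for S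
  proof (rule ccontr)
    assume "\<not> ?thesis"
    then have "carrier G \<subseteq> S" by blast
    then show False using card_mono[of S "carrier G"] that card by simp
  qed
  obtain a where a: "a \<in> carrier G" "a \<noteq> \<one>"
    using ex[of "{\<one>}"] by auto
  obtain b where b: "b \<in> carrier G" "b \<notin> {\<one>, a}"
    using ex[of "{\<one>, a}"] a by auto
  have "card {\<one>, a, b, a \<otimes> b} < 8"
    by (rule le_less_trans[OF card_length[of "[\<one>, a, b, a \<otimes> b]", simplified]]) simp
  then obtain c where c: "c \<in> carrier G" "c \<notin> {\<one>, a, b, a \<otimes> b}"
    using ex[of "{\<one>, a, b, a \<otimes> b}"] by auto
  \<comment> \<open>\<open>p x i\<close> is x^i for the representatives 0 and 1 that make up the
    carrier of \<open>Z2\<close>.\<close>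
  define p where "p x (i::int) = (if i = 1 then x else \<one>)" for x i
  define f where "f = (\<lambda>(i, j, k). p a i \<otimes> (p b j \<otimes> p c k))"
  have Z2: "carrier Z2 = {0, 1}" by (auto simp: carrier_integer_mod_group)
  have eq1: "x = y" if "x \<in> carrier G" "y \<in> carrier G" "x \<otimes> y = \<one>" for x y
    using that inv inv_equality by metis
  have hom: "f \<in> hom Z2_cubed G"
    by (rule homI)
      (use a b c in \<open>auto simp: f_def p_def Z2 sq sql comm lcomm m_assoc\<close>)
  moreover have inj: "inj_on f (carrier Z2_cubed)"
  proof -
    interpret gh: group_hom "Z2_cubed" G f
      using hom by (intro group_hom.intro group_hom_axioms.intro DirProd_group is_group) auto
    show ?thesis
    proof (unfold gh.inj_on_one_iff, intro allI impI)
      fix x assume x: "x \<in> carrier Z2_cubed" "f x = \<one>"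
      obtain i j k where ijk: "x = (i, j, k)" by (cases x)
      have "i \<in> {0,1}" "j \<in> {0,1}" "k \<in> {0,1}" using x ijk by (auto simp: Z2)
      then show "x = \<one>\<^bsub>Z2_cubed\<^esub>"
        using a b c x eq1[of a b] eq1[of a c] eq1[of b c] eq1[of a "b \<otimes> c"] sql[of b a] sql[of b c]
        by (auto simp: ijk f_def p_def comm lcomm)
    qed
  qed
  moreover have "f ` carrier Z2_cubed = carrier G"
  proof (rule card_subset_eq[OF fin])
    show "f ` carrier Z2_cubed \<subseteq> carrier G" using hom by (rule hom_carrier)
    show "card (f ` carrier Z2_cubed) = card (carrier G)"
      using inj card by (simp add: card_image Z2)
  qed
  ultimately have "Z2_cubed \<cong> G" by (intro is_isoI[of f]) (simp only: iso_iff simp_thms)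
  then show ?thesis
    by (rule group.iso_sym[OF group_Z2_cubed])
qed

text \<open>The relations of the dihedral presentation give a homomorphism from the model;
  \<open>notin\<close> makes it injective, and the order makes it onto. That the model is a group is
  recorded as well, since a semidirect product with it asks for this.\<close>

lemma (in group) dihedral_groupI:
  assumes r: "r \<in> carrier G" "ord r = n" and s: "s \<in> carrier G" "s \<otimes> s = \<one>"
    and notin: "\<And>k::int. s \<noteq> r [^] k" and rel: "s \<otimes> r \<otimes> s = inv r"
    and card: "order G = 2 * n" and n: "n > 0"
  shows "G \<cong> dihedral_group n" "group (dihedral_group n)"
proof -
  define p where "p (e::int) = (if e = 1 then s else \<one>)" for e
  define f where "f = (\<lambda>(k::int, e). r [^] k \<otimes> p e)"
  have Z2: "carrier Z2 = {0, 1}" by (auto simp: carrier_integer_mod_group)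
  have pow_mod: "r [^] (k mod int n) = r [^] k" for k :: int
  proof -
    have "r [^] (int n * (k div int n) + k mod int n) = (r [^] int n) [^] (k div int n) \<otimes> r [^] (k mod int n)"
      using r(1) by (simp only: int_pow_mult int_pow_pow)
    then have "r [^] k = (r [^] int n) [^] (k div int n) \<otimes> r [^] (k mod int n)" by simp
    also have "r [^] int n = \<one>"
      using r by (metis int_pow_int pow_ord_eq_1)
    finally show ?thesis using r by simp
  qed
  have sinv: "inv s = s" using s by (simp add: inv_equality)
  \<comment> \<open>Conjugation by the involution \<open>s\<close> is an endomorphism, so inverting
    \<open>r\<close> extends to inverting its powers.\<close>
  have srs: "s \<otimes> (r [^] k) = r [^] (-k) \<otimes> s" for k :: int
  proof -
    interpret h: group_hom G G "\<lambda>x. s \<otimes> x \<otimes> s"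
    proof (unfold_locales, rule homI)
      fix x y assume "x \<in> carrier G" "y \<in> carrier G"
      then have "s \<otimes> x \<otimes> s \<otimes> (s \<otimes> y \<otimes> s) = s \<otimes> x \<otimes> (s \<otimes> s) \<otimes> y \<otimes> s"
        using s(1) by (simp add: m_assoc)
      then show "s \<otimes> (x \<otimes> y) \<otimes> s = s \<otimes> x \<otimes> s \<otimes> (s \<otimes> y \<otimes> s)"
        using s \<open>x \<in> carrier G\<close> \<open>y \<in> carrier G\<close> by (simp add: m_assoc)
    qed (use s in auto)
    have "s \<otimes> r [^] k \<otimes> s = (s \<otimes> r \<otimes> s) [^] k"
      using r by (simp add: h.hom_int_pow)
    also have "\<dots> = r [^] (-k)"
      using r by (simp add: rel int_pow_inv int_pow_neg)
    finally have "s \<otimes> r [^] k \<otimes> s \<otimes> s = r [^] (-k) \<otimes> s" by simp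
    then show ?thesis using r s by (simp add: m_assoc)
  qed
  have hom: "f \<in> hom (dihedral_group n) G"
  proof (rule homI, goal_cases)
    case (1 x)
    then show ?case using r s by (cases x) (auto simp: f_def p_def)
  next
    case (2 x y)
    obtain k e l d where xy: "x = (k, e)" "y = (l, d)" by (cases x, cases y)
    have kl: "k \<in> carrier (integer_mod_group n)" "l \<in> carrier (integer_mod_group n)"
      and ed: "e \<in> {0, 1}" "d \<in> {0, 1}"
      using 2 by (auto simp: xy dihedral_group_def semidirect_def Z2)
    show ?case
    proof (cases "e = 0")
      case True
      then show ?thesis
        using r s ed kl by (auto simp: xy f_def p_def dihedral_group_def semidirect_def pow_mod int_pow_mult m_assoc)
    next
      case False
      then have e: "e = 1" using ed by simp
      have "r [^] ((k + (- l) mod int n) mod int n) = r [^] k \<otimes> r [^] (-l)"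
        using r by (simp add: pow_mod mod_add_right_eq flip: int_pow_mult)
      moreover have "r [^] k \<otimes> s \<otimes> (r [^] l \<otimes> x) = r [^] k \<otimes> (r [^] (-l)) \<otimes> (s \<otimes> x)" if "x \<in> carrier G" for x
      proof -
        have "r [^] k \<otimes> s \<otimes> (r [^] l \<otimes> x) = r [^] k \<otimes> (s \<otimes> r [^] l) \<otimes> x"
          using r s that by (simp add: m_assoc)
        then show ?thesis using r s that by (simp add: srs m_assoc)
      qed
      ultimately show ?thesis
        using r s ed kl e by (auto simp: xy f_def p_def dihedral_group_def semidirect_def)
    qed
  qed
  have carD: "carrier (dihedral_group n) = {0..<int n} \<times> {0, 1}"
    using n by (auto simp: dihedral_group_def semidirect_def carrier_integer_mod_group)
  have inj: "inj_on f (carrier (dihedral_group n))"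
  proof (rule inj_onI, clarify)
    fix k e l d
    assume *: "(k, e) \<in> carrier (dihedral_group n)" "(l, d) \<in> carrier (dihedral_group n)"
      and eq: "f (k, e) = f (l, d)"
    have ed: "e \<in> {0, 1}" "d \<in> {0, 1}" and kl: "k \<in> {0..<int n}" "l \<in> {0..<int n}"
      using * by (auto simp: carD)
    have rk: "k = l" if "r [^] k = r [^] l"
    proof -
      have "int n dvd k - l"
        using that r by (metis int_pow_eq)
      then show ?thesis using kl
        by (metis atLeastLessThan_iff mod_eq_dvd_iff mod_pos_pos_trivial)
    qed
    have ne: "r [^] k \<otimes> s \<noteq> r [^] l" for k l :: int
    proof
      assume "r [^] k \<otimes> s = r [^] l"
      then have "s = r [^] (l - k)"
        using r s by (metis int_pow_closed int_pow_diff int_pow_mult add.commute diff_conv_add_uminus int_pow_neg inv_solve_left)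
      then show False using notin by blast
    qed
    have "e = d"
      using ed eq ne[of k l] ne[of l k] r(1) by (auto simp: f_def p_def)
    moreover from this have "r [^] k = r [^] l"
      using ed eq r(1) s(1) by (auto simp: f_def p_def split: if_splits)
    ultimately show "k = l \<and> e = d"
      using rk by simp
  qed
  have "f ` carrier (dihedral_group n) = carrier G"
  proof (rule card_subset_eq)
    show "finite (carrier G)" using card n by (metis card.infinite mult_eq_0_iff order_def rel_simps(76) zero_less_iff_neq_zero)
    show "f ` carrier (dihedral_group n) \<subseteq> carrier G" using hom by (rule hom_carrier)
    show "card (f ` carrier (dihedral_group n)) = card (carrier G)"
      using inj card by (simp add: card_image carD order_def)
  qed
  then have "f \<in> iso (dihedral_group n) G" using hom inj by (simp add: iso_iff)
  then have iso: "inv_into (carrier (dihedral_group n)) f \<in> iso G (dihedral_group n)"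
    by (rule iso_inv_into) (use n in \<open>auto simp: dihedral_group_def semidirect_def carrier_integer_mod_group\<close>)
  then show "G \<cong> dihedral_group n" by (rule is_isoI)
  \<comment> \<open>Transport of structure yields a group whose unit is the image of
    \<open>\<one>\<close>; this image has to be identified with the unit stored in the
    record.\<close>
  have "inv_into (carrier (dihedral_group n)) f \<one> = \<one>\<^bsub>dihedral_group n\<^esub>"
    by (rule inv_into_f_eq[OF inj])
      (use n in \<open>auto simp: carD f_def p_def dihedral_group_def semidirect_def\<close>)
  then show "group (dihedral_group n)"
    using iso_imp_img_group[OF iso] by simp
qed

text \<open>Trivial intersection makes the product map on N x C injective, so by counting it is
  onto.\<close>

lemma (in group) split_if_card:
  assumes N: "subgroup N G" and C: "subgroup C G" and triv: "N \<inter> C \<subseteq> {\<one>}"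
    and fin: "finite (carrier G)" and card: "card N * card C = order G" and g: "g \<in> carrier G"
  shows "\<exists>n\<in>N. n \<otimes> g \<in> C"
proof -
  interpret N: subgroup N G by (rule N)
  interpret C: subgroup C G by (rule C)
  let ?f = "\<lambda>(n, c). n \<otimes> c"
  have "inj_on ?f (N \<times> C)"
  proof (rule inj_onI, clarify)
    fix n c n' c' assume *: "n \<in> N" "c \<in> C" "n' \<in> N" "c' \<in> C" "n \<otimes> c = n' \<otimes> c'"
    then have "inv n' \<otimes> n = c' \<otimes> inv c"
      by (metis (no_types, lifting) C.mem_carrier N.mem_carrier inv_closed inv_solve_left inv_solve_right m_assoc m_closed)
    moreover have "inv n' \<otimes> n \<in> N" "c' \<otimes> inv c \<in> C" using * by auto
    ultimately have "inv n' \<otimes> n = \<one>" "c' \<otimes> inv c = \<one>" using triv by auto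
    then show "n = n' \<and> c = c'"
      using * by (metis C.mem_carrier N.mem_carrier inv_equality inv_inv inv_closed)
  qed
  then have "?f ` (N \<times> C) = carrier G"
    by (intro card_subset_eq fin) (auto simp: card_image card_cartesian_product card order_def)
  with g have "g \<in> ?f ` (N \<times> C)" by (simp only:)
  then obtain n c where "n \<in> N" "c \<in> C" "g = n \<otimes> c" by auto
  then show ?thesis
    by (intro bexI[of _ "inv n"]) (auto simp flip: m_assoc)
qed

section \<open>Groups of bijections and their actions on lists of sets\<close>

definition fgroup :: "('v \<Rightarrow> 'v) set \<Rightarrow> ('v \<Rightarrow> 'v) monoid" where
  "fgroup F = \<lparr>carrier = F, monoid.mult = (\<circ>), one = id\<rparr>"

lemma fgroup_simps [simp]:
  "carrier (fgroup F) = F" "x \<otimes>\<^bsub>fgroup F\<^esub> y = x \<circ> y" "\<one>\<^bsub>fgroup F\<^esub> = id"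
  "fgroup F\<lparr>carrier := C\<rparr> = fgroup C"
  by (simp_all add: fgroup_def)

locale function_group =
  fixes F :: "('v \<Rightarrow> 'v) set"
  assumes bij: "f \<in> F \<Longrightarrow> bij f"
    and id_mem: "id \<in> F"
    and comp_mem: "f \<in> F \<Longrightarrow> g \<in> F \<Longrightarrow> f \<circ> g \<in> F"
    and inv_mem: "f \<in> F \<Longrightarrow> inv' f \<in> F"
begin

lemma left_inverse: "f \<in> F \<Longrightarrow> inv' f \<circ> f = id"
  using bij by (simp add: bij_is_inj)

lemma group_fgroup: "group (fgroup F)"
  by (rule groupI) (auto simp: comp_mem id_mem comp_assoc intro!: bexI[of _ "inv' _"] left_inverse inv_mem)

lemma inv_fgroup: "f \<in> F \<Longrightarrow> inv\<^bsub>fgroup F\<^esub> f = inv' f"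
  by (rule group.inv_equality[OF group_fgroup]) (auto simp: left_inverse inv_mem)

lemma inv_image_eq: "f \<in> F \<Longrightarrow> f ` W = W \<Longrightarrow> inv' f ` W = W"
  using bij by (metis bij_is_inj image_inv_f_f)

lemma function_group_setwise_stabilizer: "function_group {f \<in> F. f ` W = W}"
proof
  show "inv' f \<in> {f \<in> F. f ` W = W}" if "f \<in> {f \<in> F. f ` W = W}" for f
    using that inv_image_eq inv_mem by auto
  show "f \<circ> g \<in> {f \<in> F. f ` W = W}" if "f \<in> {f \<in> F. f ` W = W}" "g \<in> {f \<in> F. f ` W = W}" for f g
    using that comp_mem by (auto simp: image_comp[symmetric] simp del: image_comp comp_apply)
qed (use bij id_mem in auto)

lemma subgroup_if_function_group:
  assumes "function_group C" "C \<subseteq> F"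
  shows "subgroup C (fgroup F)"
proof -
  interpret C: function_group C by (rule assms(1))
  show ?thesis
    by (rule group.subgroupI[OF group_fgroup])
      (use assms(2) in \<open>auto simp: inv_fgroup C.inv_mem C.comp_mem subset_iff intro: C.id_mem\<close>)
qed

end

text \<open>\<open>sym_group n\<close> acts on {1..n} while lists are indexed from 0, hence the
  shift by one and the identity outside the index range. Sets are permuted rather than vectors, so
  that orbits of planes can serve as well as orbits of points.\<close>

definition perm_of :: "'v set list \<Rightarrow> ('v \<Rightarrow> 'v) \<Rightarrow> nat \<Rightarrow> nat" where
  "perm_of Ps f i = (if i \<in> {1..length Ps}
     then (THE j. j \<in> {1..length Ps} \<and> Ps ! (j - 1) = f ` (Ps ! (i - 1))) else i)"

locale set_permuting = function_group +
  fixes Ps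
  assumes distinct: "distinct Ps"
    and permutes: "f \<in> F \<Longrightarrow> S \<in> set Ps \<Longrightarrow> f ` S \<in> set Ps"
begin

abbreviation "idx \<equiv> {1..length Ps}"

lemma idx_unique:
  assumes "i \<in> idx" "j \<in> idx" "Ps ! (i - 1) = Ps ! (j - 1)"
  shows "i = j"
proof -
  have "i - 1 = j - 1"
    using assms by (subst nth_eq_iff_index_eq[OF distinct, symmetric]) auto
  then show ?thesis using assms by auto
qed

lemma perm_of_spec:
  assumes f: "f \<in> F" and i: "i \<in> idx"
  shows "perm_of Ps f i \<in> idx \<and> Ps ! (perm_of Ps f i - 1) = f ` (Ps ! (i - 1))"
proof -
  have "f ` (Ps ! (i - 1)) \<in> set Ps"
    using f i by (intro permutes nth_mem) auto
  then obtain j where "j < length Ps" "Ps ! j = f ` (Ps ! (i - 1))"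
    by (auto simp: in_set_conv_nth)
  then have "Suc j \<in> idx \<and> Ps ! (Suc j - 1) = f ` (Ps ! (i - 1))" by auto
  then have "\<exists>!j. j \<in> idx \<and> Ps ! (j - 1) = f ` (Ps ! (i - 1))"
    using idx_unique by metis
  then show ?thesis
    unfolding perm_of_def using i by (simp only: if_True) (rule theI')
qed

lemma perm_of_eqI:
  "f \<in> F \<Longrightarrow> i \<in> idx \<Longrightarrow> j \<in> idx \<Longrightarrow> Ps ! (j - 1) = f ` (Ps ! (i - 1)) \<Longrightarrow> perm_of Ps f i = j"
  using perm_of_spec idx_unique by metis

lemma perm_of_outside: "i \<notin> idx \<Longrightarrow> perm_of Ps f i = i"
  by (auto simp: perm_of_def)

lemma perm_of_comp: "f \<in> F \<Longrightarrow> g \<in> F \<Longrightarrow> perm_of Ps (f \<circ> g) = perm_of Ps f \<circ> perm_of Ps g"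
proof
  fix i assume fg: "f \<in> F" "g \<in> F"
  show "perm_of Ps (f \<circ> g) i = (perm_of Ps f \<circ> perm_of Ps g) i"
  proof (cases "i \<in> idx")
    case True
    then show ?thesis
      using fg perm_of_spec[of g i] perm_of_spec[of f "perm_of Ps g i"]
      by (intro perm_of_eqI) (auto simp: comp_mem image_comp)
  qed (simp add: perm_of_outside)
qed

lemma perm_of_eq_id_iff:
  assumes "f \<in> F"
  shows "perm_of Ps f = id \<longleftrightarrow> (\<forall>S\<in>set Ps. f ` S = S)"
proof
  assume *: "perm_of Ps f = id"
  show "\<forall>S\<in>set Ps. f ` S = S"
  proof
    fix S assume "S \<in> set Ps"
    then obtain j where "j < length Ps" "Ps ! j = S" by (auto simp: in_set_conv_nth)
    then show "f ` S = S" using perm_of_spec[OF assms, of "Suc j"] * by auto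
  qed
next
  assume *: "\<forall>S\<in>set Ps. f ` S = S"
  show "perm_of Ps f = id"
  proof
    fix i show "perm_of Ps f i = id i"
    proof (cases "i \<in> idx")
      case True
      then have "Ps ! (i - 1) \<in> set Ps" by (intro nth_mem) auto
      then show ?thesis using assms * True by (simp add: perm_of_eqI)
    qed (simp add: perm_of_outside)
  qed
qed

lemma perm_of_permutes:
  assumes f: "f \<in> F"
  shows "perm_of Ps f permutes idx"
proof (rule bij_imp_permutes)
  have "inj_on (perm_of Ps f) idx"
  proof (rule inj_onI)
    fix i j assume ij: "i \<in> idx" "j \<in> idx" and eq: "perm_of Ps f i = perm_of Ps f j"
    then have "f ` (Ps ! (i - 1)) = f ` (Ps ! (j - 1))"
      using perm_of_spec[OF f] by metis
    then have "Ps ! (i - 1) = Ps ! (j - 1)"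
      using bij[OF f] by (simp add: inj_image_eq_iff bij_is_inj)
    then show "i = j" using ij idx_unique by blast
  qed
  then show "bij_betw (perm_of Ps f) idx idx"
    using perm_of_spec[OF f] by (intro bij_betw_imageI endo_inj_surj) auto
qed (simp add: perm_of_outside)

lemma perm_of_hom: "perm_of Ps \<in> hom (fgroup F) (sym_group (length Ps))"
  by (rule homI) (use perm_of_permutes in \<open>auto simp: sym_group_def perm_of_comp\<close>)

lemma group_hom_perm_of: "group_hom (fgroup F) (sym_group (length Ps)) (perm_of Ps)"
  by (intro group_hom.intro group_hom_axioms.intro group_fgroup sym_group_is_group perm_of_hom)

abbreviation "pointwise \<equiv> {f \<in> F. \<forall>S\<in>set Ps. f ` S = S}"

lemma kernel_perm_of: "kernel (fgroup F) (sym_group (length Ps)) (perm_of Ps) = pointwise"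
  unfolding kernel_def by (simp add: sym_group_one perm_of_eq_id_iff cong: conj_cong)

lemma normal_pointwise: "pointwise \<lhd> fgroup F"
  using group_hom.normal_kernel[OF group_hom_perm_of] by (simp add: kernel_perm_of)

lemma iso_sym_group:
  assumes faithful: "pointwise \<subseteq> {id}" and card: "card F = fact (length Ps)"
  shows "fgroup F \<cong> sym_group (length Ps)"
proof (rule is_isoI[of "perm_of Ps"], unfold iso_iff, intro conjI)
  show inj: "inj_on (perm_of Ps) (carrier (fgroup F))"
    unfolding group_hom.inj_on_one_iff[OF group_hom_perm_of]
    using faithful by (auto simp: sym_group_one perm_of_eq_id_iff)
  show "perm_of Ps ` carrier (fgroup F) = carrier (sym_group (length Ps))"
  proof (rule card_subset_eq)
    show "perm_of Ps ` carrier (fgroup F) \<subseteq> carrier (sym_group (length Ps))"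
      using perm_of_hom by (rule hom_carrier)
    show "card (perm_of Ps ` carrier (fgroup F)) = card (carrier (sym_group (length Ps)))"
      using inj card by (simp add: card_image sym_group_def card_permutations)
  qed (simp add: sym_group_def finite_permutations)
qed (rule perm_of_hom)

lemma subgroup_setwise_stabilizer: "subgroup {f \<in> F. f ` W = W} (fgroup F)"
  by (rule subgroup_if_function_group[OF function_group_setwise_stabilizer]) auto

text \<open>The normal factor is the kernel of the action on \<open>Ps\<close>; the complement is
  the stabilizer of a further set \<open>W\<close>, which is a hyperplane for forms that ignore the
  last coordinate.\<close>

lemma is_semidirect_Z2_cubed:
  assumes triv: "\<And>f. f \<in> pointwise \<Longrightarrow> f ` W = W \<Longrightarrow> f = id"
    and sq: "\<And>f. f \<in> pointwise \<Longrightarrow> f \<circ> f = id"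
    and card: "card pointwise = 8"
    and split: "\<And>f. f \<in> F \<Longrightarrow> \<exists>g\<in>pointwise. (g \<circ> f) ` W = W"
    and K: "fgroup {f \<in> F. f ` W = W} \<cong> K" "group K"
  shows "is_semidirect (fgroup F) Z2_cubed K"
proof -
  have "subgroup pointwise (fgroup F)"
    using normal_pointwise by (rule normal_imp_subgroup)
  then have "group (fgroup pointwise)"
    using subgroup.subgroup_is_group group_fgroup by fastforce
  then have "fgroup pointwise \<cong> Z2_cubed"
    by (rule group.elementary_abelian_8) (use card sq in \<open>auto simp: order_def\<close>)
  then have H: "fgroup F\<lparr>carrier := pointwise\<rparr> \<cong> Z2_cubed"
    by (simp only: fgroup_simps)
  show ?thesis
  proof (rule group.is_semidirectI[OF group_fgroup normal_pointwise subgroup_setwise_stabilizer _ _ H group_Z2_cubed])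
    show "pointwise \<inter> {f \<in> F. f ` W = W} \<subseteq> {\<one>\<^bsub>fgroup F\<^esub>}" using triv by auto
    show "fgroup F\<lparr>carrier := {f \<in> F. f ` W = W}\<rparr> \<cong> K" using K by (simp only: fgroup_simps)
    fix f assume "f \<in> carrier (fgroup F)"
    then have f: "f \<in> F" by simp
    from split[OF f] show "\<exists>g\<in>pointwise. g \<otimes>\<^bsub>fgroup F\<^esub> f \<in> {f \<in> F. f ` W = W}"
    proof (rule bexE)
      fix g assume g: "g \<in> pointwise" "(g \<circ> f) ` W = W"
      then have "g \<circ> f \<in> F" using f by (intro comp_mem) simp_all
      with g show ?thesis by (intro bexI[OF _ g(1)]) (simp only: fgroup_simps mem_Collect_eq)
    qed
  qed (rule K)
qed

text \<open>Here the factorization follows from the orders, which are lengths of lists in the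
  applications; \<open>W\<close> is then a single vector.\<close>

lemma is_semidirect_Z2_cubed_card:
  assumes fin: "finite F"
    and triv: "\<And>f. f \<in> pointwise \<Longrightarrow> f ` W = W \<Longrightarrow> f = id"
    and sq: "\<And>f. f \<in> pointwise \<Longrightarrow> f \<circ> f = id"
    and card: "card pointwise = 8" "card F = 8 * card {f \<in> F. f ` W = W}"
    and K: "fgroup {f \<in> F. f ` W = W} \<cong> K" "group K"
  shows "is_semidirect (fgroup F) Z2_cubed K"
proof (rule is_semidirect_Z2_cubed[OF triv sq card(1) _ K])
  fix f assume "f \<in> F"
  moreover have "pointwise \<inter> {f \<in> F. f ` W = W} \<subseteq> {\<one>\<^bsub>fgroup F\<^esub>}" using triv by auto
  ultimately show "\<exists>g\<in>pointwise. (g \<circ> f) ` W = W"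
    using group.split_if_card[OF group_fgroup normal_imp_subgroup[OF normal_pointwise]
        subgroup_setwise_stabilizer, of W f] fin card
    by (auto simp: order_def)
qed

end

text \<open>Lets an action on two sets stand for a factor \<open>Z2\<close>.\<close>

lemma sym_group_2_iso: "sym_group 2 \<cong> Z2"
proof -
  have sub: "{id, Transposition.transpose 1 2} \<subseteq> {p. p permutes {1..2::nat}}"
    by (auto intro: permutes_id permutes_swap_id)
  have ne: "Transposition.transpose 1 2 \<noteq> (id :: nat \<Rightarrow> nat)"
    by (metis id_apply one_eq_numeral_iff semiring_norm(83) transpose_apply_first)
  have "card {id, Transposition.transpose 1 (2::nat)} = card {p. p permutes {1..2::nat}}"
    using ne[symmetric] by (simp add: card_permutations fact_numeral)
  then have eq: "{p. p permutes {1..2::nat}} = {id, Transposition.transpose 1 2}"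
    using card_subset_eq[OF _ sub] by (simp add: finite_permutations)
  have perm2: "p permutes {Suc 0..2} \<longleftrightarrow> p = id \<or> p = Transposition.transpose (Suc 0) 2" for p
    using eq by (auto simp: set_eq_iff)
  let ?f = "\<lambda>p::nat\<Rightarrow>nat. if p = id then 0 else (1::int)"
  have "?f \<in> iso (sym_group 2) Z2"
    unfolding iso_iff
  proof (intro conjI)
    show "?f \<in> hom (sym_group 2) Z2"
      by (rule homI) (use ne in \<open>auto simp: sym_group_def perm2 carrier_integer_mod_group\<close>)
  qed (use ne in \<open>auto simp: sym_group_def perm2 carrier_integer_mod_group inj_on_def image_iff\<close>)
  then show ?thesis by (rule is_isoI)
qed

text \<open>Two jointly faithful actions embed the group in a product of symmetric groups, and its
  order makes the embedding onto.\<close>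

lemma iso_sym_group_times_Z2:
  assumes "set_permuting F Ps" "set_permuting F Rs"
    and faithful: "{f \<in> F. (\<forall>S\<in>set Ps. f ` S = S) \<and> (\<forall>S\<in>set Rs. f ` S = S)} \<subseteq> {id}"
    and Rs: "length Rs = 2" and card: "card F = 2 * fact (length Ps)"
  shows "fgroup F \<cong> sym_group (length Ps) \<times>\<times> Z2"
proof -
  interpret P: set_permuting F Ps by fact
  interpret R: set_permuting F Rs by fact
  let ?S = "sym_group (length Ps) \<times>\<times> sym_group 2"
  let ?f = "\<lambda>f. (perm_of Ps f, perm_of Rs f)"
  have hom: "?f \<in> hom (fgroup F) ?S"
    using P.perm_of_hom R.perm_of_hom by (auto simp: hom_def Rs Pi_iff)
  have S: "group ?S" by (intro DirProd_group sym_group_is_group)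
  then have gh: "group_hom (fgroup F) ?S ?f"
    by (intro group_hom.intro group_hom_axioms.intro P.group_fgroup hom)
  have inj: "inj_on ?f F"
    using group_hom.inj_on_one_iff[OF gh] faithful
    by (auto simp: sym_group_one P.perm_of_eq_id_iff R.perm_of_eq_id_iff)
  have "?f ` F = carrier ?S"
  proof (rule card_subset_eq)
    show "?f ` F \<subseteq> carrier ?S" using hom_carrier[OF hom] by simp
    show "card (?f ` F) = card (carrier ?S)"
      using inj card by (simp add: card_image sym_group_def card_permutations card_cartesian_product)
  qed (simp add: sym_group_def finite_permutations)
  then have "fgroup F \<cong> ?S"
    using hom inj by (intro is_isoI[of ?f]) (simp add: iso_iff)
  also have "?S \<cong> sym_group (length Ps) \<times>\<times> Z2"
    by (intro group.DirProd_iso_trans[OF sym_group_is_group] iso_refl sym_group_2_iso)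
  finally show ?thesis .
qed

section \<open>Stabilizers of cubic forms\<close>

text \<open>
  By default, the simplifier turns addition and multiplication in \<open>bit\<close> into bit operations,
  which defeats ring reasoning and slows down evaluation.
\<close>

declare add_bit_eq_xor [simp del, code del] mult_bit_eq_and [simp del, code del]

lemma bit_add_code [code, simp]: "(0::bit) + x = x" "(1::bit) + 0 = 1" "(1::bit) + 1 = 0"
  by simp_all

lemma bit_mult_code [code]: "(0::bit) * x = 0" "(1::bit) * x = x"
  by simp_all

lemma bit_equal_code [code]:
  "HOL.equal (0::bit) 0 = True" "HOL.equal (1::bit) 1 = True"
  "HOL.equal (0::bit) 1 = False" "HOL.equal (1::bit) 0 = False"
  by (simp_all add: equal)

lemma bit_add_self [simp]: "(x::bit) + x = 0" "(x::bit) + (x + y) = y"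
  by (cases x; cases y; simp)+

lemma bit_mult_self [simp]: "(x::bit) * x = x" "(x::bit) * (x * y) = x * y"
  by (cases x; simp)+

text \<open>Over the field with two elements, additive maps are linear, so scalars need not
  appear.\<close>

definition form_stabilizer :: "('v::ab_group_add \<Rightarrow> bit) \<Rightarrow> ('v \<Rightarrow> 'v) set" where
  "form_stabilizer q = {f. bij f \<and> (\<forall>x y. f (x + y) = f x + f y) \<and> (\<forall>x. q (f x) = q x)}"

lemma form_stabilizerD:
  assumes "f \<in> form_stabilizer q"
  shows "bij f" "f (x + y) = f x + f y" "q (f x) = q x" "f 0 = 0"
proof -
  have add: "f (x + y) = f x + f y" for x y using assms by (simp only: form_stabilizer_def mem_Collect_eq)
  show "bij f" "f (x + y) = f x + f y" "q (f x) = q x"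
    using assms by (simp_all only: form_stabilizer_def mem_Collect_eq)
  show "f 0 = 0" using add[of 0 0] by simp
qed

lemma form_stabilizerI:
  "bij f \<Longrightarrow> (\<And>x y. f (x + y) = f x + f y) \<Longrightarrow> (\<And>x. q (f x) = q x) \<Longrightarrow> f \<in> form_stabilizer q"
  by (simp add: form_stabilizer_def)

lemma function_group_form_stabilizer: "function_group (form_stabilizer q)"
proof
  fix f assume f: "f \<in> form_stabilizer q"
  then have b: "bij f" and add: "f (x + y) = f x + f y" and q: "q (f x) = q x" for x y
    by (simp_all only: form_stabilizerD[OF f])
  have ff: "f (inv' f x) = x" for x using b by (simp add: bij_is_surj surj_f_inv_f)
  have "inv' f (x + y) = inv' f x + inv' f y" for x y
    using b by (intro inv_f_eq) (auto simp: bij_is_inj add ff)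
  moreover have "q (inv' f x) = q x" for x using q[of "inv' f x"] by (simp add: ff)
  ultimately show "inv' f \<in> form_stabilizer q"
    using b by (simp add: form_stabilizer_def bij_imp_bij_inv)
qed (auto simp: form_stabilizer_def bij_comp)

section \<open>Coordinates and the cubic form of a characteristic vector\<close>

type_synonym v3 = "bit \<times> bit \<times> bit"
text \<open>The triple holds the coordinates of \<open>a\<close>, \<open>b\<close>,
  \<open>c\<close>, the last component that of \<open>d\<close>. So \<open>(0, 1)\<close> is
  \<open>d\<close>, and \<open>fst\<close> is reduction modulo \<open>d\<close>.\<close>

type_synonym v4 = "v3 \<times> bit"

definition scale_bit :: "bit \<Rightarrow> 'v::zero \<Rightarrow> 'v" where
  "scale_bit b v = (if b = 1 then v else 0)"

lemma scale_bit_simps [simp, code]: "scale_bit 0 v = 0" "scale_bit 1 v = v"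
  by (simp_all add: scale_bit_def)

fun lin3 :: "'v \<times> 'v \<times> 'v \<Rightarrow> v3 \<Rightarrow> 'v::comm_monoid_add" where
  "lin3 (a, b, c) (x, y, z) = scale_bit x a + scale_bit y b + scale_bit z c"

text \<open>The linear map with columns \<open>u\<close> that fixes \<open>(0, 1)\<close>. As the
  stabilizers of the cubic forms fix this vector, triples encode all their elements.\<close>

fun lin4 :: "v4 \<times> v4 \<times> v4 \<Rightarrow> v4 \<Rightarrow> v4" where
  "lin4 u (w, t) = lin3 u w + (0, t)"

definition v3s :: "v3 list" where
  "v3s = List.product [0, 1] (List.product [0, 1] [0, 1])"

definition v4s :: "v4 list" where
  "v4s = List.product v3s [0, 1]"

lemma UNIV_bit: "UNIV = {0, 1::bit}"
  using bit.exhaust by blast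

lemma set_v3s [simp]: "set v3s = UNIV"
  by (simp only: v3s_def set_product list.set UNIV_bit[symmetric] UNIV_Times_UNIV)

lemma set_v4s [simp]: "set v4s = UNIV"
  by (simp only: v4s_def set_product set_v3s list.set UNIV_bit[symmetric] UNIV_Times_UNIV)

lemma finite_v4: "finite (UNIV :: v4 set)"
  using List.finite_set[of v4s] by simp

text \<open>Entries 0 to 3 come from the squares and 4 to 9 from the commutators, in the order ab,
  ac, ad, bc, bd, cd. No cubic monomial contains t because associators with \<open>d\<close> are
  trivial, and xyz has coefficient 1 because (a,b,c) = -1.\<close>

fun cubic :: "bit list \<Rightarrow> v4 \<Rightarrow> bit" where
  "cubic ls ((x, y, z), t) =
     ls ! 0 * x + ls ! 1 * y + ls ! 2 * z + ls ! 3 * t + ls ! 4 * x * y + ls ! 5 * x * z +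
     ls ! 6 * x * t + ls ! 7 * y * z + ls ! 8 * y * t + ls ! 9 * z * t + x * y * z"

text \<open>For a cubic form this is the trilinear polarization. Signs are immaterial in
  characteristic 2, and the summand \<open>q 0\<close> is left out because it is 0 for the forms
  considered.\<close>

definition third_difference :: "('v::ab_group_add \<Rightarrow> bit) \<Rightarrow> 'v \<Rightarrow> 'v \<Rightarrow> 'v \<Rightarrow> bit" where
  "third_difference q u v w =
     q (u + v + w) + q (u + v) + q (u + w) + q (v + w) + q u + q v + q w"

text \<open>The right-hand side is the determinant of the three triples, without signs. Its radical
  is spanned by \<open>(0, 1)\<close>.\<close>

lemma third_difference_cubic:
  "third_difference (cubic ls) ((a, b, c), t) ((a', b', c'), t') ((a'', b'', c''), t'') =
     a * (b' * c'' + c' * b'') + b * (a' * c'' + c' * a'') + c * (a' * b'' + b' * a'')"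
  by (simp add: third_difference_def algebra_simps)

text \<open>A map that preserves the form preserves its trilinear polarization, hence the radical of
  the latter, in which \<open>(0, 1)\<close> is the only nonzero vector.\<close>

lemma form_stabilizer_cubic_fixes:
  assumes f: "f \<in> form_stabilizer (cubic ls)"
  shows "f (0, 1) = (0, 1)"
proof -
  have b: "bij f" and add: "f (x + y) = f x + f y" and q: "cubic ls (f x) = cubic ls x" for x y
    by (simp_all only: form_stabilizerD[OF f])
  obtain a b c t where d: "f (0, 1) = ((a, b, c), t)" by (metis prod.exhaust)
  have T: "third_difference (cubic ls) (f (0, 1)) v w = 0" for v w
  proof -
    obtain v' w' where vw: "v = f v'" "w = f w'" using \<open>bij f\<close> by (metis bij_pointE)
    have "third_difference (cubic ls) (f (0, 1)) v w = third_difference (cubic ls) (0, 1) v' w'"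
      by (simp add: vw third_difference_def q flip: add)
    also have "\<dots> = 0"
      by (cases v', cases w') (auto simp: zero_prod_def third_difference_cubic split: prod.splits)
    finally show ?thesis .
  qed
  \<comment> \<open>Against two basis vectors the determinant reduces to one coordinate of its first
    row.\<close>
  have "a = 0" "b = 0" "c = 0"
    using T[of "((0,1,0),0)" "((0,0,1),0)"] T[of "((1,0,0),0)" "((0,0,1),0)"] T[of "((1,0,0),0)" "((0,1,0),0)"]
    by (simp_all add: d third_difference_cubic)
  moreover have "t \<noteq> 0"
  proof
    assume "t = 0"
    then have "f (0, 1) = f 0"
      using calculation d add[of 0 0] by (simp add: zero_prod_def)
    then show False using b by (simp add: bij_def inj_eq zero_prod_def)
  qed
  ultimately show ?thesis using d by (simp add: zero_prod_def)
qed

section \<open>Enumeration of stabilizers\<close>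

lemma zero_v4: "(0 :: v3, 0 :: bit) = 0"
  by (simp add: zero_prod_def)

text \<open>An additive map that fixes \<open>(0, 1)\<close> and sends \<open>w\<close> to
  \<open>v\<close> sends \<open>w + (0, 1)\<close> to \<open>v + (0, 1)\<close>. Comparing both
  translates on the eight vectors with last coordinate 0 therefore settles all sixteen.\<close>

definition agree :: "(v4 \<Rightarrow> bit) \<Rightarrow> v4 \<Rightarrow> v4 \<Rightarrow> bool" where
  "agree q v w \<longleftrightarrow> q v = q w \<and> q (v + (0, 1)) = q (w + (0, 1))"

text \<open>The pool \<open>vs\<close> is later either the whole space or a hyperplane; the latter
  yields the stabilizer of the hyperplane.\<close>

definition candidates :: "v4 list \<Rightarrow> (v4 \<Rightarrow> bit) \<Rightarrow> v3 \<Rightarrow> v4 list" where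
  "candidates vs q w = filter (\<lambda>v. agree q v (w, 0)) vs"

definition agreeing :: "(v4 \<Rightarrow> bit) \<Rightarrow> v3 \<Rightarrow> (v4 \<times> v4 \<times> v4) list \<Rightarrow> (v4 \<times> v4 \<times> v4) list" where
  "agreeing q w = filter (\<lambda>u. agree q (lin3 u w) (w, 0))"

definition candidate_pairs :: "v4 list \<Rightarrow> (v4 \<Rightarrow> bit) \<Rightarrow> (v4 \<times> v4) list" where
  "candidate_pairs vs q = filter (\<lambda>(a, b). agree q (a + b) ((1, 1, 0), 0))
     (List.product (candidates vs q (1, 0, 0)) (candidates vs q (0, 1, 0)))"

text \<open>The candidates are sieved in stages, which keeps the evaluation by rewriting fast.\<close>

definition stabilizer_list :: "v4 list \<Rightarrow> (v4 \<Rightarrow> bit) \<Rightarrow> (v4 \<times> v4 \<times> v4) list" where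
  "stabilizer_list vs q =
     filter (\<lambda>u. list_all (\<lambda>w. w \<noteq> 0 \<longrightarrow> fst (lin3 u w) \<noteq> 0) v3s)
       (agreeing q (1, 1, 1) (agreeing q (0, 1, 1) (agreeing q (1, 0, 1)
         (map (\<lambda>((a, b), c). (a, b, c))
           (List.product (candidate_pairs vs q) (candidates vs q (0, 0, 1)))))))"

text \<open>The stages of the sieve together test the seven nonzero combinations of the three
  images; at 0 the test is trivial. That \<open>fst\<close> does not vanish says that the images are
  independent modulo \<open>(0, 1)\<close>.\<close>

lemma set_stabilizer_list:
  "(a, b, c) \<in> set (stabilizer_list vs q) \<longleftrightarrow> {a, b, c} \<subseteq> set vs \<and>
     (\<forall>w. agree q (lin3 (a, b, c) w) (w, 0)) \<and> (\<forall>w. w \<noteq> 0 \<longrightarrow> fst (lin3 (a, b, c) w) \<noteq> 0)"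
proof -
  have all: "(\<forall>w::v3. P w) \<longleftrightarrow> list_all P v3s" for P by (simp add: list_all_iff)
  have "(a, b, c) \<in> set (map (\<lambda>((a, b), c). (a, b, c)) xs) \<longleftrightarrow> ((a, b), c) \<in> set xs" for xs :: "((v4 \<times> v4) \<times> v4) list"
    by force
  then have "(a, b, c) \<in> set (stabilizer_list vs q) \<longleftrightarrow> {a, b, c} \<subseteq> set vs \<and>
     list_all (\<lambda>w. agree q (lin3 (a, b, c) w) (w, 0)) v3s \<and> list_all (\<lambda>w. w \<noteq> 0 \<longrightarrow> fst (lin3 (a, b, c) w) \<noteq> 0) v3s"
  proof -
    assume mem: "\<And>xs. ((a, b, c) \<in> set (map (\<lambda>((a, b), c). (a, b, c)) xs)) = (((a, b), c) \<in> set xs)"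
    have "lin3 (a, b, c) (0, 0, 0) = 0" "lin3 (a, b, c) (1, 0, 0) = a" "lin3 (a, b, c) (0, 1, 0) = b"
      "lin3 (a, b, c) (0, 0, 1) = c" "lin3 (a, b, c) (1, 1, 0) = a + b"
      by simp_all
    moreover have "agree q 0 ((0, 0, 0), 0)" by (simp add: agree_def zero_prod_def)
    ultimately show ?thesis
      unfolding stabilizer_list_def agreeing_def candidate_pairs_def candidates_def
        set_filter mem_Collect_eq mem set_product mem_Times_iff fst_conv snd_conv prod.case
      by (simp only: v3s_def List.product.simps list.map append.simps list.pred_inject simp_thms) blast
  qed
  then show ?thesis by (simp only: all)
qed

lemma lin4_basis:
  "lin4 (a, b, c) ((1, 0, 0), 0) = a" "lin4 (a, b, c) ((0, 1, 0), 0) = b"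
  "lin4 (a, b, c) ((0, 0, 1), 0) = c"
  by (simp_all add: zero_v4)

lemma inj_lin4: "inj lin4"
  by (rule injI) (metis lin4_basis prod.exhaust)

lemma scale_bit_add: "scale_bit (x + y) v = scale_bit x v + scale_bit y v"
  if "v + v = 0" for v :: "'v::comm_monoid_add"
  using that by (cases x; cases y) auto

lemma v_add_self [simp]: "v + v = 0" for v :: v4
  by (cases v) (auto simp: zero_prod_def)

lemma lin4_add: "lin4 u (v + w) = lin4 u v + lin4 u w"
  by (cases u; cases v; cases w) (auto simp: scale_bit_add algebra_simps)

lemma additive_fixing_eq_lin4:
  assumes add: "\<And>x y. f (x + y) = f x + f y" and d: "f (0, 1) = (0, 1)"
  shows "f = lin4 (f ((1, 0, 0), 0), f ((0, 1, 0), 0), f ((0, 0, 1), 0))"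
proof
  fix v :: v4
  obtain x y z t where v: "v = ((x, y, z), t)" by (metis prod.exhaust)
  have f0: "f 0 = 0" using add[of 0 0] by simp
  have "v = scale_bit x ((1,0,0),0) + scale_bit y ((0,1,0),0) + scale_bit z ((0,0,1),0) + scale_bit t (0, 1)"
    by (cases x; cases y; cases z; cases t; simp add: v zero_prod_def)
  moreover have "f (scale_bit s v) = scale_bit s (f v)" for s v
    by (cases s) (auto simp: f0)
  moreover have "scale_bit t (0, 1) = ((0, t) :: v4)"
    by (cases t) (auto simp: zero_prod_def)
  ultimately have "f v = scale_bit x (f ((1,0,0),0)) + scale_bit y (f ((0,1,0),0)) + scale_bit z (f ((0,0,1),0)) + (0, t)"
    by (metis add d)
  then show "f v = lin4 (f ((1, 0, 0), 0), f ((0, 1, 0), 0), f ((0, 0, 1), 0)) v"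
    by (simp add: v)
qed

text \<open>Bijectivity is what the test on \<open>fst\<close> amounts to: a bijection that fixes
  \<open>(0, 1)\<close> sends no vector outside the span of \<open>(0, 1)\<close> into it, and
  conversely such a linear map has trivial kernel.\<close>

lemma form_stabilizer_eq_list:
  assumes fixes_d: "\<And>f. f \<in> form_stabilizer q \<Longrightarrow> f (0, 1) = (0, 1)"
  shows "{f \<in> form_stabilizer q. {f ((1, 0, 0), 0), f ((0, 1, 0), 0), f ((0, 0, 1), 0)} \<subseteq> set vs} =
    lin4 ` set (stabilizer_list vs q)"
  (is "?F = _")
proof (intro equalityI subsetI)
  fix f assume "f \<in> ?F"
  then have f: "f \<in> form_stabilizer q"
    and vs: "{f ((1, 0, 0), 0), f ((0, 1, 0), 0), f ((0, 0, 1), 0)} \<subseteq> set vs"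
    by blast+
  have b: "bij f" and add: "f (x + y) = f x + f y" and q: "q (f x) = q x" for x y
    by (simp_all only: form_stabilizerD[OF f])
  have d: "f (0, 1) = (0, 1)" using f by (rule fixes_d)
  define u where "u = (f ((1, 0, 0), 0), f ((0, 1, 0), 0), f ((0, 0, 1), 0))"
  have fu: "f = lin4 u" unfolding u_def by (rule additive_fixing_eq_lin4[OF add d])
  have l3: "lin3 u w = f (w, 0)" for w by (simp add: fu zero_v4)
  have agree: "agree q (f (w, 0)) (w, 0)" for w
    using q[of "(w, 0)"] q[of "(w, 0) + (0, 1)"] by (simp only: agree_def add d)
  have "fst (f (w, 0)) \<noteq> 0" if "w \<noteq> 0" for w
  proof
    assume "fst (f (w, 0)) = 0"
    then have "f (w, 0) = 0 \<or> f (w, 0) = (0, 1)"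
      by (cases "f (w, 0)"; cases "snd (f (w, 0))") (auto simp: zero_prod_def)
    moreover have "f 0 = 0" using add[of 0 0] by simp
    ultimately have "f (w, 0) = f 0 \<or> f (w, 0) = f (0, 1)" by (simp add: d)
    then show False using b that by (auto simp: bij_def inj_eq zero_prod_def)
  qed
  then have "u \<in> set (stabilizer_list vs q)"
    using agree vs unfolding u_def set_stabilizer_list by (simp only: l3[unfolded u_def] not_False_eq_True simp_thms) simp
  then show "f \<in> lin4 ` set (stabilizer_list vs q)" using fu by blast
next
  fix f assume "f \<in> lin4 ` set (stabilizer_list vs q)"
  then obtain u1 u2 u3 where f: "f = lin4 (u1, u2, u3)" and u: "(u1, u2, u3) \<in> set (stabilizer_list vs q)"
    by auto
  let ?u = "(u1, u2, u3)"
  have agree: "agree q (lin3 ?u w) (w, 0)" and ne: "w \<noteq> 0 \<Longrightarrow> fst (lin3 ?u w) \<noteq> 0" for w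
    using u unfolding set_stabilizer_list by blast+
  have "inj (lin4 ?u)"
  proof (rule injI)
    fix v w assume "lin4 ?u v = lin4 ?u w"
    then have "lin4 ?u (v + w) = 0" by (simp add: lin4_add)
    then have "v + w = 0"
      by (cases "v + w"; cases "fst (v + w) = 0") (use ne in \<open>auto simp: zero_prod_def plus_prod_def\<close>)
    then have "v + (w + w) = w" by (simp only: add.assoc[symmetric] add_0)
    then show "v = w" by simp
  qed
  then have "bij (lin4 ?u)" by (simp add: bij_def finite_UNIV_inj_surj[OF finite_v4])
  moreover have "q (lin4 ?u x) = q x" for x
    using agree[of "fst x"] by (cases x; cases "snd x") (auto simp: agree_def zero_v4)
  ultimately have "f \<in> form_stabilizer q"
    unfolding f by (intro form_stabilizerI lin4_add)
  moreover have "{u1, u2, u3} \<subseteq> set vs"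
    using u unfolding set_stabilizer_list by blast
  ultimately show "f \<in> ?F"
    by (simp only: mem_Collect_eq f lin4_basis simp_thms)
qed

lemma distinct_v4s: "distinct v4s"
  by code_simp

lemma distinct_stabilizer_list: "distinct vs \<Longrightarrow> distinct (stabilizer_list vs q)"
  by (auto simp: stabilizer_list_def agreeing_def candidate_pairs_def candidates_def distinct_product
      distinct_map inj_on_def intro!: distinct_filter)

section \<open>GL_3(2) acting on a hyperplane\<close>

lemma group_general_linear_group: "group (general_linear_group :: ('k::field ^ 'n ^ 'n) monoid)"
proof (rule groupI)
  fix A :: "'k^'n^'n" assume "A \<in> carrier general_linear_group"
  then obtain B where "A ** B = mat 1" "B ** A = mat 1"
    by (auto simp: general_linear_group_def invertible_def)
  then show "\<exists>B\<in>carrier general_linear_group. B \<otimes>\<^bsub>general_linear_group\<^esub> A = \<one>\<^bsub>general_linear_group\<^esub>"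
    by (auto simp: general_linear_group_def invertible_def)
next
  have "invertible (mat 1 :: 'k^'n^'n)"
    by (auto simp: invertible_def intro: exI[of _ "mat 1"])
  then show "\<one>\<^bsub>general_linear_group\<^esub> \<in> carrier (general_linear_group :: ('k ^ 'n ^ 'n) monoid)"
    by (simp add: general_linear_group_def)
qed (auto simp: general_linear_group_def invertible_mult matrix_mul_assoc)

text \<open>Triples can be evaluated and matrices act on \<open>bit ^ 3\<close>, so a translation is
  kept between the two models.\<close>

definition vec_of :: "v3 \<Rightarrow> bit ^ 3" where
  "vec_of = (\<lambda>(x, y, z). vector [x, y, z])"

definition of_vec :: "bit ^ 3 \<Rightarrow> v3" where
  "of_vec v = (v $ 1, v $ 2, v $ 3)"

lemma of_vec_vec_of [simp]: "of_vec (vec_of w) = w" "vec_of (of_vec v) = v"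
  by (auto simp: of_vec_def vec_of_def vec_eq_iff forall_3 split: prod.splits)

lemma vec_of_add: "vec_of (v + w) = vec_of v + vec_of w"
  by (auto simp: vec_of_def vec_eq_iff forall_3 split: prod.splits)

lemma of_vec_add: "of_vec (v + w) = of_vec v + of_vec w"
  by (simp add: of_vec_def)

lemma bij_of_vec: "bij of_vec" and bij_vec_of: "bij vec_of"
  by (rule o_bij[of vec_of] o_bij[of of_vec]; simp add: fun_eq_iff)+

text \<open>In block form these are an invertible 3 by 3 matrix and an entry 1 for
  \<open>(0, 1)\<close>. They are the whole stabilizer for the sixth form and the complement for the
  first.\<close>

definition stable_hyperplane_maps :: "(v4 \<Rightarrow> v4) set" where
  "stable_hyperplane_maps = {f. bij f \<and> (\<forall>x y. f (x + y) = f x + f y) \<and> f (0, 1) = (0, 1) \<and>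
     (\<forall>w. snd (f (w, 0)) = 0)}"

lemma stable_hyperplane_mapsD:
  assumes "f \<in> stable_hyperplane_maps"
  shows "bij f" "f (x + y) = f x + f y" "f (0, 1) = (0, 1)" "snd (f (w, 0)) = 0"
    "f (w, t) = (fst (f (w, 0)), t)" "fst (f (w, 0)) = 0 \<longleftrightarrow> w = 0"
proof -
  have b: "bij f" and add: "f (x + y) = f x + f y" and d: "f (0, 1) = (0, 1)" and s: "snd (f (w, 0)) = 0" for x y w
    using assms by (simp_all only: stable_hyperplane_maps_def mem_Collect_eq)
  show "bij f" "f (x + y) = f x + f y" "f (0, 1) = (0, 1)" "snd (f (w, 0)) = 0" by (fact b add d s)+
  have f0: "f 0 = 0" using add[of 0 0] by simp
  have "f (0, t) = (0, t)" using d f0 by (cases t) (simp_all add: zero_v4)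
  moreover have fw: "f (w, 0) = (fst (f (w, 0)), 0)" using s[of w] by (metis prod.collapse)
  ultimately have "f ((w, 0) + (0, t)) = (fst (f (w, 0)), 0) + (0, t)"
    by (simp only: add)
  then show "f (w, t) = (fst (f (w, 0)), t)" by simp
  have "fst (f (w, 0)) = 0 \<longleftrightarrow> f (w, 0) = f 0" using fw by (metis f0 fst_zero zero_v4)
  also have "\<dots> \<longleftrightarrow> w = 0" using b by (simp add: bij_def inj_eq zero_prod_def)
  finally show "fst (f (w, 0)) = 0 \<longleftrightarrow> w = 0" .
qed

lemma stable_hyperplane_maps_iso: "fgroup stable_hyperplane_maps \<cong> GL3_2"
proof -
  define g :: "bit^3^3 \<Rightarrow> v4 \<Rightarrow> v4" where "g A = map_prod (\<lambda>w. of_vec (A *v vec_of w)) id" for A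
  have hom: "g (A ** B) = g A \<circ> g B" for A B
    by (auto simp: g_def fun_eq_iff matrix_vector_mul_assoc)
  have mem: "g A \<in> stable_hyperplane_maps" if "invertible A" for A
  proof -
    have "bij (of_vec \<circ> (*v) A \<circ> vec_of)"
      using that by (intro bij_comp bij_of_vec bij_vec_of) (simp add: invertible_eq_bij)
    then have "bij (g A)"
      unfolding g_def using bij_betw_map_prod[of _ UNIV UNIV id UNIV UNIV] by (auto simp: o_def)
    moreover have "g A (x + y) = g A x + g A y" for x y
      by (cases x; cases y)
        (simp only: g_def map_prod_simp add_Pair vec_of_add of_vec_add matrix_vector_right_distrib id_apply)
    moreover have "vec_of 0 = 0" by (metis vec_of_add add_cancel_right_right)
    moreover have "of_vec 0 = 0" by (metis of_vec_add add_cancel_right_right)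
    ultimately show ?thesis
      unfolding stable_hyperplane_maps_def mem_Collect_eq by (auto simp add: g_def simp del: split_paired_All)
  qed
  have inj: "A = B" if "g A = g B" for A B
  proof -
    have "of_vec (A *v vec_of (of_vec v)) = of_vec (B *v vec_of (of_vec v))" for v
      using fun_cong[OF that, of "(of_vec v, 0)"] by (simp add: g_def)
    then have "A *v v = B *v v" for v
      by (metis of_vec_vec_of(2))
    then show ?thesis by (simp add: matrix_eq)
  qed
  have surj: "\<exists>A. invertible A \<and> g A = f" if f: "f \<in> stable_hyperplane_maps" for f
  proof -
    note b = stable_hyperplane_mapsD(1)[OF f] and add = stable_hyperplane_mapsD(2)[OF f]
    define k where "k w = fst (f (w, 0))" for w
    have fk: "f (w, t) = (k w, t)" for w t
      unfolding k_def by (rule stable_hyperplane_mapsD(5)[OF f])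
    have k_add: "k (v + w) = k v + k w" for v w
      using add[of "(v, 0)" "(w, 0)"] by (simp add: fk del: split_paired_All)
    have k_inj: "inj k"
      using b by (auto simp: bij_def inj_def fk)
    have "k ` UNIV = UNIV"
    proof -
      have "w \<in> range k" for w
      proof -
        obtain x where "f x = (w, 0)" using b by (metis bij_pointE)
        then show ?thesis by (cases x) (auto simp: fk)
      qed
      then show ?thesis by blast
    qed
    define h where "h v = vec_of (k (of_vec v))" for v
    have h_add: "h (v + w) = h v + h w" for v w
      by (simp add: h_def of_vec_add k_add vec_of_add)
    have h0: "h 0 = 0" using h_add[of 0 0] by simp
    have "h (c *s v) = c *s h v" for c v
      by (cases c) (simp_all add: h0)
    then have "Vector_Spaces.linear (*s) (*s) h"
      by unfold_locales (auto simp: h_add vec.scale_right_distrib vec.scale_left_distrib)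
    then have A: "matrix h *v v = h v" for v by (rule matrix_works)
    have "bij h"
      unfolding h_def using \<open>k ` UNIV = UNIV\<close> k_inj
      by (intro bij_comp[of of_vec "vec_of \<circ> k", unfolded o_def] bij_comp[of k vec_of, unfolded o_def] bij_of_vec bij_vec_of)
        (simp add: bij_def)
    then have "invertible (matrix h)"
      by (simp add: invertible_eq_bij A cong: bij_betw_cong)
    moreover have "g (matrix h) = f"
      by (auto simp: g_def fun_eq_iff A fk h_def)
    ultimately show ?thesis by blast
  qed
  have "g \<in> iso GL3_2 (fgroup stable_hyperplane_maps)"
    unfolding iso_iff
  proof (intro conjI)
    show "g \<in> hom GL3_2 (fgroup stable_hyperplane_maps)"
      by (rule homI) (auto simp: general_linear_group_def mem hom)
    show "g ` carrier GL3_2 = carrier (fgroup stable_hyperplane_maps)"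
      using mem surj by (fastforce simp: general_linear_group_def)
    show "inj_on g (carrier GL3_2)" using inj by (auto intro: inj_onI)
  qed
  then have "inv_into (carrier GL3_2) g \<in> iso (fgroup stable_hyperplane_maps) GL3_2"
    by (rule iso_inv_into) (rule group.is_monoid[OF group_general_linear_group, THEN monoid.m_closed])
  then show ?thesis by (rule is_isoI)
qed

text \<open>\<open>rel\<close> is s r s = r^-1 written without inverses, and r has order 4 because
  its order divides 4 but not 2. The relations thus become equations between products, which can be
  evaluated.\<close>

lemma (in group) dihedral_group_4I:
  assumes r: "r \<in> carrier G" and s: "s \<in> carrier G" and r4: "r \<otimes> r \<otimes> (r \<otimes> r) = \<one>" and r2: "r \<otimes> r \<noteq> \<one>"
    and s2: "s \<otimes> s = \<one>" and sr: "s \<notin> {\<one>, r, r \<otimes> r, r \<otimes> r \<otimes> r}" and rel: "s \<otimes> r \<otimes> (s \<otimes> r) = \<one>"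
    and card: "order G = 8"
  shows "G \<cong> D8" "group D8"
proof -
  have p4: "r [^] (4::nat) = \<one>" using r r4 by (simp add: numeral_eq_Suc m_assoc)
  have p2: "r [^] (2::nat) \<noteq> \<one>" using r r2 by (simp add: numeral_eq_Suc)
  have "ord r dvd 4" using p4 r by (simp add: pow_eq_id)
  then have "ord r \<in> {d. d dvd 4}" by simp
  moreover have "\<not> ord r dvd 2" using p2 r by (simp add: pow_eq_id)
  moreover have "{d::nat. d dvd 4} = {1, 2, 4}"
  proof -
    have "d \<in> {1,2,4}" if "d dvd 4" for d :: nat
    proof -
      have "d \<le> 4" using that by (intro dvd_imp_le) auto
      then have "d \<in> {0,1,2,3,4}" by auto
      then show ?thesis using that by auto
    qed
    then show ?thesis by auto
  qed
  ultimately have ord: "ord r = 4" by auto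
  have "s \<noteq> r [^] k" for k :: int
  proof
    assume "s = r [^] k"
    also have "\<dots> = r [^] (k mod 4)"
      using r ord by (simp add: int_pow_eq mod_eq_dvd_iff flip: mod_eq_dvd_iff)
    finally have "s = r [^] (k mod 4)" .
    moreover obtain n where n: "k mod 4 = int n"
      using pos_mod_sign[of 4 k] by (metis nonneg_int_cases zero_less_numeral)
    ultimately have sn: "s = r [^] n" by (simp add: int_pow_int)
    have "n < 4" using pos_mod_bound[of 4 k] n by simp
    then have "n \<in> {0, 1, 2, 3}" by auto
    then show False using sr r by (auto simp: sn numeral_eq_Suc)
  qed
  moreover have "s \<otimes> r \<otimes> s = inv r"
    using rel r s by (intro inv_equality[symmetric]) (simp_all add: m_assoc)
  ultimately show "G \<cong> D8" "group D8"
    using dihedral_groupI[OF r ord s s2] card by auto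
qed

section \<open>Groups given by lists of triples\<close>

lemma form_stabilizer_cubic_eq_list:
  "{f \<in> form_stabilizer (cubic ls). {f ((1, 0, 0), 0), f ((0, 1, 0), 0), f ((0, 0, 1), 0)} \<subseteq> set vs} =
    lin4 ` set (stabilizer_list vs (cubic ls))"
  by (rule form_stabilizer_eq_list) (rule form_stabilizer_cubic_fixes)

lemma form_stabilizer_cubic: "form_stabilizer (cubic ls) = lin4 ` set (stabilizer_list v4s (cubic ls))"
  using form_stabilizer_cubic_eq_list[of ls v4s] by simp

lemma card_lin4_image: "distinct us \<Longrightarrow> card {f \<in> lin4 ` set us. P f} = length (filter (\<lambda>u. P (lin4 u)) us)"
proof -
  assume "distinct us"
  moreover have "{f \<in> lin4 ` set us. P f} = lin4 ` set (filter (\<lambda>u. P (lin4 u)) us)"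
    by auto
  ultimately show ?thesis
    by (simp only: card_image[OF inj_on_subset[OF inj_lin4 subset_UNIV]] distinct_card distinct_filter)
qed

definition basis4 :: "v4 \<times> v4 \<times> v4" where
  "basis4 = (((1, 0, 0), 0), ((0, 1, 0), 0), ((0, 0, 1), 0))"

lemma lin4_basis4: "lin4 basis4 = id"
  using additive_fixing_eq_lin4[of id] by (simp add: basis4_def)

text \<open>Composition on the level of triples: relations between maps become equations between
  tuples of bits.\<close>

fun comp3 :: "v4 \<times> v4 \<times> v4 \<Rightarrow> v4 \<times> v4 \<times> v4 \<Rightarrow> v4 \<times> v4 \<times> v4" where
  "comp3 u (a, b, c) = (lin4 u a, lin4 u b, lin4 u c)"

lemma lin4_comp3: "lin4 (comp3 u u') = lin4 u \<circ> lin4 u'"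
proof -
  obtain a b c where u': "u' = (a, b, c)" by (metis prod.exhaust)
  have "(lin4 u \<circ> lin4 u') (x + y) = (lin4 u \<circ> lin4 u') x + (lin4 u \<circ> lin4 u') y" for x y
    by (simp only: o_apply lin4_add)
  moreover have "lin4 u (0, 1) = (0, 1)" for u by (cases u) (simp add: zero_prod_def)
  ultimately have "lin4 u \<circ> lin4 u' = lin4 ((lin4 u \<circ> lin4 u') ((1, 0, 0), 0), (lin4 u \<circ> lin4 u') ((0, 1, 0), 0), (lin4 u \<circ> lin4 u') ((0, 0, 1), 0))"
    by (intro additive_fixing_eq_lin4) (simp_all only: o_apply)
  then show ?thesis by (simp only: u' comp3.simps o_apply lin4_basis)
qed

definition permuting :: "v4 set list \<Rightarrow> (v4 \<times> v4 \<times> v4) list \<Rightarrow> bool" where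
  "permuting Ps us \<longleftrightarrow> distinct Ps \<and> (\<forall>u\<in>set us. \<forall>S\<in>set Ps. lin4 u ` S \<in> set Ps)"

definition fixing :: "v4 set list \<Rightarrow> v4 \<times> v4 \<times> v4 \<Rightarrow> bool" where
  "fixing Ps u \<longleftrightarrow> (\<forall>S\<in>set Ps. lin4 u ` S = S)"

locale listed_group =
  fixes us
  assumes group: "function_group (lin4 ` set us)" and distinct_us: "distinct us"
begin

sublocale function_group "lin4 ` set us" by (rule group)

lemma set_permuting: "permuting Ps us \<Longrightarrow> set_permuting (lin4 ` set us) Ps"
  by unfold_locales (auto simp: permuting_def)

lemma card_list: "card (lin4 ` set us) = length us"
  using card_lin4_image[OF distinct_us, of "\<lambda>_. True"] by simp

lemma only_id:
  assumes "filter P us = [basis4]" "u \<in> set us" "P u"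
  shows "lin4 u = id"
proof -
  have "u \<in> set (filter P us)"
    by (simp only: set_filter mem_Collect_eq assms(2,3) simp_thms)
  then have "u \<in> set [basis4]" by (simp only: assms(1))
  then show ?thesis by (simp add: lin4_basis4)
qed

lemma list_iso_sym_group:
  assumes "permuting Ps us" "filter (fixing Ps) us = [basis4]" "length us = fact (length Ps)"
  shows "fgroup (lin4 ` set us) \<cong> sym_group (length Ps)"
proof (rule set_permuting.iso_sym_group[OF set_permuting])
  show "{f \<in> lin4 ` set us. \<forall>S\<in>set Ps. f ` S = S} \<subseteq> {id}"
    using only_id[OF assms(2)] by (auto simp: fixing_def)
qed (use assms card_list in simp_all)

lemma list_iso_sym_group_times_Z2:
  assumes "permuting Ps us" "permuting Rs us" "filter (\<lambda>u. fixing Ps u \<and> fixing Rs u) us = [basis4]"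
    "length Rs = 2" "length us = 2 * fact (length Ps)"
  shows "fgroup (lin4 ` set us) \<cong> sym_group (length Ps) \<times>\<times> Z2"
proof (rule iso_sym_group_times_Z2[OF set_permuting set_permuting])
  show "{f \<in> lin4 ` set us. (\<forall>S\<in>set Ps. f ` S = S) \<and> (\<forall>S\<in>set Rs. f ` S = S)} \<subseteq> {id}"
    using only_id[OF assms(3)] by (auto simp: fixing_def)
qed (use assms card_list in simp_all)

lemma list_iso_D8:
  assumes "length us = 8" "r \<in> set us" "s \<in> set us" "comp3 (comp3 r r) (comp3 r r) = basis4"
    "comp3 r r \<noteq> basis4" "comp3 s s = basis4" "s \<notin> {basis4, r, comp3 r r, comp3 (comp3 r r) r}"
    "comp3 (comp3 s r) (comp3 s r) = basis4"
  shows "fgroup (lin4 ` set us) \<cong> D8" "group D8"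
proof -
  have eq: "lin4 u = lin4 u' \<longleftrightarrow> u = u'" for u u'
    using inj_lin4 by (auto dest: injD)
  show "fgroup (lin4 ` set us) \<cong> D8" "group D8"
    using group.dihedral_group_4I[OF group_fgroup, of "lin4 r" "lin4 s"] assms card_list
    by (simp_all only: fgroup_simps order_def imageI lin4_comp3[symmetric] lin4_basis4[symmetric]
        eq insert_iff empty_iff simp_thms)
qed

end

lemma listed_group_cubic: "listed_group (stabilizer_list v4s (cubic ls))"
  using function_group_form_stabilizer[of "cubic ls"]
  by unfold_locales (auto simp: form_stabilizer_cubic distinct_stabilizer_list distinct_v4s function_group_def)

section \<open>Forms that do not involve the last coordinate\<close>

definition hyperplane :: "v4 list" where
  "hyperplane = map (\<lambda>w. (w, 0)) v3s"

lemma snd_lin4: "snd (lin4 (a, b, c) ((x, y, z), t)) = x * snd a + y * snd b + z * snd c + t"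
  by (cases x; cases y; cases z) (auto simp: zero_prod_def)

text \<open>An injective linear map stabilizes the finite hyperplane as soon as it keeps three basis
  vectors inside, which is the condition imposed by the pool of candidates.\<close>

lemma hyperplane_stabilizer:
  "{f \<in> form_stabilizer (cubic ls). f ` set hyperplane = set hyperplane} =
    lin4 ` set (stabilizer_list hyperplane (cubic ls))"
  unfolding form_stabilizer_cubic_eq_list[symmetric]
proof (rule Collect_cong, rule conj_cong[OF refl])
  fix f assume f: "f \<in> form_stabilizer (cubic ls)"
  have H: "set hyperplane = {v. snd v = 0}" by (force simp: hyperplane_def)
  note add = form_stabilizerD(2)[OF f]
  let ?E = "{f ((1, 0, 0), 0), f ((0, 1, 0), 0), f ((0, 0, 1), 0)}"
  show "f ` set hyperplane = set hyperplane \<longleftrightarrow> ?E \<subseteq> set hyperplane"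
  proof
    assume "f ` set hyperplane = set hyperplane"
    moreover have "?E \<subseteq> f ` set hyperplane" by (auto simp: H)
    ultimately show "?E \<subseteq> set hyperplane" by (simp only:)
  next
    assume E: "?E \<subseteq> set hyperplane"
    obtain a b c where fu: "f = lin4 (a, b, c)"
      using additive_fixing_eq_lin4[OF add form_stabilizer_cubic_fixes[OF f]] by metis
    have "snd a = 0" "snd b = 0" "snd c = 0"
      using E unfolding fu lin4_basis H by simp_all
    then have "snd (f (w, 0)) = 0" for w
      by (cases w) (simp only: fu snd_lin4 mult_zero_right add_0)
    then have "f ` set hyperplane \<subseteq> set hyperplane" by (auto simp: H simp del: split_paired_All)
    moreover have "inj f" using form_stabilizerD(1)[OF f] by (rule bij_is_inj)
    ultimately show "f ` set hyperplane = set hyperplane"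
      by (intro endo_inj_surj) (auto intro: inj_on_subset)
  qed
qed

lemma listed_group_hyperplane: "listed_group (stabilizer_list hyperplane (cubic ls))"
proof (rule listed_group.intro)
  show "function_group (lin4 ` set (stabilizer_list hyperplane (cubic ls)))"
    unfolding hyperplane_stabilizer[symmetric]
    by (rule function_group.function_group_setwise_stabilizer[OF function_group_form_stabilizer])
  show "distinct (stabilizer_list hyperplane (cubic ls))"
    by (rule distinct_stabilizer_list) code_simp
qed

lemma cylinder_semidirect:
  assumes cyl: "\<And>w t. cubic ls (w, t) = cubic ls (w, 0)"
    and K: "fgroup (lin4 ` set (stabilizer_list hyperplane (cubic ls))) \<cong> K" "group K"
  shows "is_semidirect (fgroup (form_stabilizer (cubic ls))) Z2_cubed K"
proof -
  \<comment> \<open>The cosets of the span of \<open>(0, 1)\<close>; the kernel of the action on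
    them consists of the maps that are trivial modulo this vector.\<close>
  define Ps :: "v4 set list" where "Ps = map (\<lambda>w. {(w, 0), (w, 1)}) v3s"
  let ?F = "form_stabilizer (cubic ls)" and ?W = "set hyperplane"
  have Ps: "S \<in> set Ps \<longleftrightarrow> (\<exists>w. S = {(w, 0), (w, 1)})" for S by (auto simp: Ps_def)
  have H: "?W = {v. snd v = 0}" by (force simp: hyperplane_def)
  have coset: "f ` {(w, 0), (w, 1)} = {(fst (f (w, 0)), 0), (fst (f (w, 0)), 1)}"
    and fst_f: "fst (f (w, t)) = fst (f (w, 0))" if f: "f \<in> ?F" for f w t
  proof -
    have "f (w, 1) = f (w, 0) + (0, 1)"
      using form_stabilizerD(2)[OF f, of "(w, 0)" "(0, 1)"] form_stabilizer_cubic_fixes[OF f] by simp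
    then show "f ` {(w, 0), (w, 1)} = {(fst (f (w, 0)), 0), (fst (f (w, 0)), 1)}" "fst (f (w, t)) = fst (f (w, 0))"
      by (cases "f (w, 0)"; cases "snd (f (w, 0))"; cases t; auto)+
  qed
  have cyl': "cubic ls v = cubic ls v'" if "fst v = fst v'" for v v'
    using that cyl by (metis prod.collapse)
  interpret F: function_group ?F by (rule function_group_form_stabilizer)
  interpret P: set_permuting ?F Ps
  proof
    have "inj (\<lambda>w::v3. {(w, 0::bit), (w, 1)})" by (auto simp: inj_def doubleton_eq_iff)
    moreover have "distinct v3s" by code_simp
    ultimately show "distinct Ps" by (auto simp: Ps_def distinct_map intro: inj_on_subset)
    show "f ` S \<in> set Ps" if f: "f \<in> ?F" and S: "S \<in> set Ps" for f S
    proof -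
      obtain w where "S = {(w, 0), (w, 1)}" using S Ps by metis
      then show ?thesis using coset[OF f, of w] by (simp only: Ps) metis
    qed
  qed
  have pointwise: "f \<in> P.pointwise \<longleftrightarrow> f \<in> ?F \<and> (\<forall>w. fst (f (w, 0)) = w)" for f
  proof -
    have "f \<in> P.pointwise \<longleftrightarrow> f \<in> ?F \<and> (\<forall>w. f ` {(w, 0), (w, 1)} = {(w, 0), (w, 1)})"
      by (simp only: Ps_def set_map set_v3s ball_simps UNIV_I mem_Collect_eq simp_thms)
    also have "\<dots> \<longleftrightarrow> f \<in> ?F \<and> (\<forall>w. fst (f (w, 0)) = w)"
      by (rule conj_cong[OF refl]) (simp only: coset doubleton_eq_iff prod.inject zero_neq_one simp_thms)
    finally show ?thesis .
  qed
  \<comment> \<open>The map encoded by \<open>?u (i, j, k)\<close> adds the multiple of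
    \<open>(0, 1)\<close> by the functional i x + j y + k z. The eight functionals make up the
    normal subgroup.\<close>
  let ?u = "\<lambda>(i, j, k). (((1, 0, 0), i), ((0, 1, 0), j), ((0, 0, 1), k)) :: v4 \<times> v4 \<times> v4"
  have lin_u: "lin4 (?u (i, j, k)) ((x, y, z), t) = ((x, y, z), x * i + y * j + z * k + t)" for i j k x y z t
    by (cases x; cases y; cases z) (simp_all add: zero_prod_def)
  have fst_u: "fst (lin4 (?u ijk) v) = fst v" for ijk v
    by (cases ijk; cases v; cases "fst v") (simp only: lin_u fst_conv)
  have invol: "lin4 (?u ijk) \<circ> lin4 (?u ijk) = id" for ijk
  proof
    fix v :: v4
    obtain i j k x y z t where "ijk = (i, j, k)" "v = ((x, y, z), t)" by (metis prod.exhaust)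
    then show "(lin4 (?u ijk) \<circ> lin4 (?u ijk)) v = id v"
      by (simp only: o_apply lin_u id_apply) (simp add: ac_simps)
  qed
  have eq: "P.pointwise = lin4 ` range ?u"
  proof (intro equalityI subsetI)
    fix f assume "f \<in> P.pointwise"
    then have f: "f \<in> ?F" and fst: "fst (f (w, 0)) = w" for w by (simp_all only: pointwise)
    have "f (w, 0) = (w, snd (f (w, 0)))" for w using fst by (metis prod.collapse)
    then have "f = lin4 (?u (snd (f ((1, 0, 0), 0)), snd (f ((0, 1, 0), 0)), snd (f ((0, 0, 1), 0))))"
      unfolding prod.case
      using additive_fixing_eq_lin4[OF form_stabilizerD(2)[OF f] form_stabilizer_cubic_fixes[OF f]] by metis
    then show "f \<in> lin4 ` range ?u" by blast
  next
    fix f assume "f \<in> lin4 ` range ?u"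
    then obtain ijk where f: "f = lin4 (?u ijk)" by blast
    have "f \<in> ?F"
    proof (rule form_stabilizerI)
      show "bij f" unfolding f by (rule o_bij[OF invol invol])
      show "f (x + y) = f x + f y" for x y by (simp only: f lin4_add)
      show "cubic ls (f x) = cubic ls x" for x
        using fst_u[of ijk x] by (intro cyl') (simp only: f)
    qed
    then show "f \<in> P.pointwise" by (simp only: pointwise f fst_u fst_conv simp_thms)
  qed
  show ?thesis
  proof (rule P.is_semidirect_Z2_cubed[where W = ?W])
    show "f = id" if f: "f \<in> P.pointwise" and W: "f ` ?W = ?W" for f
    proof -
      obtain i j k where fu: "f = lin4 (?u (i, j, k))" using f unfolding eq by auto
      have "snd (f (w, 0)) = 0" for w
      proof -
        have "f (w, 0) \<in> f ` ?W" by (rule imageI) (simp add: H)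
        then show ?thesis by (simp only: W) (simp only: H mem_Collect_eq)
      qed
      from this[of "(1, 0, 0)"] this[of "(0, 1, 0)"] this[of "(0, 0, 1)"]
      have "i = 0" "j = 0" "k = 0" unfolding fu lin_u by simp_all
      then show ?thesis by (simp only: fu prod.case basis4_def[symmetric] lin4_basis4)
    qed
    show "f \<circ> f = id" if "f \<in> P.pointwise" for f
      using that invol unfolding eq by (elim imageE) (simp only:)
    show "card P.pointwise = 8"
    proof -
      have "distinct v3s" by code_simp
      then have "card (set v3s) = length v3s" by (rule distinct_card)
      moreover have "inj ?u" by (auto simp: inj_def)
      ultimately show ?thesis
        by (simp only: eq card_image inj_on_subset[OF inj_lin4 subset_UNIV] set_v3s) (simp add: v3s_def)
    qed
    show "\<exists>g\<in>P.pointwise. (g \<circ> f) ` ?W = ?W" if f: "f \<in> ?F" for f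
    proof -
      \<comment> \<open>\<open>c\<close> acts as \<open>f\<close> does modulo \<open>(0, 1)\<close>
        but maps the hyperplane to itself. It preserves the form because the form ignores the last
        coordinate, so \<open>c \<circ> inv' f\<close> is the required correction.\<close>
      define k where "k w = fst (f (w, 0))" for w
      define c where "c = map_prod k (id :: bit \<Rightarrow> bit)"
      have "inj k"
      proof (rule injI)
        fix w w' assume "k w = k w'"
        then have "f ` {(w, 0), (w, 1)} = f ` {(w', 0), (w', 1)}"
          by (simp only: coset[OF f] k_def)
        then have "{(w, 0::bit), (w, 1)} = {(w', 0), (w', 1)}"
          using form_stabilizerD(1)[OF f] by (simp only: inj_image_eq_iff bij_is_inj)
        then show "w = w'" by (simp add: doubleton_eq_iff)
      qed
      moreover have "finite (UNIV :: v3 set)" using List.finite_set[of v3s] by simp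
      ultimately have "bij k" by (simp add: bij_def finite_UNIV_inj_surj)
      then have "bij c" unfolding c_def using bij_betw_map_prod[of k UNIV UNIV id UNIV UNIV] by simp
      have k_add: "k (v + w) = k v + k w" for v w
        using form_stabilizerD(2)[OF f, of "(v, 0)" "(w, 0)"] by (simp add: k_def)
      have "c \<in> ?F"
      proof (rule form_stabilizerI)
        show "c (x + y) = c x + c y" for x y
          by (cases x; cases y) (simp only: c_def add_Pair map_prod_simp k_add id_apply)
        show "cubic ls (c x) = cubic ls x" for x
        proof -
          have "cubic ls (c x) = cubic ls (f (fst x, 0))"
            by (rule cyl') (simp only: c_def fst_map_prod k_def)
          also have "\<dots> = cubic ls (fst x, 0)" by (rule form_stabilizerD(3)[OF f])
          also have "\<dots> = cubic ls x" by (rule cyl') simp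
          finally show ?thesis .
        qed
      qed fact
      then have "c \<circ> inv' f \<in> ?F" using f by (intro F.comp_mem F.inv_mem)
      moreover have "fst ((c \<circ> inv' f) (w, 0)) = w" for w
      proof -
        have "fst (c v) = fst (f v)" for v
          using fst_f[OF f, of "fst v" "snd v"] by (simp add: c_def k_def)
        then show ?thesis
          using form_stabilizerD(1)[OF f] by (simp add: bij_is_surj surj_f_inv_f)
      qed
      ultimately have "c \<circ> inv' f \<in> P.pointwise" by (simp only: pointwise simp_thms)
      moreover have "c \<circ> inv' f \<circ> f = c"
        using F.left_inverse[OF f] by (simp only: comp_assoc comp_id)
      moreover have "c ` ?W = ?W"
      proof (rule endo_inj_surj)
        show "c ` ?W \<subseteq> ?W" by (auto simp: H c_def)
        show "inj_on c ?W" using \<open>bij c\<close> by (auto simp: bij_def intro: inj_on_subset)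
      qed simp
      ultimately show ?thesis by (intro bexI[of _ "c \<circ> inv' f"]) (simp only:)
    qed
  qed (use K hyperplane_stabilizer in simp_all)
qed

section \<open>The sixteen forms\<close>

abbreviation "C4_form i \<equiv> cubic (C4_vectors ! (i - 1))"

text \<open>The checks unfold these polynomials, so that no coefficient list has to be indexed
  during evaluation.\<close>

lemma C4_forms:
  "C4_form 1 = (\<lambda>((x, y, z), t). x + y + z + x * y + x * z + y * z + x * y * z)"
  "C4_form 2 = (\<lambda>((x, y, z), t). x * y * z)"
  "C4_form 3 = (\<lambda>((x, y, z), t). x * y + x * z + y * z + x * y * z)"
  "C4_form 4 = (\<lambda>((x, y, z), t). z + x * y + x * y * z)"
  "C4_form 5 = (\<lambda>((x, y, z), t). x * z + y * z + x * y * z)"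
  "C4_form 6 = (\<lambda>((x, y, z), t). x + y + z + t + x * y + x * z + y * z + x * y * z)"
  "C4_form 7 = (\<lambda>((x, y, z), t). t + x * y * z)"
  "C4_form 8 = (\<lambda>((x, y, z), t). x * t + x * y * z)"
  "C4_form 9 = (\<lambda>((x, y, z), t). y + x * t + x * y * z)"
  "C4_form 10 = (\<lambda>((x, y, z), t). t + x * y + x * z + x * t + x * y * z)"
  "C4_form 11 = (\<lambda>((x, y, z), t). t + x * t + x * y * z)"
  "C4_form 12 = (\<lambda>((x, y, z), t). x * t + y * z + x * y * z)"
  "C4_form 13 = (\<lambda>((x, y, z), t). y + z + x * y + x * z + x * t + y * z + x * y * z)"
  "C4_form 14 = (\<lambda>((x, y, z), t). t + x * t + y * z + x * y * z)"
  "C4_form 15 = (\<lambda>((x, y, z), t). x + t + x * t + y * z + x * y * z)"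
  "C4_form 16 = (\<lambda>((x, y, z), t). t + x * y + x * z + x * t + y * z + x * y * z)"
  by (rule ext; simp add: C4_vectors_def split: prod.splits)+

abbreviation "Out_form i \<equiv> fgroup (form_stabilizer (C4_form i))"

text \<open>The nonzero vectors of x = 0, y = 0, z = 0 and x + y + z = 0 in the hyperplane t = 0.
  These are the planes that avoid (1,1,1), the only vector there at which xyz is 1; the linear maps
  of the hyperplane that fix (1,1,1) permute them in all 24 ways.\<close>

definition planes :: "v4 set list" where
  "planes = [{((0,0,1),0), ((0,1,0),0), ((0,1,1),0)}, {((0,0,1),0), ((1,0,0),0), ((1,0,1),0)},
     {((0,1,0),0), ((1,0,0),0), ((1,1,0),0)}, {((0,1,1),0), ((1,0,1),0), ((1,1,0),0)}]"


lemma length_planes: "length planes = 4"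
  by (simp add: planes_def)

definition points :: "v4 list \<Rightarrow> v4 set list" where
  "points = map (\<lambda>v. {v})"

text \<open>With all conditions on \<open>us\<close> in one predicate, a single evaluation settles
  them.\<close>

definition sym_check :: "v4 set list \<Rightarrow> (v4 \<times> v4 \<times> v4) list \<Rightarrow> bool" where
  "sym_check Ps us \<longleftrightarrow>
     permuting Ps us \<and> filter (fixing Ps) us = [basis4] \<and> length us = fact (length Ps)"

definition sym_Z2_check :: "v4 set list \<Rightarrow> v4 set list \<Rightarrow> (v4 \<times> v4 \<times> v4) list \<Rightarrow> bool" where
  "sym_Z2_check Ps Rs us \<longleftrightarrow>
     permuting Ps us \<and> permuting Rs us \<and> filter (\<lambda>u. fixing Ps u \<and> fixing Rs u) us = [basis4] \<and>
     length Rs = 2 \<and> length us = 2 * fact (length Ps)"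

definition D8_check :: "v4 \<times> v4 \<times> v4 \<Rightarrow> v4 \<times> v4 \<times> v4 \<Rightarrow> (v4 \<times> v4 \<times> v4) list \<Rightarrow> bool" where
  "D8_check r s us \<longleftrightarrow> length us = 8 \<and> r \<in> set us \<and> s \<in> set us \<and>
     comp3 (comp3 r r) (comp3 r r) = basis4 \<and> comp3 r r \<noteq> basis4 \<and> comp3 s s = basis4 \<and>
     s \<notin> {basis4, r, comp3 r r, comp3 (comp3 r r) r} \<and> comp3 (comp3 s r) (comp3 s r) = basis4"

definition semidirect_check :: "v4 set list \<Rightarrow> v4 \<Rightarrow> (v4 \<times> v4 \<times> v4) list \<Rightarrow> bool" where
  "semidirect_check Ps e us \<longleftrightarrow> permuting Ps us \<and>
     filter (fixing Ps) (filter (\<lambda>u. lin4 u e = e) us) = [basis4] \<and>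
     list_all (\<lambda>u. comp3 u u = basis4) (filter (fixing Ps) us) \<and>
     length (filter (fixing Ps) us) = 8 \<and> length (filter (\<lambda>u. lin4 u e = e) us) = fact (length Ps) \<and>
     length us = 8 * fact (length Ps)"

context listed_group
begin

lemma sym_group_if_check: "sym_check Ps us \<Longrightarrow> fgroup (lin4 ` set us) \<cong> sym_group (length Ps)"
  using list_iso_sym_group by (simp add: sym_check_def)

lemma sym_group_times_Z2_if_check:
  "sym_Z2_check Ps Rs us \<Longrightarrow> fgroup (lin4 ` set us) \<cong> sym_group (length Ps) \<times>\<times> Z2"
  unfolding sym_Z2_check_def by (elim conjE) (rule list_iso_sym_group_times_Z2)

lemma D8_if_check:
  assumes "D8_check r s us"
  shows "fgroup (lin4 ` set us) \<cong> D8" "group D8"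
  using assms list_iso_D8[of r s] unfolding D8_check_def by blast+

lemma Z2_cubed_if_check:
  assumes "length us = 8 \<and> list_all (\<lambda>u. comp3 u u = basis4) us"
  shows "fgroup (lin4 ` set us) \<cong> Z2_cubed"
proof (rule group.elementary_abelian_8[OF group_fgroup])
  show "order (fgroup (lin4 ` set us)) = 8" using assms card_list by (simp add: order_def)
  fix f assume "f \<in> carrier (fgroup (lin4 ` set us))"
  then obtain u where "u \<in> set us" "f = lin4 u" by auto
  then show "f \<otimes>\<^bsub>fgroup (lin4 ` set us)\<^esub> f = \<one>\<^bsub>fgroup (lin4 ` set us)\<^esub>"
    using assms by (simp add: list_all_iff lin4_basis4 del: comp3.simps flip: lin4_comp3)
qed

lemma is_semidirect_if_check:
  assumes "semidirect_check Ps e us"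
  shows "is_semidirect (fgroup (lin4 ` set us)) Z2_cubed (sym_group (length Ps))"
proof -
  let ?F = "lin4 ` set us" and ?vs = "filter (\<lambda>u. lin4 u e = e) us"
  have check: "permuting Ps us" "filter (fixing Ps) ?vs = [basis4]"
    "\<forall>u\<in>set (filter (fixing Ps) us). comp3 u u = basis4"
    "length (filter (fixing Ps) us) = 8" "length ?vs = fact (length Ps)" "length us = 8 * fact (length Ps)"
    using assms unfolding semidirect_check_def list_all_iff by blast+
  interpret P: set_permuting ?F Ps using check(1) by (rule set_permuting)
  have C: "{f \<in> ?F. f ` {e} = {e}} = lin4 ` set ?vs" by auto
  interpret C: listed_group ?vs
    using function_group_setwise_stabilizer[of "{e}"] unfolding C
    by (rule listed_group.intro) (simp add: distinct_us)
  have fix_iff: "lin4 u \<in> P.pointwise \<longleftrightarrow> fixing Ps u" if "u \<in> set us" for u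
    using that by (simp add: fixing_def)
  show ?thesis
  proof (rule P.is_semidirect_Z2_cubed_card[where W = "{e}"])
    show "f = id" if f: "f \<in> P.pointwise" and e: "f ` {e} = {e}" for f
    proof -
      obtain u where u: "u \<in> set us" "f = lin4 u" using f by blast
      have "fixing Ps u" using f fix_iff[OF u(1)] by (simp only: u(2))
      moreover have "lin4 u e = e" using e by (simp add: u(2))
      ultimately show ?thesis
        using u(1) unfolding u(2) by (intro C.only_id[OF check(2)]) simp_all
    qed
    show "f \<circ> f = id" if f: "f \<in> P.pointwise" for f
    proof -
      obtain u where u: "u \<in> set us" "f = lin4 u" using f by blast
      then show ?thesis
        using f fix_iff[OF u(1)] u bspec[OF check(3), of u]
        by (simp only: set_filter mem_Collect_eq lin4_comp3[symmetric] lin4_basis4 simp_thms)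
    qed
    show "card P.pointwise = 8"
      using card_lin4_image[OF distinct_us, of "\<lambda>f. \<forall>S\<in>set Ps. f ` S = S"] check(4)
      by (simp add: fixing_def[abs_def])
    show "card ?F = 8 * card {f \<in> ?F. f ` {e} = {e}}"
      unfolding C using card_list C.card_list check(5,6) by (simp only:)
    show "fgroup {f \<in> ?F. f ` {e} = {e}} \<cong> sym_group (length Ps)"
      unfolding C
    proof (rule C.list_iso_sym_group)
      show "permuting Ps ?vs" using check(1) by (simp add: permuting_def)
    qed (rule check)+
  qed (simp_all add: sym_group_is_group)
qed

end

lemma Out_form_eq: "Out_form i = fgroup (lin4 ` set (stabilizer_list v4s (C4_form i)))"
  by (simp only: form_stabilizer_cubic)

text \<open>
  The orbits, and the dihedral generators, were found by a computer search; only the checks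
  below are part of the proof.
\<close>

lemma Out_2: "is_semidirect (Out_form 2) Z2_cubed (sym_group 4)"
proof (rule cylinder_semidirect)
  have "sym_check planes (stabilizer_list hyperplane (C4_form 2))"
    unfolding C4_forms by code_simp
  then show "fgroup (lin4 ` set (stabilizer_list hyperplane (C4_form 2))) \<cong> sym_group 4"
    using listed_group.sym_group_if_check[OF listed_group_hyperplane] by (metis length_planes)
qed (unfold C4_forms, auto simp: sym_group_is_group)

text \<open>For t = 0 the form is 1 exactly where two of x, y, z are 1, and the four points are its
  nonzero zeros. They are a basis of the hyperplane and the sum of that basis, so linear maps
  permute them freely.\<close>

lemma Out_3: "is_semidirect (Out_form 3) Z2_cubed (sym_group 4)"
proof (rule cylinder_semidirect)
  let ?Ps = "points [((0,0,1),0), ((0,1,0),0), ((1,0,0),0), ((1,1,1),0)]"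
  have "sym_check ?Ps (stabilizer_list hyperplane (C4_form 3))"
    unfolding C4_forms by code_simp
  moreover have "length ?Ps = 4" by (simp add: points_def)
  ultimately show "fgroup (lin4 ` set (stabilizer_list hyperplane (C4_form 3))) \<cong> sym_group 4"
    using listed_group.sym_group_if_check[OF listed_group_hyperplane] by metis
qed (unfold C4_forms, auto simp: sym_group_is_group)

text \<open>For t = 0 the form is 1 at the four vectors with z = 1 and at (1,1,0). The difference
  (1,1,0) pairs these four off; they are the vertices of a square with the pairs as diagonals, which
  the first generator rotates and the second reflects.\<close>

lemma Out_4: "is_semidirect (Out_form 4) Z2_cubed D8"
proof -
  have check: "D8_check (((0,1,0),0), ((1,0,0),0), ((1,0,1),0)) (((1,0,0),0), ((0,1,0),0), ((1,0,1),0))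
      (stabilizer_list hyperplane (C4_form 4))"
    unfolding C4_forms by code_simp
  show ?thesis
    by (rule cylinder_semidirect[OF _ listed_group.D8_if_check[OF listed_group_hyperplane check]])
      (unfold C4_forms, auto)
qed

text \<open>As a form without t it also splits over the maps trivial modulo \<open>(0, 1)\<close>,
  with a complement of order 6; the direct product shows elsewhere. The four sets are the planes of
  the space z = 0 that avoid \<open>(0, 1)\<close>, and the two points are the zeros with z =
  1.\<close>

lemma Out_5: "Out_form 5 \<cong> sym_group 4 \<times>\<times> Z2"
proof -
  let ?Ps = "[{((0,1,0),0), ((1,0,0),0), ((1,1,0),0)},
    {((0,1,0),0), ((1,0,0),1), ((1,1,0),1)},
    {((0,1,0),1), ((1,0,0),0), ((1,1,0),1)},
    {((0,1,0),1), ((1,0,0),1), ((1,1,0),0)}]"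
  have "sym_Z2_check ?Ps
      (points [((0,0,1),0), ((0,0,1),1)])
      (stabilizer_list v4s (C4_form 5))"
    unfolding C4_forms by code_simp
  moreover have "length ?Ps = 4" by (simp add: points_def)
  ultimately show ?thesis
    unfolding Out_form_eq using listed_group.sym_group_times_Z2_if_check[OF listed_group_cubic] by metis
qed

text \<open>On t = 0, the last coordinate of the images is a linear functional and the sum of the
  indicators of two points. A nonzero functional takes the value 1 four times, so this one is 0, and
  what remains are the linear maps of t = 0 that fix (1,1,1).\<close>

lemma Out_7: "Out_form 7 \<cong> sym_group 4"
proof -
  let ?Ps = "planes"
  have "sym_check ?Ps (stabilizer_list v4s (C4_form 7))"
    unfolding C4_forms by code_simp
  moreover have "length ?Ps = 4" by (simp add: points_def planes_def)
  ultimately show ?thesis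
    unfolding Out_form_eq using listed_group.sym_group_if_check[OF listed_group_cubic] by metis
qed

text \<open>The points are the zeros with x = 1. They form a basis with sum \<open>(0, 1)\<close>,
  so each of their permutations extends to a linear map that fixes \<open>(0, 1)\<close>.\<close>

lemma Out_8: "Out_form 8 \<cong> sym_group 4"
proof -
  let ?Ps = "points [((1,0,0),0), ((1,0,1),0), ((1,1,0),0), ((1,1,1),1)]"
  have "sym_check ?Ps (stabilizer_list v4s (C4_form 8))"
    unfolding C4_forms by code_simp
  moreover have "length ?Ps = 4" by (simp add: points_def planes_def)
  ultimately show ?thesis
    unfolding Out_form_eq using listed_group.sym_group_if_check[OF listed_group_cubic] by metis
qed

text \<open>The four zeros with x = 1 again form a basis with sum \<open>(0, 1)\<close>. On x = 0
  the form is y, so their partition by the coordinate y into two pairs is preserved. The first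
  generator permutes them in a 4-cycle.\<close>

lemma Out_9: "Out_form 9 \<cong> D8"
proof -
  have "D8_check (((1,1,1),0), ((0,1,1),1), ((0,0,1),1)) (((1,0,0),0), ((0,1,1),1), ((0,0,1),0))
      (stabilizer_list v4s (C4_form 9))"
    unfolding C4_forms by code_simp
  then show ?thesis
    unfolding Out_form_eq by (rule listed_group.D8_if_check[OF listed_group_cubic])
qed

text \<open>On x = 0 the form is t, and on x = 1 it vanishes only for y = z = 0. The orbits are the
  nonzero zeros with x = 0 and the two zeros with x = 1.\<close>

lemma Out_10: "Out_form 10 \<cong> sym_group 3 \<times>\<times> Z2"
proof -
  let ?Ps = "points [((0,0,1),0), ((0,1,0),0), ((0,1,1),0)]"
  have "sym_Z2_check ?Ps
      (points [((1,0,0),0), ((1,0,0),1)])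
      (stabilizer_list v4s (C4_form 10))"
    unfolding C4_forms by code_simp
  moreover have "length ?Ps = 3" by (simp add: points_def)
  ultimately show ?thesis
    unfolding Out_form_eq using listed_group.sym_group_times_Z2_if_check[OF listed_group_cubic] by metis
qed

text \<open>On x = 0 the form is t and on x = 1 it is yz. The orbits are the nonzero zeros with x =
  0 and the two vectors with x = 1 and value 1.\<close>

lemma Out_11: "Out_form 11 \<cong> sym_group 3 \<times>\<times> Z2"
proof -
  let ?Ps = "points [((0,0,1),0), ((0,1,0),0), ((0,1,1),0)]"
  have "sym_Z2_check ?Ps
      (points [((1,1,1),0), ((1,1,1),1)])
      (stabilizer_list v4s (C4_form 11))"
    unfolding C4_forms by code_simp
  moreover have "length ?Ps = 3" by (simp add: points_def)
  ultimately show ?thesis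
    unfolding Out_form_eq using listed_group.sym_group_times_Z2_if_check[OF listed_group_cubic] by metis
qed

text \<open>On x = 1 the form is t and on x = 0 it is yz. The four zeros with x = 1 are paired off
  by the difference (0,1,1), which again gives a square with two diagonals.\<close>

lemma Out_12: "Out_form 12 \<cong> D8"
proof -
  have "D8_check (((1,1,0),0), ((0,0,1),0), ((0,1,0),0)) (((1,0,0),0), ((0,0,1),0), ((0,1,0),0))
      (stabilizer_list v4s (C4_form 12))"
    unfolding C4_forms by code_simp
  then show ?thesis
    unfolding Out_form_eq by (rule listed_group.D8_if_check[OF listed_group_cubic])
qed

text \<open>On x = 1 the form is t, so the points are the zeros there. They form an affine plane
  over the field with two elements, whose affine group is the full symmetric group.\<close>

lemma Out_13: "Out_form 13 \<cong> sym_group 4"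
proof -
  let ?Ps = "points [((1,0,0),0), ((1,0,1),0), ((1,1,0),0), ((1,1,1),0)]"
  have "sym_check ?Ps (stabilizer_list v4s (C4_form 13))"
    unfolding C4_forms by code_simp
  moreover have "length ?Ps = 4" by (simp add: points_def planes_def)
  ultimately show ?thesis
    unfolding Out_form_eq using listed_group.sym_group_if_check[OF listed_group_cubic] by metis
qed

text \<open>On x = 0 the form is t + yz, and the points are its nonzero zeros, a basis of x = 0 with
  sum \<open>(0, 1)\<close>. On x = 1 the form is 0, so maps that fix the three points may send
  (1,0,0) to any of the eight vectors with x = 1.\<close>

lemma Out_14: "is_semidirect (Out_form 14) Z2_cubed (sym_group 3)"
proof -
  let ?Ps = "points [((0,0,1),0), ((0,1,0),0), ((0,1,1),1)]"
  have "semidirect_check ?Ps ((1,0,0),0) (stabilizer_list v4s (C4_form 14))"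
    unfolding C4_forms by code_simp
  moreover have "length ?Ps = 3" by (simp add: points_def)
  ultimately show ?thesis
    unfolding Out_form_eq using listed_group.is_semidirect_if_check[OF listed_group_cubic] by metis
qed

text \<open>The form is the fourteenth plus x. As x is the polarization with \<open>(0, 1)\<close>
  in both cases, it is invariant, and the two stabilizers agree.\<close>

lemma Out_15: "is_semidirect (Out_form 15) Z2_cubed (sym_group 3)"
proof -
  let ?Ps = "points [((0,0,1),0), ((0,1,0),0), ((0,1,1),1)]"
  have "semidirect_check ?Ps ((1,0,0),0) (stabilizer_list v4s (C4_form 15))"
    unfolding C4_forms by code_simp
  moreover have "length ?Ps = 3" by (simp add: points_def)
  ultimately show ?thesis
    unfolding Out_form_eq using listed_group.is_semidirect_if_check[OF listed_group_cubic] by metis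
qed

text \<open>On x = 0 the form is t + yz as for the two preceding ones, but on x = 1 it is y + z.
  This leaves the exchange of (0,1,0) and (0,0,1) and four images of (1,0,0).\<close>

lemma Out_16: "Out_form 16 \<cong> Z2_cubed"
proof -
  have "(\<lambda>us. length us = 8 \<and> list_all (\<lambda>u. comp3 u u = basis4) us) (stabilizer_list v4s (C4_form 16))"
    unfolding C4_forms by code_simp
  then show ?thesis
    unfolding Out_form_eq by (rule listed_group.Z2_cubed_if_check[OF listed_group_cubic])
qed

section \<open>The two forms with GL_3(2) symmetry\<close>

lemma C4_form_1_eq: "C4_form 1 (w, t) = (if w = 0 then 0 else 1)"
  unfolding C4_forms
  by (cases w; cases "fst w"; cases "fst (snd w)"; cases "snd (snd w)"; cases t) (simp_all add: zero_prod_def)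

lemma C4_form_6_eq: "C4_form 6 (w, t) = (if w = 0 then 0 else 1) + t"
  unfolding C4_forms
  by (cases w; cases "fst w"; cases "fst (snd w)"; cases "snd (snd w)"; cases t) (simp_all add: zero_prod_def)

lemma stabilizer_C4_form_6: "form_stabilizer (C4_form 6) = stable_hyperplane_maps"
proof (intro equalityI subsetI)
  fix f assume f: "f \<in> form_stabilizer (C4_form 6)"
  have d: "f (0, 1) = (0, 1)" by (rule form_stabilizer_cubic_fixes[OF f])
  have "snd (f (w, 0)) = 0" for w
  proof (cases "w = 0")
    case True
    then show ?thesis using form_stabilizerD(4)[OF f] by (simp add: zero_v4)
  next
    case False
    obtain k s where k: "f (w, 0) = (k, s)" by (metis prod.exhaust)
    have "C4_form 6 (k, s) = C4_form 6 (w, 0)"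
      using form_stabilizerD(3)[OF f, of "(w, 0)"] by (simp only: k)
    then have ks: "(if k = 0 then 0 else 1) + s = 1"
      by (simp only: C4_form_6_eq False if_False) simp
    \<comment> \<open>If the last coordinate of the image were 1, the value 1 would force
      \<open>k = 0\<close>; the image would be \<open>(0, 1)\<close>, which is already the image of
      \<open>(0, 1)\<close>.\<close>
    have "f (w, 0) \<noteq> f (0, 1)"
      using form_stabilizerD(1)[OF f] by (simp add: bij_def inj_eq)
    then have "(k, s) \<noteq> (0, 1)" unfolding k d .
    then show ?thesis using ks by (cases s) (auto simp: k split: if_splits)
  qed
  then show "f \<in> stable_hyperplane_maps"
    using form_stabilizerD(1,2)[OF f] d unfolding stable_hyperplane_maps_def mem_Collect_eq by (intro conjI allI)
next
  fix f assume f: "f \<in> stable_hyperplane_maps"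
  show "f \<in> form_stabilizer (C4_form 6)"
  proof (rule form_stabilizerI)
    show "C4_form 6 (f x) = C4_form 6 x" for x
    proof -
      obtain w t where x: "x = (w, t)" by (metis prod.exhaust)
      show ?thesis
        unfolding x stable_hyperplane_mapsD(5)[OF f, of w t] C4_form_6_eq stable_hyperplane_mapsD(6)[OF f] by (rule refl)
    qed
  qed (rule stable_hyperplane_mapsD[OF f])+
qed

lemma hyperplane_stabilizer_C4_form_1:
  "lin4 ` set (stabilizer_list hyperplane (C4_form 1)) = stable_hyperplane_maps"
  unfolding hyperplane_stabilizer[symmetric]
proof (intro equalityI subsetI)
  have H: "set hyperplane = {v. snd v = 0}" by (force simp: hyperplane_def)
  fix f assume "f \<in> {f \<in> form_stabilizer (C4_form 1). f ` set hyperplane = set hyperplane}"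
  then have f: "f \<in> form_stabilizer (C4_form 1)" and W: "f ` set hyperplane = set hyperplane" by simp_all
  have "snd (f (w, 0)) = 0" for w
  proof -
    have "f (w, 0) \<in> f ` set hyperplane" by (rule imageI) (simp add: H)
    then show ?thesis by (simp only: W) (simp only: H mem_Collect_eq)
  qed
  then show "f \<in> stable_hyperplane_maps"
    using form_stabilizerD(1,2)[OF f] form_stabilizer_cubic_fixes[OF f]
    unfolding stable_hyperplane_maps_def mem_Collect_eq by (intro conjI allI)
next
  have H: "set hyperplane = {v. snd v = 0}" by (force simp: hyperplane_def)
  fix f assume f: "f \<in> stable_hyperplane_maps"
  have "f \<in> form_stabilizer (C4_form 1)"
  proof (rule form_stabilizerI)
    show "C4_form 1 (f x) = C4_form 1 x" for x
    proof -
      obtain w t where x: "x = (w, t)" by (metis prod.exhaust)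
      show ?thesis
        unfolding x stable_hyperplane_mapsD(5)[OF f, of w t] C4_form_1_eq stable_hyperplane_mapsD(6)[OF f] by (rule refl)
    qed
  qed (rule stable_hyperplane_mapsD[OF f])+
  moreover have "f ` set hyperplane = set hyperplane"
  proof (rule endo_inj_surj)
    show "f ` set hyperplane \<subseteq> set hyperplane"
      using stable_hyperplane_mapsD(4)[OF f] by (auto simp: H simp del: split_paired_All)
    show "inj_on f (set hyperplane)"
      using stable_hyperplane_mapsD(1)[OF f] by (auto simp: bij_def intro: inj_on_subset)
  qed simp
  ultimately show "f \<in> {f \<in> form_stabilizer (C4_form 1). f ` set hyperplane = set hyperplane}" by simp
qed

lemma Out_1: "is_semidirect (Out_form 1) Z2_cubed GL3_2"
proof (rule cylinder_semidirect)
  show "fgroup (lin4 ` set (stabilizer_list hyperplane (C4_form 1))) \<cong> GL3_2"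
    unfolding hyperplane_stabilizer_C4_form_1 by (rule stable_hyperplane_maps_iso)
  show "C4_form 1 (w, t) = C4_form 1 (w, 0)" for w t by (simp only: C4_form_1_eq)
qed (rule group_general_linear_group)

lemma Out_6: "Out_form 6 \<cong> GL3_2"
  unfolding stabilizer_C4_form_6 by (rule stable_hyperplane_maps_iso)

section \<open>Code loops in coordinates\<close>

text \<open>In the extension of V by the signs that \<psi> defines, a maximal subgroup
  \<open>K\<close> avoiding the central element \<open>(1, 0)\<close> meets every fibre exactly
  once: an element over a missed \<open>v\<close> could be adjoined. So \<open>K\<close> is the
  graph of a section, and its closure under the product is the coboundary equation.\<close>

lemma finite_symmetric_cocycle_is_coboundary:
  fixes \<psi> :: "'v::ab_group_add \<Rightarrow> 'v \<Rightarrow> bit"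
  assumes fin: "finite (UNIV :: 'v set)" and char2: "\<And>v::'v. v + v = 0"
    and sym: "\<And>v w. \<psi> v w = \<psi> w v" and diag: "\<And>v. \<psi> v v = 0" and zero: "\<And>v. \<psi> 0 v = 0"
    and cocycle: "\<And>v w u. \<psi> (v + w) u + \<psi> v w = \<psi> v (w + u) + \<psi> w u"
  shows "\<exists>\<epsilon>. \<forall>v w. \<psi> v w = \<epsilon> (v + w) + \<epsilon> v + \<epsilon> w"
proof -
  define m where "m x y = (fst x + fst y + \<psi> (snd x) (snd y), snd x + snd y)" for x y :: "bit \<times> 'v"
  have m_comm: "m x y = m y x" for x y by (simp add: m_def sym[of "snd x"] add_ac)
  have m_assoc: "m (m x y) z = m x (m y z)" for x y z
    using cocycle[of "snd x" "snd y" "snd z"] by (simp add: m_def algebra_simps)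
  have m_self: "m (0, v) (0, v) = (0, 0)" for v by (simp add: m_def diag char2)
  have m_one: "m (0, 0) x = x" for x by (simp add: m_def zero)
  \<comment> \<open>Closed subsets containing the unit are subgroups here, since every element is
    its own inverse.\<close>
  define \<K> where "\<K> = {K. (0, 0) \<in> K \<and> (1, 0) \<notin> K \<and> (\<forall>x\<in>K. \<forall>y\<in>K. m x y \<in> K)}"
  have "finite (UNIV :: (bit \<times> 'v) set)"
    using fin by (simp add: finite_prod UNIV_bit)
  then have "finite (Pow (UNIV :: (bit \<times> 'v) set))" by (simp only: finite_Pow_iff)
  then have "finite \<K>" by (rule finite_subset[rotated]) (simp only: Pow_UNIV subset_UNIV)
  moreover have "{(0, 0)} \<in> \<K>" by (simp add: \<K>_def m_one)
  ultimately obtain K where K: "K \<in> \<K>" and max: "\<And>K'. K' \<in> \<K> \<Longrightarrow> K \<subseteq> K' \<Longrightarrow> K' = K"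
    using finite_has_maximal[of \<K>] by blast
  have one: "(0, 0) \<in> K" and minus: "(1, 0) \<notin> K" and closed: "x \<in> K \<Longrightarrow> y \<in> K \<Longrightarrow> m x y \<in> K" for x y
    using K by (auto simp: \<K>_def)
  have not_both: "(0, v) \<notin> K \<or> (1, v) \<notin> K" for v
    using closed[of "(0, v)" "(1, v)"] minus by (auto simp: m_def diag char2)
  have some: "(0, v) \<in> K \<or> (1, v) \<in> K" for v
  proof (rule ccontr)
    assume no: "\<not> ?thesis"
    define K' where "K' = K \<union> m (0, v) ` K"
    have "m x y \<in> K'" if "x \<in> K'" "y \<in> K'" for x y
    proof -
      have 1: "m (m (0, v) k) k' = m (0, v) (m k k')" for k k' by (rule m_assoc)
      have 2: "m k (m (0, v) k') = m (0, v) (m k k')" for k k' by (metis m_assoc m_comm)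
      have 3: "m (m (0, v) k) (m (0, v) k') = m k k'" for k k' by (metis 1 2 m_assoc m_self m_one)
      obtain k k' where k: "k \<in> K" "k' \<in> K" "x = k \<or> x = m (0, v) k" "y = k' \<or> y = m (0, v) k'"
        using \<open>x \<in> K'\<close> \<open>y \<in> K'\<close> unfolding K'_def by blast
      then have "m x y = m k k' \<or> m x y = m (0, v) (m k k')"
        using 1[of k k'] 2[of k k'] 3[of k k'] by (elim disjE) (simp_all only: simp_thms)
      moreover have "m k k' \<in> K'" "m (0, v) (m k k') \<in> K'"
        using closed[OF k(1,2)] by (simp_all add: K'_def)
      ultimately show ?thesis by (elim disjE) simp_all
    qed
    moreover have "(1, 0) \<notin> K'"
    proof
      assume "(1, 0) \<in> K'"
      then obtain k where k: "k \<in> K" "m (0, v) k = (1, 0)" using minus by (auto simp: K'_def)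
      then have "k = m (0, v) (1, 0)" by (metis m_assoc m_self m_one)
      then have "k = (1, v)" using zero[of v] by (simp add: m_def sym[of v 0])
      then show False using k no by simp
    qed
    ultimately have "K' \<in> \<K>" using one by (auto simp: \<K>_def K'_def)
    then have "K' = K" by (rule max) (auto simp: K'_def)
    moreover have "m (0, v) (0, 0) \<in> K'" using one by (auto simp: K'_def)
    ultimately show False using no m_one[of "(0, v)"] m_comm by metis
  qed
  define \<epsilon> where "\<epsilon> v = (if (1, v) \<in> K then 1 else 0 :: bit)" for v
  have \<epsilon>: "(\<epsilon> v, v) \<in> K" for v using some[of v] by (auto simp: \<epsilon>_def)
  have \<epsilon>_unique: "e = \<epsilon> v" if "(e, v) \<in> K" for e v
    using that not_both[of v] by (cases e) (auto simp: \<epsilon>_def)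
  have "\<epsilon> v + \<epsilon> w + \<psi> v w = \<epsilon> (v + w)" for v w
    using closed[OF \<epsilon>[of v] \<epsilon>[of w]] by (intro \<epsilon>_unique) (simp add: m_def)
  then have "\<psi> v w = \<epsilon> (v + w) + \<epsilon> v + \<epsilon> w" for v w
    by (metis bit_add_self(2) add.assoc add.commute)
  then show ?thesis by blast
qed

lemma bit_add_eq_0_iff: "(x::bit) + y = 0 \<longleftrightarrow> x = y"
  by (cases x; cases y) simp_all

definition polarization :: "('v::ab_group_add \<Rightarrow> bit) \<Rightarrow> 'v \<Rightarrow> 'v \<Rightarrow> bit" where
  "polarization q v w = q (v + w) + q v + q w"

text \<open>Exponent notation: \<open>h e v\<close> stands for (-1)^e v. \<open>V\<close> is a
  subset, so that a code inside the words fits as well as all of \<open>v4\<close>. Intersection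
  parities are expressed through polarizations of \<open>q\<close>, which leaves the form as the
  datum to compare.\<close>

locale coded_loop =
  fixes L :: "'a signed_loop" (structure)
    and V :: "'v::ab_group_add set"
    and h :: "bit \<Rightarrow> 'v \<Rightarrow> 'a"
    and \<phi> :: "'v \<Rightarrow> 'v \<Rightarrow> bit"
    and q :: "'v \<Rightarrow> bit"
  assumes zero_mem: "0 \<in> V"
    and add_mem: "v \<in> V \<Longrightarrow> w \<in> V \<Longrightarrow> v + w \<in> V"
    and char2: "v \<in> V \<Longrightarrow> v + v = 0"
    and h_bij: "bij_betw (\<lambda>(e, v). h e v) (UNIV \<times> V) (carrier L)"
    and h_mult: "v \<in> V \<Longrightarrow> w \<in> V \<Longrightarrow> h e v \<otimes> h f w = h (e + f + \<phi> v w) (v + w)"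
    and h_one: "\<one> = h 0 0"
    and h_minus_one: "minus_one L = h 1 0"
    and \<phi>_zero: "v \<in> V \<Longrightarrow> \<phi> 0 v = 0" "v \<in> V \<Longrightarrow> \<phi> v 0 = 0"
    and \<phi>_diag: "v \<in> V \<Longrightarrow> \<phi> v v = q v"
    and \<phi>_swap: "v \<in> V \<Longrightarrow> w \<in> V \<Longrightarrow> \<phi> v w = \<phi> w v + polarization q v w"
    and \<phi>_assoc: "v \<in> V \<Longrightarrow> w \<in> V \<Longrightarrow> u \<in> V \<Longrightarrow>
      \<phi> (v + w) u = \<phi> v (w + u) + \<phi> v w + \<phi> w u + third_difference q v w u"
begin

lemma h_inj: "v \<in> V \<Longrightarrow> w \<in> V \<Longrightarrow> h e v = h f w \<longleftrightarrow> e = f \<and> v = w"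
  using h_bij by (auto simp: bij_betw_def inj_on_def)

lemma h_closed: "v \<in> V \<Longrightarrow> h e v \<in> carrier L"
  using h_bij by (auto simp: bij_betw_def)

lemma carrier_eq: "carrier L = (\<lambda>(e, v). h e v) ` (UNIV \<times> V)"
  using h_bij by (simp add: bij_betw_def)

lemma carrierE:
  assumes "x \<in> carrier L"
  obtains e v where "v \<in> V" "x = h e v"
  using assms unfolding carrier_eq by (elim imageE) (auto split: prod.splits)

lemma mult_closed: "x \<in> carrier L \<Longrightarrow> y \<in> carrier L \<Longrightarrow> x \<otimes> y \<in> carrier L"
  by (elim carrierE) (simp add: h_mult h_closed add_mem)

lemma q_zero: "q 0 = 0"
  using \<phi>_diag[of 0] \<phi>_zero[of 0] zero_mem by simp

lemma add_eq_zero_iff: "v \<in> V \<Longrightarrow> w \<in> V \<Longrightarrow> v + w = 0 \<longleftrightarrow> w = v"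
  using char2 by (metis add_left_cancel)

lemma add_cancel: "v \<in> V \<Longrightarrow> w \<in> V \<Longrightarrow> v + (v + w) = w" "v \<in> V \<Longrightarrow> w \<in> V \<Longrightarrow> w + (v + w) = v"
  using char2 by (metis add.assoc add_0, metis add.left_commute add.commute add_0)

text \<open>The inverse is a definite description in a structure that is not a group, so its
  uniqueness is shown in coordinates.\<close>

lemma inv_h: "v \<in> V \<Longrightarrow> inv (h e v) = h (e + q v) v"
  unfolding m_inv_def
  by (rule the_equality)
    (auto simp: h_mult h_one h_closed char2 \<phi>_diag h_inj zero_mem add_mem add_eq_zero_iff bit_add_eq_0_iff ac_simps
      elim!: carrierE)

lemma square_h: "v \<in> V \<Longrightarrow> h e v \<otimes> h e v = h (q v) 0"
  by (simp add: h_mult char2 \<phi>_diag)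

lemma commutator_h:
  assumes v: "v \<in> V" and w: "w \<in> V"
  shows "commutator L (h e v) (h f w) = h (polarization q v w) 0"
proof -
  \<comment> \<open>Two instances of the cocycle identity with a repeated argument, where the third
    difference vanishes; together they eliminate \<open>\<phi> v (v + w)\<close>.\<close>
  have "\<phi> (v + w) v = \<phi> v (w + v) + \<phi> v w + \<phi> w v + third_difference q v w v"
    using v w by (intro \<phi>_assoc) auto
  moreover have "\<phi> (v + v) w = \<phi> v (v + w) + \<phi> v v + \<phi> v w + third_difference q v v w"
    using v w by (intro \<phi>_assoc) auto
  moreover have "third_difference q v w v = 0" "third_difference q v v w = 0"
    using v w by (simp_all add: third_difference_def char2 q_zero add_cancel ac_simps)
  ultimately have "q v + \<phi> v w + \<phi> (v + w) v = \<phi> v w + \<phi> w v"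
    using v w by (simp add: \<phi>_zero \<phi>_diag char2 ac_simps)
  also have "\<dots> = polarization q v w"
    using \<phi>_swap[OF v w] by (simp add: ac_simps)
  finally have *: "q v + \<phi> v w + \<phi> (v + w) v = polarization q v w" .
  have "v + w + v = w" using add_cancel(1)[OF v w] by (simp only: ac_simps)
  then have "commutator L (h e v) (h f w) = h (q v + \<phi> v w + \<phi> (v + w) v) 0"
    using v w by (simp add: commutator_def inv_h h_mult add_mem char2 \<phi>_diag add_cancel[OF v w] ac_simps)
  then show ?thesis by (simp only: *)
qed

lemma associator_h:
  assumes "v \<in> V" "w \<in> V" "u \<in> V"
  shows "associator L (h e v) (h f w) (h g u) = h (third_difference q v w u) 0"
proof -
  have "h e v \<otimes> h f w \<otimes> h g u =
      h (e + (f + g + \<phi> w u) + \<phi> v (w + u) + third_difference q v w u) (v + (w + u))"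
    using assms \<phi>_assoc[of v w u] by (simp add: h_mult add_mem ac_simps)
  then show ?thesis
    using assms by (simp add: associator_def h_mult inv_h add_mem char2 \<phi>_diag ac_simps)
qed

lemma sign_power_h: "sign_power L e = h e 0"
  by (cases e) (simp_all add: sign_power_def h_one h_minus_one)

abbreviation "sign_class v \<equiv> {h 0 v, h 1 v}"

lemma signs_eq: "signs L = sign_class 0"
  by (simp add: signs_def h_one h_minus_one)

lemma sign_class_inj: "v \<in> V \<Longrightarrow> w \<in> V \<Longrightarrow> sign_class v = sign_class w \<longleftrightarrow> v = w"
  by (auto simp: doubleton_eq_iff h_inj)

lemma signs_coset: "v \<in> V \<Longrightarrow> signs L #> h e v = sign_class v"
  by (cases e) (auto simp: r_coset_def signs_eq h_mult zero_mem \<phi>_zero)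

lemma sign_class_mult: "v \<in> V \<Longrightarrow> w \<in> V \<Longrightarrow> sign_class v <#> sign_class w = sign_class (v + w)"
  by (cases "\<phi> v w") (auto simp: set_mult_def h_mult)

lemma carrier_Mod_signs: "carrier (L Mod signs L) = sign_class ` V"
  by (auto simp: FactGroup_def RCOSETS_def carrier_eq signs_coset image_iff)

lemma inv_Mod_signs: "v \<in> V \<Longrightarrow> inv\<^bsub>L Mod signs L\<^esub> sign_class v = sign_class v"
  unfolding m_inv_def carrier_Mod_signs
  by (rule the_equality)
    (auto simp: FactGroup_def sign_class_mult signs_eq char2 sign_class_inj add_mem zero_mem add_eq_zero_iff
      simp del: insert_iff)

lemma generate_Mod_signs:
  assumes S: "S \<subseteq> V" "0 \<in> S" "\<And>v w. v \<in> S \<Longrightarrow> w \<in> S \<Longrightarrow> v + w \<in> S" and B: "B \<subseteq> S"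
  shows "generate (L Mod signs L) (sign_class ` B) \<subseteq> sign_class ` S"
proof
  fix X assume "X \<in> generate (L Mod signs L) (sign_class ` B)"
  then show "X \<in> sign_class ` S"
  proof induction
    case one
    then show ?case using S(2) by (auto simp: FactGroup_def signs_eq)
  next
    case (incl X)
    then show ?case using B by auto
  next
    case (inv X)
    then obtain v where v: "v \<in> B" "X = sign_class v" by blast
    then have "v \<in> S" "v \<in> V" using B S(1) by blast+
    then show ?case unfolding v(2) inv_Mod_signs[OF \<open>v \<in> V\<close>] by (intro imageI)
  next
    case (eng X Y)
    then obtain v w where "v \<in> S" "X = sign_class v" "w \<in> S" "Y = sign_class w" by blast
    then have "X \<otimes>\<^bsub>L Mod signs L\<^esub> Y = sign_class (v + w)"
      using S(1) by (simp add: FactGroup_def sign_class_mult subset_iff)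
    then show ?case using \<open>v \<in> S\<close> \<open>w \<in> S\<close> S(3) by blast
  qed
qed

text \<open>The bridge from the quotient by the signs, where the basis property lives, to
  \<open>V\<close>: the classes of a subspace are closed under generation.\<close>

lemma basis_mod_signs_spans:
  assumes basis: "basis_mod_signs L (map (\<lambda>(e, v). h e v) xs)" and xs: "snd ` set xs \<subseteq> S"
    and S: "S \<subseteq> V" "0 \<in> S" "\<And>v w. v \<in> S \<Longrightarrow> w \<in> S \<Longrightarrow> v + w \<in> S"
  shows "V \<subseteq> S"
proof -
  have "set (map (\<lambda>x. signs L #> x) (map (\<lambda>(e, v). h e v) xs)) = sign_class ` snd ` set xs"
    using xs S(1) by (force simp: signs_coset image_iff)
  then have "carrier (L Mod signs L) = generate (L Mod signs L) (sign_class ` snd ` set xs)"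
    using basis by (simp only: basis_mod_signs_def Let_def)
  also have "\<dots> \<subseteq> sign_class ` S"
    using S xs by (rule generate_Mod_signs)
  finally have "sign_class ` V \<subseteq> sign_class ` S" by (simp only: carrier_Mod_signs)
  show ?thesis
  proof
    fix v assume "v \<in> V"
    then have "sign_class v \<in> sign_class ` S" using \<open>sign_class ` V \<subseteq> sign_class ` S\<close> by blast
    then obtain s where "s \<in> S" "sign_class v = sign_class s" by blast
    then show "v \<in> S" using \<open>v \<in> V\<close> S(1) sign_class_inj[of v s] by (auto simp only:)
  qed
qed

end

section \<open>Outer automorphisms as stabilizers\<close>

locale coded_loop_UNIV = coded_loop L UNIV h \<phi> q
  for L :: "'a signed_loop" (structure) and h :: "bit \<Rightarrow> 'v::ab_group_add \<Rightarrow> 'a" and \<phi> q +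
  assumes finite_V: "finite (UNIV :: 'v set)"
    and nonassociative_form: "\<exists>v w u. third_difference q v w u = 1"
begin

lemmas h_mult' = h_mult[OF UNIV_I UNIV_I]
lemmas h_inj' = h_inj[OF UNIV_I UNIV_I]
lemmas h_closed' = h_closed[OF UNIV_I]
lemmas char2' = char2[OF UNIV_I]
lemmas \<phi>_zero' = \<phi>_zero(1)[OF UNIV_I] \<phi>_zero(2)[OF UNIV_I]
lemmas \<phi>_diag' = \<phi>_diag[OF UNIV_I]

definition code :: "'a \<Rightarrow> bit \<times> 'v" where
  "code = inv_into UNIV (\<lambda>(e, v). h e v)"

lemma code_h [simp]: "code (h e v) = (e, v)"
  using inv_into_f_f[of "\<lambda>(e, v). h e v" UNIV "(e, v)"] h_bij by (simp add: code_def bij_betw_def)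

lemma h_code: "x \<in> carrier L \<Longrightarrow> h (fst (code x)) (snd (code x)) = x"
  by (elim carrierE) simp

lemma autoD:
  assumes "f \<in> auto L"
  shows "x \<in> carrier L \<Longrightarrow> f x \<in> carrier L"
    and "x \<in> carrier L \<Longrightarrow> y \<in> carrier L \<Longrightarrow> f (x \<otimes> y) = f x \<otimes> f y"
    and "x \<in> carrier L \<Longrightarrow> y \<in> carrier L \<Longrightarrow> f x = f y \<longleftrightarrow> x = y"
    and "y \<in> carrier L \<Longrightarrow> \<exists>x\<in>carrier L. f x = y"
proof -
  have "f ` carrier L = carrier L" using assms by (simp add: auto_def Bij_def bij_betw_def)
  moreover assume "y \<in> carrier L"
  ultimately have "y \<in> f ` carrier L" by (simp only:)
  then show "\<exists>x\<in>carrier L. f x = y" by blast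
qed (use assms in \<open>auto simp: auto_def hom_def Bij_def bij_betw_def inj_on_def extensional_def\<close>)

text \<open>An automorphism fixes \<open>-1\<close> because \<open>-1\<close> is an associator.\<close>

lemma auto_fixes_signs:
  assumes f: "f \<in> auto L"
  shows "f (h e 0) = h e 0"
proof -
  have sq: "h a v \<otimes> h a v = h a v \<Longrightarrow> h a v = h 0 0" for a v
    by (auto simp: square_h h_inj' q_zero)
  have one: "f (h 0 0) = h 0 0"
  proof -
    have "f (h 0 0) \<otimes> f (h 0 0) = f (h 0 0)"
      using autoD(2)[OF f h_closed' h_closed', of 0 0 0 0] by (simp add: h_mult' \<phi>_zero')
    moreover obtain a v where "f (h 0 0) = h a v"
      using autoD(1)[OF f h_closed'] carrierE by metis
    ultimately show ?thesis using sq by simp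
  qed
  have minus: "f (h 1 0) = h 1 0"
  proof -
    obtain v w u where A: "third_difference q v w u = 1" using nonassociative_form by blast
    have assoc: "h a v \<otimes> h b w \<otimes> h c u = h (third_difference q v w u) 0 \<otimes> (h a v \<otimes> (h b w \<otimes> h c u))"
      for a b c v w u
      using \<phi>_assoc[of v w u] by (simp add: h_mult' \<phi>_zero' ac_simps)
    let ?x = "h 0 v" and ?y = "h 0 w" and ?z = "h 0 u"
    obtain a v' b w' c u' e m where *: "f ?x = h a v'" "f ?y = h b w'" "f ?z = h c u'" "f (h 1 0) = h e m"
      using autoD(1)[OF f h_closed'] carrierE by metis
    have "f (?x \<otimes> ?y \<otimes> ?z) = f (h 1 0) \<otimes> (f ?x \<otimes> (f ?y \<otimes> f ?z))"
      unfolding assoc A by (simp only: autoD(2)[OF f] mult_closed h_closed')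
    then have "h a v' \<otimes> h b w' \<otimes> h c u' = h e m \<otimes> (h a v' \<otimes> (h b w' \<otimes> h c u'))"
      by (simp only: autoD(2)[OF f] mult_closed h_closed' *)
    \<comment> \<open>The vectors of the two sides agree except for the additional summand
      \<open>m\<close> on the right.\<close>
    then have "m = 0"
      unfolding assoc by (simp add: h_mult' h_inj')
    moreover have "h e m \<noteq> h 0 0"
      using autoD(3)[OF f h_closed' h_closed', of 1 0 0 0] one * by (simp add: h_inj')
    ultimately show ?thesis using * by (simp add: h_inj')
  qed
  show ?thesis using one minus by (cases e) simp_all
qed

definition shift :: "('a \<Rightarrow> 'a) \<Rightarrow> 'v \<Rightarrow> bit" where
  "shift f v = fst (code (f (h 0 v)))"

definition induced :: "('a \<Rightarrow> 'a) \<Rightarrow> 'v \<Rightarrow> 'v" where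
  "induced f v = snd (code (f (h 0 v)))"

lemma auto_h:
  assumes f: "f \<in> auto L"
  shows "f (h e v) = h (e + shift f v) (induced f v)"
proof -
  have "f (h 0 v) = h (shift f v) (induced f v)"
    by (simp add: shift_def induced_def h_code autoD(1)[OF f h_closed'])
  moreover have "f (h e v) = f (h e 0) \<otimes> f (h 0 v)"
    using autoD(2)[OF f h_closed' h_closed', of e 0 0 v] by (simp add: h_mult' \<phi>_zero')
  ultimately show ?thesis by (simp add: auto_fixes_signs[OF f] h_mult' \<phi>_zero')
qed

lemma induced_mem:
  assumes f: "f \<in> auto L"
  shows "induced f \<in> form_stabilizer q"
proof (rule form_stabilizerI)
  show "induced f (v + w) = induced f v + induced f w" for v w
    using autoD(2)[OF f h_closed' h_closed', of 0 v 0 w]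
    by (simp only: h_mult' auto_h[OF f] h_inj')
  show "q (induced f v) = q v" for v
    using autoD(2)[OF f h_closed' h_closed', of 0 v 0 v]
    by (simp only: square_h[OF UNIV_I] auto_fixes_signs[OF f] auto_h[OF f, of 0 v] h_inj')
  show "bij (induced f)"
  proof (rule bijI)
    show "inj (induced f)"
    proof (rule injI)
      fix v w assume "induced f v = induced f w"
      then have "f (h 0 v) = f (h (shift f v + shift f w) w)"
        by (simp add: auto_h[OF f] ac_simps)
      then show "v = w" by (simp only: autoD(3)[OF f h_closed' h_closed'] h_inj')
    qed
    show "surj (induced f)"
    proof (unfold surj_def, rule allI)
      fix w
      obtain x where x: "x \<in> carrier L" "f x = h 0 w" using autoD(4)[OF f h_closed'] by blast
      then obtain e v where "x = h e v" using carrierE by metis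
      then show "\<exists>v. w = induced f v" using x(2) by (auto simp: auto_h[OF f] h_inj')
    qed
  qed
qed

lemma form_stabilizer_lift:
  assumes g: "g \<in> form_stabilizer q"
  shows "\<exists>f\<in>auto L. induced f = g"
proof -
  note add = form_stabilizerD(2)[OF g] and q_g = form_stabilizerD(3)[OF g] and g0 = form_stabilizerD(4)[OF g]
  define \<psi> where "\<psi> v w = \<phi> (g v) (g w) + \<phi> v w" for v w
  have "\<exists>\<epsilon>. \<forall>v w. \<psi> v w = \<epsilon> (v + w) + \<epsilon> v + \<epsilon> w"
  proof (rule finite_symmetric_cocycle_is_coboundary[OF finite_V char2'])
    show "\<psi> v v = 0" for v by (simp add: \<psi>_def \<phi>_diag' q_g)
    show "\<psi> 0 v = 0" for v by (simp add: \<psi>_def g0 \<phi>_zero')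
    have "polarization q (g v) (g w) = polarization q v w" for v w
      by (simp add: polarization_def q_g flip: add)
    then show "\<psi> v w = \<psi> w v" for v w
      using \<phi>_swap[of v w] \<phi>_swap[of "g v" "g w"] by (simp add: \<psi>_def ac_simps)
    \<comment> \<open>Both factor sets miss the cocycle identity by the same third difference, so it
      cancels in \<psi>.\<close>
    have "third_difference q (g v) (g w) (g u) = third_difference q v w u" for v w u
      by (simp add: third_difference_def q_g flip: add)
    then show "\<psi> (v + w) u + \<psi> v w = \<psi> v (w + u) + \<psi> w u" for v w u
      using \<phi>_assoc[of v w u] \<phi>_assoc[of "g v" "g w" "g u"] by (simp add: \<psi>_def add ac_simps)
  qed
  then obtain \<epsilon> where \<epsilon>: "\<phi> (g v) (g w) + \<phi> v w = \<epsilon> (v + w) + \<epsilon> v + \<epsilon> w" for v w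
    by (auto simp: \<psi>_def)
  \<comment> \<open>The lift is (e, v) \<mapsto> (e + \<epsilon> v, g v): the sign \<epsilon>
    compensates the change of the factor set under \<open>g\<close>.\<close>
  define f where "f = restrict (\<lambda>x. h (fst (code x) + \<epsilon> (snd (code x))) (g (snd (code x)))) (carrier L)"
  have f_h: "f (h e v) = h (e + \<epsilon> v) (g v)" for e v
    by (simp add: f_def h_closed')
  have \<epsilon>0: "\<epsilon> 0 = 0" using \<epsilon>[of 0 0] by (simp add: g0 \<phi>_zero')
  have "f \<in> hom L L"
  proof (rule homI)
    fix x y assume "x \<in> carrier L" "y \<in> carrier L"
    then obtain a v b w where xy: "x = h a v" "y = h b w" using carrierE by metis
    have "\<epsilon> (v + w) + \<phi> v w = \<epsilon> v + \<epsilon> w + \<phi> (g v) (g w)"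
      using \<epsilon>[of v w] by (metis add.assoc add.commute bit_add_self(2))
    then show "f (x \<otimes> y) = f x \<otimes> f y"
      by (simp add: xy h_mult' f_h add h_inj' ac_simps)
  qed (auto simp: f_h h_closed' elim!: carrierE)
  moreover have "bij_betw f (carrier L) (carrier L)"
  proof (rule bij_betwI')
    fix x y assume "x \<in> carrier L" "y \<in> carrier L"
    then obtain a v b w where xy: "x = h a v" "y = h b w" using carrierE by metis
    show "f x = f y \<longleftrightarrow> x = y"
      using form_stabilizerD(1)[OF g] by (auto simp: xy f_h h_inj' bij_def inj_eq)
  next
    fix x assume "x \<in> carrier L"
    then show "f x \<in> carrier L" by (auto simp: f_h h_closed' elim!: carrierE)
  next
    fix y assume "y \<in> carrier L"
    then obtain b w where y: "y = h b w" using carrierE by metis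
    obtain v where "g v = w" using form_stabilizerD(1)[OF g] by (metis bij_pointE)
    then have "y = f (h (b + \<epsilon> v) v)" by (simp add: f_h y ac_simps)
    then show "\<exists>x\<in>carrier L. y = f x" using h_closed' by blast
  qed
  ultimately have "f \<in> auto L" by (simp add: auto_def Bij_def f_def)
  moreover have "induced f = g" by (simp add: fun_eq_iff induced_def f_h)
  ultimately show ?thesis by blast
qed

text \<open>\<open>L\<close> is only a loop; closure of the product is all that composites and
  inverses of automorphisms require.\<close>

lemma subgroup_auto: "subgroup (auto L) (BijGroup (carrier L))"
proof (rule subgroup.intro)
  show "auto L \<subseteq> carrier (BijGroup (carrier L))"
    by (force simp: auto_def BijGroup_def)
  show "x \<otimes>\<^bsub>BijGroup (carrier L)\<^esub> y \<in> auto L" if "x \<in> auto L" "y \<in> auto L" for x y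
  proof -
    have "compose (carrier L) x y \<in> hom L L"
      using autoD(1,2)[OF that(1)] autoD(1,2)[OF that(2)] mult_closed
      by (auto simp: hom_def compose_def)
    then show ?thesis
      using that by (simp add: BijGroup_def auto_def compose_Bij)
  qed
  show "\<one>\<^bsub>BijGroup (carrier L)\<^esub> \<in> auto L"
    by (auto simp: BijGroup_def auto_def id_Bij hom_def mult_closed)
  show "inv\<^bsub>BijGroup (carrier L)\<^esub> x \<in> auto L" if x: "x \<in> auto L" for x
  proof -
    have "x \<in> Bij (carrier L)" using x by (simp add: auto_def)
    moreover have "restrict (inv_into (carrier L) x) (carrier L) \<in> hom L L"
      using autoD(2)[OF x] \<open>x \<in> Bij (carrier L)\<close> mult_closed
      by (auto simp: hom_def Bij_inv_into_mem intro!: Bij_inv_into_lemma)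
    ultimately show ?thesis by (simp add: inv_BijGroup auto_def restrict_inv_into_Bij)
  qed
qed

lemma group_AutoGroup: "group (AutoGroup L)"
  unfolding AutoGroup_def by (rule subgroup.subgroup_is_group[OF subgroup_auto group_BijGroup])

lemma Out_iso: "Out L \<cong> fgroup (form_stabilizer q)"
proof -
  have "induced \<in> hom (AutoGroup L) (fgroup (form_stabilizer q))"
  proof (rule homI)
    fix f g assume "f \<in> carrier (AutoGroup L)" "g \<in> carrier (AutoGroup L)"
    then have f: "f \<in> auto L" and g: "g \<in> auto L" by (simp_all add: AutoGroup_def)
    then have eq: "f \<otimes>\<^bsub>AutoGroup L\<^esub> g = compose (carrier L) f g"
      by (simp add: AutoGroup_def BijGroup_def auto_def)
    show "induced (f \<otimes>\<^bsub>AutoGroup L\<^esub> g) = induced f \<otimes>\<^bsub>fgroup (form_stabilizer q)\<^esub> induced g"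
      unfolding eq
      by (simp add: fun_eq_iff induced_def[of "compose _ _ _"] compose_eq h_closed' auto_h[OF f] auto_h[OF g])
  qed (simp add: AutoGroup_def induced_mem)
  then have gh: "group_hom (AutoGroup L) (fgroup (form_stabilizer q)) induced"
    by (intro group_hom.intro group_hom_axioms.intro group_AutoGroup
        function_group.group_fgroup[OF function_group_form_stabilizer])
  have "kernel (AutoGroup L) (fgroup (form_stabilizer q)) induced = {f \<in> auto L. induced f = id}"
    by (simp add: kernel_def AutoGroup_def)
  also have "\<dots> = sign_auto L"
    unfolding sign_auto_def
  proof (rule Collect_cong, rule conj_cong[OF refl])
    fix f assume f: "f \<in> auto L"
    have "(\<forall>x\<in>carrier L. f x = x \<or> f x = minus_one L \<otimes> x) \<longleftrightarrow>
        (\<forall>e v. f (h e v) = h e v \<or> f (h e v) = h (1 + e) v)"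
      by (auto simp: carrier_eq h_minus_one h_mult' \<phi>_zero')
    \<comment> \<open>Once the vectors are fixed, only the sign \<open>shift f v\<close> is left,
      and both of its values are allowed.\<close>
    also have "\<dots> \<longleftrightarrow> (\<forall>v. induced f v = v)"
    proof -
      have "s = 0 \<or> s = 1" for s :: bit by (cases s) simp_all
      then show ?thesis by (auto simp: auto_h[OF f] h_inj' add.commute)
    qed
    finally show "induced f = id \<longleftrightarrow> (\<forall>x\<in>carrier L. f x = x \<or> f x = minus_one L \<otimes> x)"
      by (auto simp: fun_eq_iff)
  qed
  finally have "Out L = AutoGroup L Mod kernel (AutoGroup L) (fgroup (form_stabilizer q)) induced"
    by (simp add: Out_def)
  also have "\<dots> \<cong> fgroup (form_stabilizer q)"
  proof (rule group_hom.FactGroup_iso[OF gh])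
    show "induced ` carrier (AutoGroup L) = carrier (fgroup (form_stabilizer q))"
      using induced_mem form_stabilizer_lift by (force simp: AutoGroup_def)
  qed
  finally show ?thesis .
qed

end

section \<open>From code loops to cubic forms\<close>

definition bit_sign :: "bit \<Rightarrow> int" where
  "bit_sign e = (if e = 1 then -1 else 1)"

lemma bit_sign_add: "bit_sign (e + f) = bit_sign e * bit_sign f"
  by (cases e; cases f) (simp_all add: bit_sign_def)

lemma bit_sign_inj [simp]: "bit_sign e = bit_sign f \<longleftrightarrow> e = f"
  by (cases e; cases f) (simp_all add: bit_sign_def)

text \<open>\<open>of_nat\<close> into \<open>bit\<close> is reduction modulo 2.\<close>

lemma bit_sign_of_nat: "(-1) ^ k = bit_sign (of_nat k)"
  by (induction k) (simp_all add: bit_sign_add, simp_all add: bit_sign_def)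

lemma bij_betw_bit_sign: "bij_betw bit_sign UNIV {1, -1}"
  by (simp add: bij_betw_def inj_def UNIV_bit) (simp add: bit_sign_def)

lemma card_symmetric_difference:
  assumes "finite X" "finite Y"
  shows "card ((X \<union> Y) - (X \<inter> Y)) + 2 * card (X \<inter> Y) = card X + card Y"
proof -
  have "X \<union> Y = ((X \<union> Y) - (X \<inter> Y)) \<union> (X \<inter> Y)" by blast
  moreover have "card (((X \<union> Y) - (X \<inter> Y)) \<union> (X \<inter> Y)) = card ((X \<union> Y) - (X \<inter> Y)) + card (X \<inter> Y)"
    using assms by (intro card_Un_disjoint) auto
  ultimately have "card (X \<union> Y) = card ((X \<union> Y) - (X \<inter> Y)) + card (X \<inter> Y)" by metis
  then show ?thesis using card_Un_Int[OF assms] by simp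
qed

lemma supp_add: "supp (v + w) = (supp v \<union> supp w) - (supp v \<inter> supp w)"
proof -
  have "v i + w i = 1 \<longleftrightarrow> (v i = 1) \<noteq> (w i = 1)" for i
    by (cases "v i"; cases "w i") simp_all
  then show ?thesis
    by (simp only: supp_def set_eq_iff Un_iff Diff_iff Int_iff mem_Collect_eq plus_fun_apply) blast
qed

locale doubly_even =
  fixes m V
  assumes code: "double_even_code m V"
begin

lemma finite_supp: "v \<in> V \<Longrightarrow> finite (supp v)"
proof -
  assume "v \<in> V"
  then have "supp v \<subseteq> {..<m}"
    using code by (fastforce simp: double_even_code_def F2_space_def supp_def not_le[symmetric])
  then show ?thesis by (rule finite_subset) simp
qed

lemma zero_mem: "0 \<in> V" and add_mem: "v \<in> V \<Longrightarrow> w \<in> V \<Longrightarrow> v + w \<in> V"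
  using code by (auto simp: double_even_code_def intro: F2.subspace_0 F2.subspace_add)

lemma char2: "v + v = (0 :: word2)"
  by (simp add: fun_eq_iff)

definition weight_form :: "word2 \<Rightarrow> bit" where
  "weight_form v = of_nat (card (supp v) div 4)"

text \<open>|v + w| = |v| + |w| - 2 |v \<inter> w|, divided by 4.\<close>

lemma polarization_weight_form:
  assumes v: "v \<in> V" and w: "w \<in> V"
  shows "polarization weight_form v w = of_nat (card (supp v \<inter> supp w) div 2)"
proof -
  have "4 dvd card (supp v)" "4 dvd card (supp w)" "4 dvd card (supp (v + w))" "2 dvd card (supp v \<inter> supp w)"
    using code v w add_mem by (auto simp: double_even_code_def)
  moreover have "card (supp (v + w)) + 2 * card (supp v \<inter> supp w) = card (supp v) + card (supp w)"
    using card_symmetric_difference[OF finite_supp[OF v] finite_supp[OF w]] by (simp only: supp_add)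
  ultimately have "card (supp (v + w)) div 4 + card (supp v \<inter> supp w) div 2 = card (supp v) div 4 + card (supp w) div 4"
    by (elim dvdE) simp
  then have "weight_form (v + w) + of_nat (card (supp v \<inter> supp w) div 2) = weight_form v + weight_form w"
    unfolding weight_form_def by (metis of_nat_add)
  then show ?thesis
    unfolding polarization_def by (metis add.assoc bit_add_self(2))
qed

text \<open>The same identity inside the support of \<open>u\<close>, divided by 2, measures how far
  the polarization is from being additive, and that defect is the third difference.\<close>

lemma third_difference_weight_form:
  assumes v: "v \<in> V" and w: "w \<in> V" and u: "u \<in> V"
  shows "third_difference weight_form v w u = of_nat (card (supp v \<inter> supp w \<inter> supp u))"
proof -
  let ?v = "supp v \<inter> supp u" and ?w = "supp w \<inter> supp u" and ?vw = "supp (v + w) \<inter> supp u"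
  have "2 dvd card ?v" "2 dvd card ?w" "2 dvd card ?vw"
    using code v w u add_mem by (auto simp: double_even_code_def)
  moreover have "?vw = (?v \<union> ?w) - (?v \<inter> ?w)" "supp v \<inter> supp w \<inter> supp u = ?v \<inter> ?w"
    by (auto simp: supp_add)
  then have "card ?vw + 2 * card (supp v \<inter> supp w \<inter> supp u) = card ?v + card ?w"
    using card_symmetric_difference[of ?v ?w] finite_supp[OF v] finite_supp[OF w] by simp
  ultimately have "card ?vw div 2 + card (supp v \<inter> supp w \<inter> supp u) = card ?v div 2 + card ?w div 2"
    by (elim dvdE) simp
  then have "polarization weight_form (v + w) u + of_nat (card (supp v \<inter> supp w \<inter> supp u)) =
      polarization weight_form v u + polarization weight_form w u"
    using v w u by (simp only: polarization_weight_form add_mem) (metis of_nat_add)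
  then have "of_nat (card (supp v \<inter> supp w \<inter> supp u)) =
      polarization weight_form (v + w) u + (polarization weight_form v u + polarization weight_form w u)"
    by (metis bit_add_self(2))
  also have "\<dots> = third_difference weight_form v w u"
    by (simp add: polarization_def third_difference_def ac_simps)
  finally show ?thesis by simp
qed

end

lemma code_loop_coded:
  fixes L :: "'a signed_loop"
  assumes "code_loop_of_rank n L"
  shows "\<exists>V h \<phi> q. coded_loop L (V :: word2 set) h \<phi> q \<and> F2.dim V = n"
proof -
  obtain m V \<phi> h where code: "double_even_code m V" and dim: "F2.dim V = n" and \<phi>: "code_factor V \<phi>"
    and h: "h \<in> iso (code_loop_of V \<phi>) L" and h': "h (minus_one (code_loop_of V \<phi>)) = minus_one L" and L: "loop L"
    using assms unfolding code_loop_of_rank_def by (elim conjE exE bexE)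
  have h_minus: "h (-1, 0) = minus_one L" using h' by (simp add: code_loop_of_def)
  interpret doubly_even m V by unfold_locales (rule code)
  interpret L: loop L by (rule L)
  define \<psi> where "\<psi> v w = (if \<phi> v w = -1 then 1 else 0 :: bit)" for v w
  have \<phi>_values: "\<And>v w. v \<in> V \<Longrightarrow> w \<in> V \<Longrightarrow> \<phi> v w \<in> {1, -1}"
    and \<phi>_diag: "\<And>v. v \<in> V \<Longrightarrow> \<phi> v v = (-1) ^ (card (supp v) div 4)"
    and \<phi>_swap: "\<And>v w. v \<in> V \<Longrightarrow> w \<in> V \<Longrightarrow> \<phi> v w = (-1) ^ (card (supp v \<inter> supp w) div 2) * \<phi> w v"
    and \<phi>_zero: "\<And>v. v \<in> V \<Longrightarrow> \<phi> 0 v = 1 \<and> \<phi> v 0 = 1"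
    and \<phi>_assoc: "\<And>v w u. v \<in> V \<Longrightarrow> w \<in> V \<Longrightarrow> u \<in> V \<Longrightarrow>
        \<phi> (v + w) u = \<phi> v (w + u) * \<phi> v w * \<phi> w u * (-1) ^ card (supp v \<inter> supp w \<inter> supp u)"
    using \<phi> unfolding code_factor_def by blast+
  have \<psi>: "\<phi> v w = bit_sign (\<psi> v w)" if "v \<in> V" "w \<in> V" for v w
    using \<phi>_values[OF that] by (auto simp: \<psi>_def bit_sign_def)
  define k where "k e v = h (bit_sign e, v)" for e v
  have k_mult: "k e v \<otimes>\<^bsub>L\<^esub> k f w = k (e + f + \<psi> v w) (v + w)" if "v \<in> V" "w \<in> V" for e f v w
  proof -
    have "(bit_sign e, v) \<in> carrier (code_loop_of V \<phi>)" "(bit_sign f, w) \<in> carrier (code_loop_of V \<phi>)"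
      using that by (auto simp: code_loop_of_def bit_sign_def)
    moreover have "h \<in> hom (code_loop_of V \<phi>) L" using h by (simp add: iso_def)
    ultimately have "k e v \<otimes>\<^bsub>L\<^esub> k f w = h ((bit_sign e, v) \<otimes>\<^bsub>code_loop_of V \<phi>\<^esub> (bit_sign f, w))"
      unfolding k_def
      by (intro hom_mult[symmetric, of h "code_loop_of V \<phi>" L "(bit_sign e, v)" "(bit_sign f, w)"])
    then show ?thesis using that by (simp add: code_loop_of_def k_def \<psi> bit_sign_add)
  qed
  have k_bij: "bij_betw (\<lambda>(e, v). k e v) (UNIV \<times> V) (carrier L)"
  proof -
    have "bij_betw h ({1, -1} \<times> V) (carrier L)"
      using h by (simp add: iso_def code_loop_of_def)
    moreover have "bij_betw (map_prod bit_sign id) (UNIV \<times> V) ({1, -1} \<times> V)"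
      by (intro bij_betw_map_prod bij_betw_bit_sign) simp
    ultimately have "bij_betw (h \<circ> map_prod bit_sign id) (UNIV \<times> V) (carrier L)"
      by (rule bij_betw_trans[rotated])
    moreover have "h \<circ> map_prod bit_sign id = (\<lambda>(e, v). k e v)" by (auto simp: k_def)
    ultimately show ?thesis by simp
  qed
  have \<psi>0: "\<psi> 0 v = 0" "\<psi> v 0 = 0" if "v \<in> V" for v
    using \<phi>_zero[OF that] by (simp_all add: \<psi>_def)
  have one: "\<one>\<^bsub>L\<^esub> = k 0 0"
  proof -
    have k0: "k 0 0 \<in> carrier L" using k_bij zero_mem by (auto simp: bij_betw_def)
    \<comment> \<open>By unique division, an idempotent of a loop is its unit.\<close>
    have "k 0 0 \<otimes>\<^bsub>L\<^esub> k 0 0 = k 0 0" by (simp add: k_mult zero_mem \<psi>0)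
    then show ?thesis using L.left_div[OF k0 k0] L.r_one[OF k0] L.one_closed k0 by blast
  qed
  have "coded_loop L V k \<psi> weight_form"
  proof
    show "minus_one L = k 1 0" using h_minus by (simp add: k_def bit_sign_def)
    show "\<psi> v v = weight_form v" if "v \<in> V" for v
      using \<phi>_diag[OF that] by (simp only: \<psi>[OF that that] bit_sign_of_nat bit_sign_inj weight_form_def)
    show "\<psi> v w = \<psi> w v + polarization weight_form v w" if "v \<in> V" "w \<in> V" for v w
    proof -
      have "bit_sign (\<psi> v w) = bit_sign (of_nat (card (supp v \<inter> supp w) div 2) + \<psi> w v)"
        using \<phi>_swap[OF that] that by (simp only: \<psi> bit_sign_of_nat bit_sign_add)
      then show ?thesis using that by (simp add: polarization_weight_form add.commute)
    qed
    show "\<psi> (v + w) u = \<psi> v (w + u) + \<psi> v w + \<psi> w u + third_difference weight_form v w u"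
      if "v \<in> V" "w \<in> V" "u \<in> V" for v w u
    proof -
      have "bit_sign (\<psi> (v + w) u) =
          bit_sign (\<psi> v (w + u) + \<psi> v w + \<psi> w u + of_nat (card (supp v \<inter> supp w \<inter> supp u)))"
        using \<phi>_assoc[OF that] that by (simp only: \<psi> add_mem bit_sign_of_nat bit_sign_add)
      then show ?thesis using that by (simp only: bit_sign_inj third_difference_weight_form)
    qed
  qed (use zero_mem add_mem char2 k_mult k_bij one \<psi>0 in auto)
  then show ?thesis using dim by blast
qed

lemma (in coded_loop) change_coordinates:
  fixes g :: "'w::ab_group_add \<Rightarrow> _"
  assumes g: "bij_betw g UNIV V" and add: "\<And>x y. g (x + y) = g x + g y"
  shows "coded_loop L UNIV (\<lambda>e x. h e (g x)) (\<lambda>x y. \<phi> (g x) (g y)) (\<lambda>x. q (g x))"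
proof -
  have mem: "g x \<in> V" for x using g by (auto simp: bij_betw_def)
  have inj: "g x = g y \<longleftrightarrow> x = y" for x y using g by (auto simp: bij_betw_def inj_eq)
  have g0: "g 0 = 0" using add[of 0 0] by simp
  show ?thesis
  proof
    show "x + x = 0" for x :: 'w
      using char2[OF mem[of x]] inj[of "x + x" 0] by (simp add: add g0)
    have "bij_betw (map_prod id g) (UNIV \<times> UNIV) (UNIV \<times> V)"
      by (intro bij_betw_map_prod g) simp
    from bij_betw_trans[OF this h_bij]
    show "bij_betw (\<lambda>(e, x). h e (g x)) (UNIV \<times> UNIV) (carrier L)"
      by (simp add: comp_def case_prod_unfold)
    show "\<phi> (g x) (g y) = \<phi> (g y) (g x) + polarization (\<lambda>x. q (g x)) x y" for x y
      using \<phi>_swap[OF mem[of x] mem[of y]] by (simp add: polarization_def add)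
    show "\<phi> (g (x + y)) (g z) = \<phi> (g x) (g (y + z)) + \<phi> (g x) (g y) + \<phi> (g y) (g z) +
        third_difference (\<lambda>x. q (g x)) x y z" for x y z
      using \<phi>_assoc[OF mem[of x] mem[of y] mem[of z]] by (simp add: third_difference_def add)
  qed (simp_all add: mem add g0 h_mult h_one h_minus_one \<phi>_zero \<phi>_diag)
qed

text \<open>Unlike in \<open>lin4\<close>, the fourth vector is arbitrary and the values may be
  words.\<close>

fun combination :: "'v \<times> 'v \<times> 'v \<times> 'v \<Rightarrow> v4 \<Rightarrow> 'v::ab_group_add" where
  "combination (a, b, c, d) ((x, y, z), t) =
     scale_bit x a + scale_bit y b + scale_bit z c + scale_bit t d"

lemma combination_add:
  assumes "a + a = 0" "b + b = 0" "c + c = 0" "d + d = 0"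
  shows "combination (a, b, c, d) (v + w) = combination (a, b, c, d) v + combination (a, b, c, d) w"
proof -
  obtain x y z t x' y' z' t' where "v = ((x, y, z), t)" "w = ((x', y', z'), t')" by (metis prod.exhaust)
  then show ?thesis
    by (simp add: scale_bit_add[OF assms(1)] scale_bit_add[OF assms(2)] scale_bit_add[OF assms(3)]
        scale_bit_add[OF assms(4)] ac_simps)
qed

text \<open>\<open>q\<close> is additive up to its polarization, and the polarization up to the
  third difference. Expanding the sum of all four vectors from the left meets the third difference
  of \<open>a + b\<close>, \<open>c\<close> and \<open>d\<close>, hence the condition with
  \<open>a + b\<close>.\<close>

lemma form_combination:
  assumes abc: "third_difference q a b c = 1"
    and d: "third_difference q d a b = 0" "third_difference q d a c = 0" "third_difference q d b c = 0"
      "third_difference q d (a + b) c = 0" and q0: "q 0 = 0"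
  shows "q (combination (a, b, c, d) v) =
    cubic [q a, q b, q c, q d, polarization q a b, polarization q a c, polarization q a d,
      polarization q b c, polarization q b d, polarization q c d] v"
proof -
  have q_add: "q (v + w) = q v + q w + polarization q v w" for v w
    by (simp add: polarization_def ac_simps)
  have polarization_add: "polarization q (v + w) u = polarization q v u + polarization q w u + third_difference q v w u" for v w u
    by (simp add: polarization_def third_difference_def ac_simps)
  have d': "third_difference q v w d = third_difference q d v w" for v w
    by (simp add: third_difference_def ac_simps)
  obtain x y z t where v: "v = ((x, y, z), t)" by (metis prod.exhaust)
  show ?thesis
    unfolding v
    by (cases x; cases y; cases z; cases t)
      (simp_all add: q_add polarization_add d' abc d q0
        add.assoc[where 'a = bit] add.commute[where 'a = bit] add.left_commute[where 'a = bit])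
qed

lemma scale_bit_word: "scale_bit x v = (\<lambda>i. x * v i)" for v :: word2
  by (cases x) (auto simp: fun_eq_iff)

text \<open>This turns rank 4 into injectivity of the coordinate map.\<close>

lemma dim_le_3:
  fixes a b c d :: word2
  assumes "V \<subseteq> F2.span {a, b, c, d}" and a: "a = scale_bit y b + scale_bit z c + scale_bit t d"
  shows "F2.dim V \<le> 3"
proof -
  have "a \<in> F2.span {b, c, d}"
    unfolding a scale_bit_word by (intro F2.span_add F2.span_scale F2.span_base) auto
  then have "F2.span {a, b, c, d} = F2.span {b, c, d}"
    by (rule F2.span_redundant)
  then have "F2.dim V \<le> card {b, c, d}"
    using assms(1) by (intro F2.dim_le_card) auto
  also have "\<dots> \<le> 3" using card_length[of "[b, c, d]"] by simp
  finally show ?thesis .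
qed

lemma coded_loop_characteristic_vector:
  fixes L :: "'a signed_loop" and V :: "word2 set"
  assumes coded: "coded_loop L V h \<phi> q" and dim: "F2.dim V = 4"
    and char: "has_characteristic_vector L ls"
  shows "\<exists>h \<phi>. coded_loop L (UNIV :: v4 set) h \<phi> (cubic ls)"
proof -
  interpret coded_loop L V h \<phi> q by (rule coded)
  obtain xa xb xc xd where basis: "basis_mod_signs L [xa, xb, xc, xd]"
    and abc: "associator L xa xb xc = minus_one L"
    and assoc_d: "\<forall>x\<in>carrier L. \<forall>y\<in>carrier L. associator L xd x y = \<one>\<^bsub>L\<^esub>"
    and ls: "[xa \<otimes>\<^bsub>L\<^esub> xa, xb \<otimes>\<^bsub>L\<^esub> xb, xc \<otimes>\<^bsub>L\<^esub> xc, xd \<otimes>\<^bsub>L\<^esub> xd,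
         commutator L xa xb, commutator L xa xc, commutator L xa xd,
         commutator L xb xc, commutator L xb xd, commutator L xc xd] = map (sign_power L) ls"
    using char unfolding has_characteristic_vector_def by (elim exE conjE)
  have "set [xa, xb, xc, xd] \<subseteq> carrier L" using basis by (simp only: basis_mod_signs_def)
  then have carrier: "xa \<in> carrier L" "xb \<in> carrier L" "xc \<in> carrier L" "xd \<in> carrier L" by simp_all
  obtain ea a eb b ec c ed d where
    abcd: "a \<in> V" "b \<in> V" "c \<in> V" "d \<in> V" and x: "xa = h ea a" "xb = h eb b" "xc = h ec c" "xd = h ed d"
    using carrier by (metis carrierE)
  have sign_inj: "h e 0 = h f 0 \<longleftrightarrow> e = f" for e f
    by (simp add: h_inj zero_mem)
  have "map (\<lambda>e. h e 0) ls = map (\<lambda>e. h e 0)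
      [q a, q b, q c, q d, polarization q a b, polarization q a c, polarization q a d,
       polarization q b c, polarization q b d, polarization q c d]"
    using ls unfolding x sign_power_h[abs_def]
    by (simp add: square_h commutator_h abcd)
  then have ls_eq: "ls = [q a, q b, q c, q d, polarization q a b, polarization q a c, polarization q a d,
       polarization q b c, polarization q b d, polarization q c d]"
    by (rule map_injective) (simp add: inj_def sign_inj)
  have T_abc: "third_difference q a b c = 1"
    using abc unfolding x by (simp add: associator_h abcd h_minus_one sign_inj)
  have T_d: "third_difference q d v w = 0" if "v \<in> V" "w \<in> V" for v w
    using assoc_d[rule_format, OF h_closed[OF that(1), of 0] h_closed[OF that(2), of 0]] that
    unfolding x by (simp add: associator_h abcd h_one sign_inj)
  define g where "g = combination (a, b, c, d)"
  have g_add: "g (v + w) = g v + g w" for v w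
    unfolding g_def by (rule combination_add) (simp_all only: char2 abcd)
  have g0: "g 0 = 0" using g_add[of 0 0] by simp
  have scale_mem: "scale_bit e v \<in> V" if "v \<in> V" for e v
    using that zero_mem by (cases e) simp_all
  have g_mem: "g v \<in> V" for v
  proof -
    obtain x y z t where "v = ((x, y, z), t)" by (metis prod.exhaust)
    then show ?thesis by (simp add: g_def add_mem scale_mem abcd)
  qed
  have "V \<subseteq> range g"
  proof (rule basis_mod_signs_spans)
    show "basis_mod_signs L (map (\<lambda>(e, v). h e v) [(ea, a), (eb, b), (ec, c), (ed, d)])"
      using basis by (simp add: x)
    have "g ((1, 0, 0), 0) = a" "g ((0, 1, 0), 0) = b" "g ((0, 0, 1), 0) = c" "g ((0, 0, 0), 1) = d"
      by (simp_all add: g_def)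
    then show "snd ` set [(ea, a), (eb, b), (ec, c), (ed, d)] \<subseteq> range g"
      by (auto simp del: split_paired_All)
    show "range g \<subseteq> V" using g_mem by blast
    show "0 \<in> range g" using g0 by (metis rangeI)
    show "v + w \<in> range g" if "v \<in> range g" "w \<in> range g" for v w
      using that by (elim rangeE) (simp only: g_add[symmetric] rangeI)
  qed
  then have range: "range g = V" using g_mem by blast
  have span: "V \<subseteq> F2.span {a, b, c, d}"
  proof
    fix v assume "v \<in> V"
    then obtain x y z t where "v = g ((x, y, z), t)"
      using \<open>V \<subseteq> range g\<close> by (metis prod.exhaust rangeE subsetD)
    then have v: "v = scale_bit x a + scale_bit y b + scale_bit z c + scale_bit t d" by (simp add: g_def)
    show "v \<in> F2.span {a, b, c, d}"
      unfolding v scale_bit_word by (intro F2.span_add F2.span_scale F2.span_base) auto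
  qed
  \<comment> \<open>A vanishing combination with a coefficient 1 expresses that generator by the
    other three, against dimension 4; there is one case for each coefficient.\<close>
  have kernel: "v = 0" if "g v = 0" for v
  proof -
    obtain x y z t where v: "v = ((x, y, z), t)" by (metis prod.exhaust)
    have zero: "scale_bit x a + scale_bit y b + scale_bit z c + scale_bit t d = 0"
      using that by (simp add: v g_def)
    have move: "u = w" if "u + w = 0" "u \<in> V" "w \<in> V" for u w
      using add_eq_zero_iff[OF that(2,3)] that(1) by simp
    have "x \<noteq> 1"
    proof
      assume "x = 1"
      then have "a + (scale_bit y b + scale_bit z c + scale_bit t d) = 0"
        using zero by (simp only: scale_bit_simps ac_simps)
      then have "a = scale_bit y b + scale_bit z c + scale_bit t d"
        by (rule move) (intro add_mem scale_mem abcd)+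
      moreover have "V \<subseteq> F2.span {a, b, c, d}"
        using span by (simp only: insert_commute)
      ultimately have "F2.dim V \<le> 3" by (intro dim_le_3)
      then show False using dim by simp
    qed
    moreover have "y \<noteq> 1"
    proof
      assume "y = 1"
      then have "b + (scale_bit x a + scale_bit z c + scale_bit t d) = 0"
        using zero by (simp only: scale_bit_simps ac_simps)
      then have "b = scale_bit x a + scale_bit z c + scale_bit t d"
        by (rule move) (intro add_mem scale_mem abcd)+
      moreover have "V \<subseteq> F2.span {b, a, c, d}"
        using span by (simp only: insert_commute)
      ultimately have "F2.dim V \<le> 3" by (intro dim_le_3)
      then show False using dim by simp
    qed
    moreover have "z \<noteq> 1"
    proof
      assume "z = 1"
      then have "c + (scale_bit x a + scale_bit y b + scale_bit t d) = 0"
        using zero by (simp only: scale_bit_simps ac_simps)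
      then have "c = scale_bit x a + scale_bit y b + scale_bit t d"
        by (rule move) (intro add_mem scale_mem abcd)+
      moreover have "V \<subseteq> F2.span {c, a, b, d}"
        using span by (simp only: insert_commute)
      ultimately have "F2.dim V \<le> 3" by (intro dim_le_3)
      then show False using dim by simp
    qed
    moreover have "t \<noteq> 1"
    proof
      assume "t = 1"
      then have "d + (scale_bit x a + scale_bit y b + scale_bit z c) = 0"
        using zero by (simp only: scale_bit_simps ac_simps)
      then have "d = scale_bit x a + scale_bit y b + scale_bit z c"
        by (rule move) (intro add_mem scale_mem abcd)+
      moreover have "V \<subseteq> F2.span {d, a, b, c}"
        using span by (simp only: insert_commute)
      ultimately have "F2.dim V \<le> 3" by (intro dim_le_3)
      then show False using dim by simp
    qed
    ultimately show ?thesis by (simp add: v zero_prod_def)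
  qed
  have "inj g"
  proof (rule injI)
    fix v w assume "g v = g w"
    then have "g (v + w) = 0" using char2[OF g_mem[of w]] by (simp only: g_add)
    then have "v + w = 0" by (rule kernel)
    then have "v + (w + w) = w" by (simp only: add.assoc[symmetric] add_0)
    then show "v = w" by simp
  qed
  then have "bij_betw g UNIV V" using range by (simp add: bij_betw_def)
  from change_coordinates[OF this g_add]
  have "coded_loop L UNIV (\<lambda>e x. h e (g x)) (\<lambda>x y. \<phi> (g x) (g y)) (\<lambda>x. q (g x))" .
  moreover have "(\<lambda>x. q (g x)) = cubic ls"
    unfolding g_def ls_eq by (rule ext, rule form_combination) (simp_all add: T_abc T_d abcd add_mem q_zero)
  ultimately show ?thesis by (metis (full_types))
qed

lemma Out_C4_iso:
  assumes "is_C4 i L"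
  shows "Out L \<cong> Out_form i"
proof -
  obtain V h \<phi> q where "coded_loop L (V :: word2 set) h \<phi> q" "F2.dim V = 4"
    using assms code_loop_coded[of 4 L] unfolding is_C4_def by blast
  then obtain h \<phi> where coded: "coded_loop L (UNIV :: v4 set) h \<phi> (C4_form i)"
    using assms coded_loop_characteristic_vector[of L V h \<phi> q "C4_vectors ! (i - 1)"] unfolding is_C4_def by blast
  \<comment> \<open>The monomial xyz has coefficient 1 in every form.\<close>
  have "third_difference (C4_form i) ((1, 0, 0), 0) ((0, 1, 0), 0) ((0, 0, 1), 0) = 1"
    by (simp add: third_difference_cubic)
  then have "coded_loop_UNIV L h \<phi> (C4_form i)"
    using coded finite_v4 by (intro coded_loop_UNIV.intro coded_loop_UNIV_axioms.intro) (assumption | blast)+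
  then show ?thesis by (rule coded_loop_UNIV.Out_iso)
qed

theorem proposition7:
  fixes L :: "'a signed_loop"
  shows "(is_C4 1 L \<longrightarrow> is_semidirect (Out L) Z2_cubed GL3_2) \<and>
    (is_C4 2 L \<longrightarrow> is_semidirect (Out L) Z2_cubed (sym_group 4)) \<and>
    (is_C4 3 L \<longrightarrow> is_semidirect (Out L) Z2_cubed (sym_group 4)) \<and>
    (is_C4 4 L \<longrightarrow> is_semidirect (Out L) Z2_cubed D8) \<and>
    (is_C4 5 L \<longrightarrow> Out L \<cong> sym_group 4 \<times>\<times> Z2) \<and>
    (is_C4 6 L \<longrightarrow> Out L \<cong> GL3_2) \<and>
    (is_C4 7 L \<longrightarrow> Out L \<cong> sym_group 4) \<and>
    (is_C4 8 L \<longrightarrow> Out L \<cong> sym_group 4) \<and>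
    (is_C4 9 L \<longrightarrow> Out L \<cong> D8) \<and>
    (is_C4 10 L \<longrightarrow> Out L \<cong> sym_group 3 \<times>\<times> Z2) \<and>
    (is_C4 11 L \<longrightarrow> Out L \<cong> sym_group 3 \<times>\<times> Z2) \<and>
    (is_C4 12 L \<longrightarrow> Out L \<cong> D8) \<and>
    (is_C4 13 L \<longrightarrow> Out L \<cong> sym_group 4) \<and>
    (is_C4 14 L \<longrightarrow> is_semidirect (Out L) Z2_cubed (sym_group 3)) \<and>
    (is_C4 15 L \<longrightarrow> is_semidirect (Out L) Z2_cubed (sym_group 3)) \<and>
    (is_C4 16 L \<longrightarrow> Out L \<cong> Z2_cubed)"
  by (intro conjI impI;
      rule is_semidirect_iso_left iso_trans, erule Out_C4_iso,
      rule Out_1 Out_2 Out_3 Out_4 Out_5 Out_6 Out_7 Out_8 Out_9 Out_10 Out_11 Out_12 Out_13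
        Out_14 Out_15 Out_16)

end
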